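(* Let $\mathcal X:y^n=f(x)$ be a superelliptic curve over $\mathbb F_q$ with split ramification as in the context, and let $s\ge1$. Then $G_s\not\le A_s$ for every $s$ (so no $\mathcal C_s$ is self-orthogonal by the divisorial criterion $G_s\le A_s$), while $$A_s\le G_s\quad\Longleftrightarrow\quad 2s\ge M.$$ When $2s\ge M$ the code $\mathcal C_s$ contains its dual, $\varepsilon(G_s,A_s)=0$, and $$\operatorname{Hull}(\mathcal C_s)=\mathcal C_s^\perp,\qquad\dim\operatorname{Hull}(\mathcal C_s)=N-\dim\mathcal C_s.$$
   Context: Setting. $q$ is a power of a prime $p$; $n\ge2$, $d\ge3$ are integers with $n\mid q-1$ (so $p\nmid n$); $c=\gcd(n,d)$; $f\in\mathbb F_q[x]$ has degree $d$ and splits into $d$ distinct linear factors over $\mathbb F_q$. $\mathcal X$ is the smooth projective model of $y^n=f(x)$ over $\mathbb F_q$, and $\pi:\mathcal X\to\mathbb P^1$, $(x,y)\mapsto x$. $\mathrm{Ram}=\sum_{f(a)=0}Q_a$ with $Q_a$ the unique point over the root $a$; $D_\infty$ is the reduced divisor of the $c$ geometric points over $x=\infty$. $D$ is the sum of all $\mathbb F_q$-rational points of $\mathcal X$ lying over $\mathbb A^1(\mathbb F_q)$ and not on $\mathrm{Ram}$, $N=\deg D$. $\Delta=\{a\in\mathbb F_q:f(a)\ne0,\ f(a)\notin(\mathbb F_q^* )^n\}$ and $E=\pi^*(\Delta)$. Codes. $L(G)=\{h\in\mathbb F_q(\mathcal X)^*:\operatorname{div}(h)+G\ge0\}\cup\{0\}$;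 for $G$ with support disjoint from $\operatorname{Supp} D$, $C_L(D,G)\subseteq\mathbb F_q^N$ is the image of evaluation of $L(G)$ at the points of $D$. For $s\ge1$: $G_s=sD_\infty$, $\mathcal C_s=C_L(D,G_s)$, $M=\frac{(q-1)n}{c}-1$, and $A_s=D-G_s+\operatorname{div}(\eta)=-\mathrm{Ram}-E+(M-s)D_\infty$ with $\eta=-dx/(x^q-x)$, so that $\mathcal C_s^\perp=C_L(D,A_s)$. $C^\perp$ is the dual for the standard bilinear form and $\operatorname{Hull}(C)=C\cap C^\perp$. $\vee$ is the coefficientwise maximum of divisors, and the excess of a pair $(G,A)$ is $$\varepsilon(G,A)=\dim_{\mathbb F_q}\frac{(L(G)+L(A))\cap L(G\vee A-D)}{L(G-D)+L(A-D)}.$$ *)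

theory Defs
  imports
    "HOL-Computational_Algebra.Polynomial"
    "HOL-Library.Function_Algebras"
    "HOL-Library.Extended_Nat"
    "HOL-Library.Cardinality"
begin

section \<open>The function field of a superelliptic curve\<close>

definition bivariate_eval ::
    "('a::field \<Rightarrow> 'k::field) \<Rightarrow> 'k \<Rightarrow> 'k \<Rightarrow> 'a poly poly \<Rightarrow> 'k" where
  "bivariate_eval \<iota> x y B = poly (map_poly (\<lambda>g. poly (map_poly \<iota> g) x) B) y"

text \<open>
  The type \<open>'k\<close> is the function field of \<open>y^n = f(x)\<close> over the field \<open>'a\<close> of constants, which is
  embedded by \<open>\<iota>\<close>: it is generated by \<open>x\<close> and \<open>y\<close> as a field over the constants, \<open>x\<close> is
  transcendental, and \<open>y^n = f(x)\<close>. If \<open>Y^n - f\<close> is irreducible over the rational function field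
  (as it is when \<open>f\<close> has a simple root), this determines \<open>'k\<close> up to isomorphism over the
  constants, as the fraction field of the affine coordinate ring.
\<close>

locale superelliptic_function_field =
  fixes \<iota> :: "'a::field \<Rightarrow> 'k::field" and n :: nat and f :: "'a poly" and x y :: 'k
  assumes embed_one: "\<iota> 1 = 1"
    and embed_add: "\<iota> (a + b) = \<iota> a + \<iota> b"
    and embed_mult: "\<iota> (a * b) = \<iota> a * \<iota> b"
    and x_transcendental: "poly (map_poly \<iota> g) x = 0 \<Longrightarrow> g = 0"
    and curve_equation: "y ^ n = poly (map_poly \<iota> f) x"
    and generated:
      "\<exists>A B. bivariate_eval \<iota> x y B \<noteq> 0 \<and> h = bivariate_eval \<iota> x y A / bivariate_eval \<iota> x y B"

section \<open>Closed points and divisors\<close>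

text \<open>
  The closed points of the smooth projective model are the places of the function field, given by
  their normalised discrete valuations. The valuation of \<open>0\<close> should be infinite; the
  value \<open>0\<close> is prescribed there instead, so that distinct functions are distinct places.
\<close>

type_synonym 'k point = "'k \<Rightarrow> int"

definition places :: "('a::field \<Rightarrow> 'k::field) \<Rightarrow> 'k point set" where
  "places \<iota> = {v. v 0 = 0
     \<and> (\<forall>g h. g \<noteq> 0 \<longrightarrow> h \<noteq> 0 \<longrightarrow> v (g * h) = v g + v h)
     \<and> (\<forall>g h. g \<noteq> 0 \<longrightarrow> h \<noteq> 0 \<longrightarrow> g + h \<noteq> 0 \<longrightarrow> min (v g) (v h) \<le> v (g + h))
     \<and> (\<forall>a. a \<noteq> 0 \<longrightarrow> v (\<iota> a) = 0)
     \<and> (\<exists>t. t \<noteq> 0 \<and> v t = 1)}"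

definition regular_at :: "'k::field point \<Rightarrow> 'k \<Rightarrow> bool" where
  "regular_at P h \<longleftrightarrow> h = 0 \<or> 0 \<le> P h"

definition vanishes_at :: "'k::field point \<Rightarrow> 'k \<Rightarrow> bool" where
  "vanishes_at P h \<longleftrightarrow> h = 0 \<or> 0 < P h"

text \<open>The residue field at \<open>P\<close> is the field of constants.\<close>

definition rational_place :: "('a::field \<Rightarrow> 'k::field) \<Rightarrow> 'k point \<Rightarrow> bool" where
  "rational_place \<iota> P \<longleftrightarrow>
     P \<in> places \<iota> \<and> (\<forall>h. regular_at P h \<longrightarrow> (\<exists>a. vanishes_at P (h - \<iota> a)))"

text \<open>The value at a rational place of a function regular there.\<close>

definition value_at :: "('a::field \<Rightarrow> 'k::field) \<Rightarrow> 'k point \<Rightarrow> 'k \<Rightarrow> 'a" where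
  "value_at \<iota> P h = (THE a. vanishes_at P (h - \<iota> a))"

text \<open>
  A divisor is an integer-valued function on the places, extended by \<open>0\<close> to the whole function
  type. Addition, subtraction, \<open>\<le>\<close> and \<open>sup\<close> of divisors are the
  pointwise operations on functions.
\<close>

type_synonym 'k divisor = "'k point \<Rightarrow> int"

definition Supp :: "'k divisor \<Rightarrow> 'k point set" where
  "Supp G = {P. G P \<noteq> 0}"

definition principal_divisor :: "('a::field \<Rightarrow> 'k::field) \<Rightarrow> 'k \<Rightarrow> 'k divisor" where
  "principal_divisor \<iota> h = (\<lambda>P. if P \<in> places \<iota> then P h else 0)"

definition RR_space :: "('a::field \<Rightarrow> 'k::field) \<Rightarrow> 'k divisor \<Rightarrow> 'k set" where
  "RR_space \<iota> G = {h. h \<noteq> 0 \<and> 0 \<le> principal_divisor \<iota> h + G} \<union> {0}"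

section \<open>Dimensions of quotients, degrees\<close>

text \<open>\<open>B\<close> maps bijectively to a basis of the quotient space \<open>U / W\<close>.\<close>

definition quotient_basis ::
    "('a::field \<Rightarrow> 'v::ab_group_add \<Rightarrow> 'v) \<Rightarrow> 'v set \<Rightarrow> 'v set \<Rightarrow> 'v set \<Rightarrow> bool" where
  "quotient_basis scl U W B \<longleftrightarrow> B \<subseteq> U
     \<and> (\<forall>F u. finite F \<longrightarrow> F \<subseteq> B \<longrightarrow> (\<Sum>b\<in>F. scl (u b) b) \<in> W \<longrightarrow> (\<forall>b\<in>F. u b = 0))
     \<and> (\<forall>h\<in>U. \<exists>F u. finite F \<and> F \<subseteq> B \<and> h - (\<Sum>b\<in>F. scl (u b) b) \<in> W)"

definition quotient_dim ::
    "('a::field \<Rightarrow> 'v::ab_group_add \<Rightarrow> 'v) \<Rightarrow> 'v set \<Rightarrow> 'v set \<Rightarrow> enat" where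
  "quotient_dim scl U W =
     (if \<exists>B. finite B \<and> quotient_basis scl U W B
      then enat (card (SOME B. finite B \<and> quotient_basis scl U W B)) else \<infinity>)"

definition field_scale :: "('a::field \<Rightarrow> 'k::field) \<Rightarrow> 'a \<Rightarrow> 'k \<Rightarrow> 'k" where
  "field_scale \<iota> a h = \<iota> a * h"

definition place_degree :: "('a::field \<Rightarrow> 'k::field) \<Rightarrow> 'k point \<Rightarrow> nat" where
  "place_degree \<iota> P =
     the_enat (quotient_dim (field_scale \<iota>) {h. regular_at P h} {h. vanishes_at P h})"

definition divisor_degree :: "('a::field \<Rightarrow> 'k::field) \<Rightarrow> 'k divisor \<Rightarrow> int" where
  "divisor_degree \<iota> G = (\<Sum>P\<in>Supp G. G P * int (place_degree \<iota> P))"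

section \<open>The divisor of a differential\<close>

definition derivation_over :: "('a::field \<Rightarrow> 'k::field) \<Rightarrow> ('k \<Rightarrow> 'k) \<Rightarrow> bool" where
  "derivation_over \<iota> \<delta> \<longleftrightarrow> (\<forall>a. \<delta> (\<iota> a) = 0)
     \<and> (\<forall>g h. \<delta> (g + h) = \<delta> g + \<delta> h)
     \<and> (\<forall>g h. \<delta> (g * h) = g * \<delta> h + h * \<delta> g)"

text \<open>\<open>d/dx\<close>, for a separating element \<open>x\<close>.\<close>

definition ddx :: "('a::field \<Rightarrow> 'k::field) \<Rightarrow> 'k \<Rightarrow> 'k \<Rightarrow> 'k" where
  "ddx \<iota> x = (THE \<delta>. derivation_over \<iota> \<delta> \<and> \<delta> x = 1)"

text \<open>
  The divisor of \<open>g dx\<close>: if \<open>t\<close> is a uniformiser at \<open>P\<close>, then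
  \<open>g dx = (g / (dt/dx)) dt\<close>, and the order of \<open>g dx\<close> at \<open>P\<close> is the valuation
  of the coefficient of \<open>dt\<close>.
\<close>

definition differential_divisor ::
    "('a::field \<Rightarrow> 'k::field) \<Rightarrow> 'k \<Rightarrow> 'k \<Rightarrow> 'k divisor" where
  "differential_divisor \<iota> x g = (\<lambda>P. if P \<in> places \<iota>
     then P (g / ddx \<iota> x (SOME t. P t = 1)) else 0)"

section \<open>Evaluation codes\<close>

text \<open>
  The coordinates of a word are indexed by the points in the support of \<open>D\<close> rather than by
  \<open>1, ..., N\<close>; words are extended by \<open>0\<close> to the whole function type.
\<close>

type_synonym ('k, 'a) codeword = "'k point \<Rightarrow> 'a"

definition word_space :: "'k divisor \<Rightarrow> ('k, 'a::field) codeword set" where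
  "word_space D = {w. \<forall>P. P \<notin> Supp D \<longrightarrow> w P = 0}"

definition AG_code ::
    "('a::field \<Rightarrow> 'k::field) \<Rightarrow> 'k divisor \<Rightarrow> 'k divisor \<Rightarrow> ('k, 'a) codeword set" where
  "AG_code \<iota> D G = (\<lambda>h P. if P \<in> Supp D then value_at \<iota> P h else 0) ` RR_space \<iota> G"

definition dual_code ::
    "'k divisor \<Rightarrow> ('k, 'a::field) codeword set \<Rightarrow> ('k, 'a) codeword set" where
  "dual_code D C = {w \<in> word_space D. \<forall>v\<in>C. (\<Sum>P\<in>Supp D. w P * v P) = 0}"

definition Hull ::
    "'k divisor \<Rightarrow> ('k, 'a::field) codeword set \<Rightarrow> ('k, 'a) codeword set" where
  "Hull D C = C \<inter> dual_code D C"

definition word_scale :: "'a::field \<Rightarrow> ('k, 'a) codeword \<Rightarrow> ('k, 'a) codeword" where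
  "word_scale a w = (\<lambda>P. a * w P)"

lemma vector_space_word_scale: "vector_space word_scale"
  by unfold_locales (auto simp: word_scale_def fun_eq_iff algebra_simps)

definition code_dim :: "('k, 'a::field) codeword set \<Rightarrow> nat" where
  "code_dim C = vector_space.dim word_scale C"

definition subspace_sum :: "'k::field set \<Rightarrow> 'k set \<Rightarrow> 'k set" where
  "subspace_sum U V = {u + v | u v. u \<in> U \<and> v \<in> V}"

definition excess ::
    "('a::field \<Rightarrow> 'k::field) \<Rightarrow> 'k divisor \<Rightarrow> 'k divisor \<Rightarrow> 'k divisor \<Rightarrow> enat" where
  "excess \<iota> D G A = quotient_dim (field_scale \<iota>)
     (subspace_sum (RR_space \<iota> G) (RR_space \<iota> A) \<inter> RR_space \<iota> (sup G A - D))
     (subspace_sum (RR_space \<iota> (G - D)) (RR_space \<iota> (A - D)))"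

section \<open>The divisors attached to a superelliptic curve\<close>

text \<open>
  The sum of the places over \<open>x = \<infinity>\<close>, each with coefficient \<open>1\<close>; over an algebraic
  closure of the constants it becomes the reduced divisor of the geometric points over \<open>\<infinity>\<close>.
\<close>

definition D_infinity :: "('a::field \<Rightarrow> 'k::field) \<Rightarrow> 'k \<Rightarrow> 'k divisor" where
  "D_infinity \<iota> x = (\<lambda>P. if P \<in> places \<iota> \<and> P x < 0 then 1 else 0)"

text \<open>
  The sum of the rational points lying over some rational point \<open>a\<close> of the affine line with
  \<open>f(a) \<noteq> 0\<close>, i.e. away from the ramification points over the roots of \<open>f\<close>.
\<close>

definition D_evaluation :: "('a::field \<Rightarrow> 'k::field) \<Rightarrow> 'a poly \<Rightarrow> 'k \<Rightarrow> 'k divisor" where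
  "D_evaluation \<iota> f x = (\<lambda>P. if rational_place \<iota> P
     \<and> (\<exists>a. vanishes_at P (x - \<iota> a) \<and> poly f a \<noteq> 0) then 1 else 0)"

text \<open>The divisor of \<open>\<eta> = -dx / (x^q - x)\<close>, where \<open>q\<close> is the number of constants.\<close>

definition div_eta :: "('a::{finite,field} \<Rightarrow> 'k::field) \<Rightarrow> 'k \<Rightarrow> 'k divisor" where
  "div_eta \<iota> x = differential_divisor \<iota> x (- 1 / (x ^ CARD('a) - x))"

definition G_divisor :: "('a::field \<Rightarrow> 'k::field) \<Rightarrow> 'k \<Rightarrow> nat \<Rightarrow> 'k divisor" where
  "G_divisor \<iota> x s = (\<lambda>P. int s * D_infinity \<iota> x P)"

definition A_divisor ::
    "('a::{finite,field} \<Rightarrow> 'k::field) \<Rightarrow> 'a poly \<Rightarrow> 'k \<Rightarrow> nat \<Rightarrow> 'k divisor" where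
  "A_divisor \<iota> f x s = D_evaluation \<iota> f x - G_divisor \<iota> x s + div_eta \<iota> x"

end

theory Submission
  imports Defs
begin

text \<open>
  That the code contains its dual is a computation with explicit monomials. The evaluation points
  over \<open>a\<close> are the pairs \<open>(a, b)\<close> with \<open>b^n = f(a)\<close>, a coset of the group of \<open>n\<close>-th roots
  of unity. The space \<open>L(s D_infinity)\<close> contains the monomials \<open>x^i y^j\<close> with
  \<open>i e + j d' \<le> s\<close>, where \<open>e = n/c\<close> and \<open>d' = d/c\<close> are the pole orders of \<open>x\<close> and \<open>y\<close> over
  infinity. A Fourier transform on the fibres decomposes a word orthogonal to these monomials into
  words \<open>h_j(a) b^j\<close> with \<open>0 \<le> j < n\<close>, and orthogonality says that the first moments over the
  field of \<open>h_0\<close>, or of \<open>f h_j\<close> for \<open>j > 0\<close>, vanish. The interpolation formula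
  \<open>\<Sum>a. u(a) (1 - (X - a)^(q-1))\<close> turns vanishing moments into a bound on the degree
  (\<open>interpolation_moments\<close>), and \<open>2 s \<ge> M\<close> is what makes every \<open>x^i y^j\<close> that can still occur a
  monomial of the code (\<open>orthogonal_expansion\<close>, \<open>dual_code_subset\<close>). The dimension formula is then
  linear algebra (\<open>dim_dual_code\<close>), and the excess vanishes because \<open>A \<le> G\<close> makes its numerator
  part of its denominator (\<open>excess_eq_0\<close>).

  The comparison of the divisors requires the order of \<open>dx\<close> at every place, and the existence of
  places over infinity and over a root of \<open>f\<close>. Both rest on one criterion for a local ring of the
  curve to have principal maximal ideal (\<open>nonunits_unif_ideal\<close>): if \<open>\<pi>\<close> divides \<open>s^Q - s\<close> and
  \<open>t^Q - t\<close> for two generators and a power \<open>Q\<close> of \<open>q\<close>, then it divides \<open>a^Q - a\<close> for every \<open>a\<close>,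
  since the Frobenius map is additive; and \<open>a^Q - a\<close> is a unit times \<open>a\<close> when \<open>a\<close> vanishes at the
  point. It applies with \<open>\<pi> = x^Q - x\<close> at the finite places away from the roots of \<open>f\<close>, with
  \<open>\<pi> = y\<close> over the roots, and over infinity with a monomial in \<open>x\<close> and \<open>y\<close> of order one. A
  derivation that is regular on the generators and invertible on \<open>\<pi>\<close> is invertible on every
  uniformiser (\<open>derivation_order\<close>), which gives the orders of \<open>dx\<close> as \<open>0\<close>, \<open>n - 1\<close> and
  \<open>- e - 1\<close>. So \<open>A\<close> is negative over the roots, whence \<open>G\<close> is never below \<open>A\<close>; it is \<open>M - s\<close> over
  infinity and at most \<open>0\<close> at all other places, so that \<open>A \<le> G\<close> is decided over infinity.

  Places exist because Zorn's lemma provides valuation rings in which a given transcendental element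
  is not invertible (\<open>exists_valuation_ring\<close>), and the criterion makes them discrete. The powers
  \<open>1, y, \<dots>, y^(n-1)\<close> are independent over \<open>k(x)\<close>, as one sees over a root of \<open>f\<close>
  (\<open>independent_powers_y\<close>); this yields the automorphisms \<open>y \<mapsto> \<zeta> y\<close>, which move the evaluation
  points along the fibres, and the derivation \<open>d/dx\<close>.
\<close>

section \<open>Finite fields and roots of unity\<close>

text \<open>Multiplication by \<open>a\<close> permutes the nonzero elements and multiplies their product by \<open>a^(q-1)\<close>.\<close>

lemma power_card_field:
  fixes a :: "'a::{finite,field}"
  shows "a ^ CARD('a) = a"
proof (cases "a = 0")
  case False
  have "(\<Prod>b\<in>-{0}. b) = (\<Prod>b\<in>-{0}. a * b)"
    by (rule prod.reindex_bij_witness[of _ "\<lambda>b. a * b" "\<lambda>b. b / a"]) (use False in auto)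
  also have "\<dots> = a ^ (CARD('a) - 1) * (\<Prod>b\<in>-{0}. b)"
    by (simp add: prod.distrib card_Diff_singleton Compl_eq_Diff_UNIV)
  finally have "a ^ (CARD('a) - 1) = 1"
    by (simp add: prod_zero_iff)
  then have "a * a ^ (CARD('a) - 1) = a" by simp
  then show ?thesis
    by (metis finite_UNIV_card_ge_0 finite power_eq_if less_numeral_extra(3))
qed simp

lemma card_field_ge_2: "CARD('a::{finite,field}) \<ge> 2"
proof -
  have "card {0, 1 :: 'a} \<le> CARD('a)" by (rule card_mono) auto
  then show ?thesis by simp
qed

lemma power_card_minus_1_field:
  fixes a :: "'a::{finite,field}"
  assumes "a \<noteq> 0"
  shows "a ^ (CARD('a) - 1) = 1"
proof -
  have "a * a ^ (CARD('a) - 1) = a * 1"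
    using power_card_field[of a] card_field_ge_2[where 'a = 'a]
    by (simp add: power_eq_if)
  then show ?thesis using assms by simp
qed

lemma card_zeros_le_degree:
  fixes p :: "'a::field poly"
  assumes "p \<noteq> 0" "\<And>a. a \<in> A \<Longrightarrow> poly p a = 0"
  shows "card A \<le> degree p"
proof -
  have "card A \<le> card {a. poly p a = 0}"
    using assms by (intro card_mono poly_roots_finite) auto
  also have "\<dots> \<le> degree p" by (rule card_poly_roots_bound[OF assms(1)])
  finally show ?thesis .
qed

text \<open>
  The polynomial \<open>(X + 1)^q - X^q - 1\<close> has degree less than \<open>q\<close> and vanishes on the whole field,
  so it is zero.
\<close>

lemma of_nat_choose_card_eq_0:
  assumes "0 < k" "k < CARD('a::{finite,field})"
  shows "of_nat (CARD('a) choose k) = (0 :: 'a)"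
proof -
  let ?q = "CARD('a)"
  define p where "p = (\<Sum>i\<in>{0<..<?q}. monom (of_nat (?q choose i) :: 'a) i)"
  have "poly p a = 0" for a
  proof -
    have set: "{..?q} = insert 0 (insert ?q {0<..<?q})"
      by auto
    have "(a + 1) ^ ?q = (\<Sum>i\<le>?q. of_nat (?q choose i) * a ^ i)"
      by (simp add: binomial_ring)
    also have "\<dots> = 1 + (a ^ ?q + (\<Sum>i\<in>{0<..<?q}. of_nat (?q choose i) * a ^ i))"
      unfolding set by (subst sum.insert; (subst sum.insert)?) auto
    finally show ?thesis
      by (simp add: power_card_field p_def poly_sum poly_monom)
  qed
  moreover have "degree p < ?q"
    unfolding p_def by (rule degree_sum_less) (auto intro: le_less_trans[OF degree_monom_le])
  ultimately have "p = 0"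
    using card_zeros_le_degree[of p UNIV] by fastforce
  moreover have "coeff p k = of_nat (?q choose k)"
    unfolding p_def coeff_sum using assms by (simp add: sum.delta)
  ultimately show ?thesis by simp
qed

lemma of_nat_card_eq_0: "of_nat CARD('a::{finite,field}) = (0 :: 'a)"
  using of_nat_choose_card_eq_0[where 'a = 'a, of 1] card_field_ge_2[where 'a = 'a] by simp

lemma of_nat_dvd_card_minus_1:
  assumes "n dvd CARD('a::{finite,field}) - 1"
  shows "of_nat n \<noteq> (0 :: 'a)"
proof
  assume n0: "of_nat n = (0 :: 'a)"
  obtain m where m: "CARD('a) - 1 = n * m" using assms by (auto elim: dvdE)
  have "of_nat CARD('a) = (of_nat (n * m + 1) :: 'a)"
    unfolding m[symmetric] using card_field_ge_2[where 'a = 'a] by simp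
  then show False using n0 by (simp add: of_nat_card_eq_0)
qed

definition unity_roots :: "nat \<Rightarrow> 'a::field set" where
  "unity_roots n = {z. z ^ n = 1}"

lemma monom_minus_1_nonzero:
  assumes "n > 0"
  shows "monom (1::'a::field) n - 1 \<noteq> 0"
proof
  assume "monom (1::'a) n - 1 = 0"
  then have "coeff (monom (1::'a) n - 1) n = 0" by simp
  then show False using assms by (simp add: coeff_1)
qed

lemma degree_monom_minus_1: "degree (monom (1::'a::field) n - 1) \<le> n"
  by (rule degree_diff_le) (auto simp: degree_monom_le)

lemma poly_monom_minus_1: "z \<in> unity_roots n \<Longrightarrow> poly (monom 1 n - 1) z = 0"
  by (simp add: unity_roots_def poly_monom)

lemma finite_unity_roots:
  assumes "n > 0"
  shows "finite (unity_roots n :: 'a::field set)"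
proof (rule finite_subset)
  show "unity_roots n \<subseteq> {z::'a. poly (monom 1 n - 1) z = 0}"
    using poly_monom_minus_1 by blast
  show "finite {z::'a. poly (monom 1 n - 1) z = 0}"
    by (rule poly_roots_finite[OF monom_minus_1_nonzero[OF assms]])
qed

lemma card_unity_roots_le:
  assumes "n > 0"
  shows "card (unity_roots n :: 'a::field set) \<le> n"
  using card_zeros_le_degree[OF monom_minus_1_nonzero[OF assms] poly_monom_minus_1]
    degree_monom_minus_1[of n, where 'a = 'a] by (rule order.trans)

text \<open>
  The cofactor of \<open>X^n - 1\<close> in \<open>X^(q-1) - 1\<close> has at most \<open>q - 1 - n\<close> of the \<open>q - 1\<close> zeros.
\<close>

lemma card_unity_roots:
  assumes n: "n dvd CARD('a::{finite,field}) - 1"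
  shows "card (unity_roots n :: 'a set) = n"
proof -
  let ?q = "CARD('a)"
  obtain m where m: "?q - 1 = n * m" using n by (auto elim: dvdE)
  have q: "?q \<ge> 2" by (rule card_field_ge_2)
  then have n0: "n > 0" and m0: "m > 0" using m by (auto intro!: Nat.gr0I)
  define g where "g = (\<Sum>i<m. monom (1::'a) (n * i))"
  have "coeff g 0 = 1"
    unfolding g_def coeff_sum using n0 m0 by (simp add: coeff_monom sum.delta)
  then have g0: "g \<noteq> 0" by auto
  have dg: "degree g \<le> n * (m - 1)"
    unfolding g_def by (rule degree_sum_le) (auto intro!: order.trans[OF degree_monom_le])
  have "- {0} - unity_roots n \<subseteq> {a. poly g a = 0}"
  proof
    fix a :: 'a assume a: "a \<in> - {0} - unity_roots n"
    have "(a ^ n - 1) * poly g a = (a ^ n) ^ m - 1"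
      by (simp add: g_def poly_sum poly_monom power_mult geometric_sum power_diff_1_eq)
    also have "\<dots> = 0"
      using a power_card_minus_1_field[of a] by (simp add: m[symmetric] power_mult[symmetric] del: One_nat_def)
    finally show "a \<in> {a. poly g a = 0}" using a by (simp add: unity_roots_def)
  qed
  then have "card (- {0 :: 'a} - unity_roots n) \<le> n * (m - 1)"
    by (intro order.trans[OF card_zeros_le_degree[OF g0] dg]) auto
  moreover have "card (- {0 :: 'a}) \<le> card (- {0 :: 'a} - unity_roots n) + card (unity_roots n :: 'a set)"
    using card_Un_le[of "- {0 :: 'a} - unity_roots n" "unity_roots n"]
      card_mono[of "(- {0 :: 'a} - unity_roots n) \<union> unity_roots n" "- {0}"] by fastforce
  moreover have "card (- {0 :: 'a}) = n * m"
    using m by (simp add: card_Diff_singleton Compl_eq_Diff_UNIV)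
  moreover have "n * m = n * (m - 1) + n" using m0 by (cases m) auto
  ultimately have "n \<le> card (unity_roots n :: 'a set)" by linarith
  then show ?thesis using card_unity_roots_le[OF n0] by (metis antisym)
qed

text \<open>
  If \<open>n\<close> does not divide \<open>j\<close>, some \<open>n\<close>-th root of unity \<open>w\<close> has \<open>w^j \<noteq> 1\<close>, because there are too many
  of them to be roots of unity of order \<open>j mod n\<close>; the sum is invariant under multiplication by
  \<open>w^j\<close>.
\<close>

lemma sum_power_unity_roots:
  assumes n: "n dvd CARD('a::{finite,field}) - 1"
  shows "(\<Sum>z\<in>unity_roots n. z ^ j) = (if n dvd j then of_nat n else (0 :: 'a))"
proof (cases "n dvd j")
  case True
  then have "z ^ j = 1" if "z \<in> unity_roots n" for z :: 'a
    using that by (auto simp: unity_roots_def power_mult elim!: dvdE)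
  then show ?thesis using True by (simp add: card_unity_roots[OF n])
next
  case False
  have q: "CARD('a) \<ge> 2" by (rule card_field_ge_2)
  then have n0: "n > 0" using n by (auto intro!: Nat.gr0I)
  let ?r = "j mod n"
  have r: "?r > 0" "?r < n" using False n0 by (auto simp: mod_greater_zero_iff_not_dvd)
  have zj: "z ^ j = z ^ ?r" if "z \<in> unity_roots n" for z :: 'a
  proof -
    have "z ^ j = z ^ (n * (j div n) + ?r)" by simp
    also have "\<dots> = z ^ ?r" using that by (simp only: power_add power_mult) (simp add: unity_roots_def)
    finally show ?thesis .
  qed
  have "\<not> unity_roots n \<subseteq> (unity_roots ?r :: 'a set)"
  proof
    assume "unity_roots n \<subseteq> (unity_roots ?r :: 'a set)"
    from card_mono[OF finite_unity_roots[OF r(1)] this] card_unity_roots_le[OF r(1), where 'a = 'a]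
    show False using card_unity_roots[OF n] r by simp
  qed
  then obtain w :: 'a where w: "w ^ n = 1" "w ^ ?r \<noteq> 1" by (auto simp: unity_roots_def)
  have w0: "w \<noteq> 0" using w n0 by (auto simp: power_0_left)
  have "(\<Sum>z\<in>unity_roots n. z ^ j) = (\<Sum>z\<in>unity_roots n. (w * z) ^ j)"
    by (rule sum.reindex_bij_witness[of _ "\<lambda>b. w * b" "\<lambda>b. b / w"])
       (use w w0 in \<open>auto simp: unity_roots_def power_mult_distrib power_divide\<close>)
  also have "\<dots> = w ^ j * (\<Sum>z\<in>unity_roots n. z ^ j)"
    by (simp add: power_mult_distrib sum_distrib_left)
  finally have "(1 - w ^ j) * (\<Sum>z\<in>unity_roots n. z ^ j) = 0" by (simp add: algebra_simps)
  then show ?thesis using w zj[of w] False by (auto simp: unity_roots_def)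
qed

section \<open>Valuation rings and their existence\<close>

definition subring :: "'k::field set \<Rightarrow> bool" where
  "subring S \<longleftrightarrow> 1 \<in> S \<and> (\<forall>a\<in>S. \<forall>b\<in>S. a - b \<in> S \<and> a * b \<in> S)"

definition valuation_ring :: "'k::field set \<Rightarrow> bool" where
  "valuation_ring V \<longleftrightarrow> subring V \<and> (\<forall>u. u \<in> V \<or> inverse u \<in> V)"

definition nonunits :: "'k::field set \<Rightarrow> 'k set" where
  "nonunits V = {h \<in> V. h = 0 \<or> inverse h \<notin> V}"

lemma subringI:
  assumes "1 \<in> S" "\<And>a b. a \<in> S \<Longrightarrow> b \<in> S \<Longrightarrow> a - b \<in> S"
    and "\<And>a b. a \<in> S \<Longrightarrow> b \<in> S \<Longrightarrow> a * b \<in> S"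
  shows "subring S"
  using assms by (auto simp: subring_def)

context
  fixes S :: "'k::field set"
  assumes S: "subring S"
begin

lemma subring_one: "1 \<in> S" using S by (simp add: subring_def)
lemma subring_diff: "a \<in> S \<Longrightarrow> b \<in> S \<Longrightarrow> a - b \<in> S" using S by (simp add: subring_def)
lemma subring_mult: "a \<in> S \<Longrightarrow> b \<in> S \<Longrightarrow> a * b \<in> S" using S by (simp add: subring_def)
lemma subring_zero: "0 \<in> S" using subring_diff[OF subring_one subring_one] by simp
lemma subring_uminus: "a \<in> S \<Longrightarrow> - a \<in> S" using subring_diff[OF subring_zero, of a] by simp
lemma subring_add: "a \<in> S \<Longrightarrow> b \<in> S \<Longrightarrow> a + b \<in> S"
  using subring_diff[of a "- b"] subring_uminus[of b] by simp
lemma subring_power: "a \<in> S \<Longrightarrow> a ^ k \<in> S"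
  by (induction k) (auto intro: subring_one subring_mult)
lemma subring_sum: "(\<And>i. i \<in> A \<Longrightarrow> g i \<in> S) \<Longrightarrow> sum g A \<in> S"
  by (induction A rule: infinite_finite_induct) (auto intro: subring_zero subring_add)
lemma subring_prod: "(\<And>i. i \<in> A \<Longrightarrow> g i \<in> S) \<Longrightarrow> prod g A \<in> S"
  by (induction A rule: infinite_finite_induct) (auto intro: subring_one subring_mult)
lemma subring_of_nat: "of_nat k \<in> S"
  by (induction k) (auto intro: subring_zero subring_one subring_add)

lemmas subring_intros = subring_one subring_diff subring_mult subring_zero subring_uminus
  subring_add subring_power subring_sum subring_prod subring_of_nat

end

context
  fixes V :: "'k::field set"
  assumes V: "valuation_ring V"
begin

lemma valuation_ring_subring: "subring V" using V by (simp add: valuation_ring_def)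
lemma valuation_ring_cases: "u \<in> V \<or> inverse u \<in> V" using V by (simp add: valuation_ring_def)

lemmas valuation_ring_intros = subring_intros[OF valuation_ring_subring]

lemma nonunits_subset: "h \<in> nonunits V \<Longrightarrow> h \<in> V" by (simp add: nonunits_def)

lemma zero_nonunits: "0 \<in> nonunits V" by (simp add: nonunits_def valuation_ring_intros)

lemma one_notin_nonunits: "1 \<notin> nonunits V" by (simp add: nonunits_def valuation_ring_intros)

lemma inverse_unit: "h \<in> V \<Longrightarrow> h \<notin> nonunits V \<Longrightarrow> inverse h \<in> V"
  by (auto simp: nonunits_def)

lemma nonunits_mult:
  assumes "h \<in> nonunits V" "g \<in> V"
  shows "g * h \<in> nonunits V" "h * g \<in> nonunits V"
proof -
  show 1: "g * h \<in> nonunits V"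
  proof (cases "g * h = 0")
    case True then show ?thesis using zero_nonunits by auto
  next
    case False
    have eq: "inverse h = g * inverse (g * h)" using False by (simp add: field_simps)
    have "inverse (g * h) \<notin> V"
    proof
      assume "inverse (g * h) \<in> V"
      then have "inverse h \<in> V" unfolding eq by (rule valuation_ring_intros(3)[OF assms(2)])
      then show False using assms(1) False by (simp add: nonunits_def)
    qed
    moreover have "g * h \<in> V" using assms by (intro valuation_ring_intros(3)) (auto simp: nonunits_def)
    ultimately show ?thesis by (simp add: nonunits_def)
  qed
  then show "h * g \<in> nonunits V" by (simp add: mult.commute)
qed

lemma nonunits_add:
  assumes "a \<in> nonunits V" "b \<in> nonunits V"
  shows "a + b \<in> nonunits V"
proof -
  have *: "a + b \<in> nonunits V"
    if a: "a \<in> nonunits V" and b: "b \<in> nonunits V" and c: "a / b \<in> V" "b \<noteq> 0" for a b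
  proof -
    have "a + b = (a / b + 1) * b" using c by (simp add: field_simps)
    then show ?thesis using nonunits_mult(1)[OF b, of "a / b + 1"] c by (simp add: valuation_ring_intros)
  qed
  show ?thesis
  proof (cases "a = 0 \<or> b = 0")
    case True then show ?thesis using assms by auto
  next
    case False
    then show ?thesis
      using valuation_ring_cases[of "a / b"] *[of a b] *[of b a] assms by (auto simp: add.commute)
  qed
qed

lemma nonunits_uminus: "a \<in> nonunits V \<Longrightarrow> - a \<in> nonunits V"
  using nonunits_mult(1)[of a "- 1"] by (simp add: valuation_ring_intros)

lemma nonunits_diff: "a \<in> nonunits V \<Longrightarrow> b \<in> nonunits V \<Longrightarrow> a - b \<in> nonunits V"
  using nonunits_add[of a "- b"] nonunits_uminus[of b] by simp

lemma nonunits_sum: "(\<And>i. i \<in> A \<Longrightarrow> g i \<in> nonunits V) \<Longrightarrow> sum g A \<in> nonunits V"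
  by (induction A rule: infinite_finite_induct) (auto intro: zero_nonunits nonunits_add)

lemma nonunits_prime:
  assumes "a * b \<in> nonunits V" "a \<in> V" "b \<in> V"
  shows "a \<in> nonunits V \<or> b \<in> nonunits V"
  using assms by (auto simp: nonunits_def valuation_ring_intros)

lemma nonunits_power: "a ^ k \<in> nonunits V \<Longrightarrow> a \<in> V \<Longrightarrow> a \<in> nonunits V"
  by (induction k) (auto simp: one_notin_nonunits dest: nonunits_prime intro: valuation_ring_intros)

lemma nonunits_power_pos: "a \<in> nonunits V \<Longrightarrow> k > 0 \<Longrightarrow> a ^ k \<in> nonunits V"
  by (cases k) (auto intro!: nonunits_mult(2) valuation_ring_intros(7) dest: nonunits_subset)

lemma unit_add_nonunit:
  assumes "a \<notin> nonunits V" "b \<in> nonunits V"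
  shows "a + b \<notin> nonunits V"
  using nonunits_diff[OF _ assms(2), of "a + b"] assms by auto

lemma unit_cong:
  assumes "a \<notin> nonunits V" "b - a \<in> nonunits V"
  shows "b \<notin> nonunits V"
  using unit_add_nonunit[OF assms] by simp

text \<open>Valuation rings are integrally closed; only pure equations \<open>u^k = a\<close> occur below.\<close>

lemma integrally_closed_power:
  assumes "u ^ k \<in> V" "k > 0"
  shows "u \<in> V"
proof (rule ccontr)
  assume u: "u \<notin> V"
  then have "inverse u \<in> nonunits V"
    using valuation_ring_cases[of u] by (simp add: nonunits_def)
  then have "inverse u ^ k \<in> nonunits V" using assms nonunits_power_pos by blast
  then have "u ^ k * inverse u ^ k \<in> nonunits V" using assms by (intro nonunits_mult)
  moreover have "u \<noteq> 0" using u valuation_ring_intros(4) by auto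
  then have "u ^ k * inverse u ^ k = 1" by (simp add: power_mult_distrib[symmetric])
  ultimately show False by (simp add: one_notin_nonunits)
qed

end

definition polys_over :: "'k::field set \<Rightarrow> 'k poly set" where
  "polys_over S = {p. \<forall>i. coeff p i \<in> S}"

definition adjoin :: "'k::field set \<Rightarrow> 'k \<Rightarrow> 'k set" where
  "adjoin S u = (\<lambda>p. poly p u) ` polys_over S"

lemma subring_adjoin:
  assumes S: "subring S"
  shows "subring (adjoin S u)" "S \<subseteq> adjoin S u" "u \<in> adjoin S u"
proof -
  note S' = subring_intros[OF S]
  have one: "1 \<in> polys_over S" by (auto simp: polys_over_def S' coeff_1)
  have diff: "p - r \<in> polys_over S" "p * r \<in> polys_over S"
    if "p \<in> polys_over S" "r \<in> polys_over S" for p r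
    using that by (auto simp: polys_over_def S' coeff_mult intro!: S'(8))
  show "subring (adjoin S u)"
  proof (rule subringI)
    show "1 \<in> adjoin S u" unfolding adjoin_def by (rule image_eqI[OF _ one]) simp
  next
    fix a b assume "a \<in> adjoin S u" "b \<in> adjoin S u"
    then obtain p r where "p \<in> polys_over S" "r \<in> polys_over S" "a = poly p u" "b = poly r u"
      by (auto simp: adjoin_def)
    then have "a - b = poly (p - r) u" "a * b = poly (p * r) u"
      and "p - r \<in> polys_over S" "p * r \<in> polys_over S"
      by (auto intro: diff)
    then show "a - b \<in> adjoin S u" "a * b \<in> adjoin S u"
      unfolding adjoin_def by blast+
  qed
  show "S \<subseteq> adjoin S u"
    unfolding adjoin_def by (auto simp: polys_over_def coeff_pCons S' split: nat.splits intro!: image_eqI[of _ _ "[:_:]"])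
  show "u \<in> adjoin S u"
    unfolding adjoin_def by (rule image_eqI[of _ _ "[:0, 1:]"]) (auto simp: polys_over_def coeff_pCons S' split: nat.splits)
qed

lemma exists_maximal_subring_avoiding:
  fixes R :: "'k::field set"
  assumes R: "subring R" "w \<notin> R"
  obtains M where "subring M" "R \<subseteq> M" "w \<notin> M"
    and "\<And>S. subring S \<Longrightarrow> M \<subseteq> S \<Longrightarrow> w \<notin> S \<Longrightarrow> S = M"
proof -
  define A where "A = {S. subring S \<and> R \<subseteq> S \<and> w \<notin> S}"
  have "\<exists>M\<in>A. \<forall>X\<in>A. M \<subseteq> X \<longrightarrow> X = M"
  proof (rule subset_Zorn_nonempty)
    show "A \<noteq> {}" using R by (auto simp: A_def)
  next
    fix C assume C: "C \<noteq> {}" "subset.chain A C"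
    then have CA: "C \<subseteq> A" and lin: "\<And>X Y. X \<in> C \<Longrightarrow> Y \<in> C \<Longrightarrow> X \<subseteq> Y \<or> Y \<subseteq> X"
      by (auto simp: subset_chain_def)
    have "subring (\<Union>C)"
    proof (rule subringI)
      show "1 \<in> \<Union>C" using C CA by (auto simp: A_def subring_def)
    next
      fix a b assume "a \<in> \<Union>C" "b \<in> \<Union>C"
      then obtain X Y where "X \<in> C" "Y \<in> C" "a \<in> X" "b \<in> Y" by auto
      then obtain Z where Z: "Z \<in> C" "a \<in> Z" "b \<in> Z" using lin by blast
      then have "subring Z" using CA by (auto simp: A_def)
      then have "a - b \<in> Z" "a * b \<in> Z" using Z by (auto simp: subring_def)
      then show "a - b \<in> \<Union>C" "a * b \<in> \<Union>C" using Z by auto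
    qed
    then show "\<Union>C \<in> A" using C CA by (auto simp: A_def)
  qed
  then obtain M where M: "M \<in> A" "\<And>X. X \<in> A \<Longrightarrow> M \<subseteq> X \<Longrightarrow> X = M" by blast
  show ?thesis
    by (rule that[of M]) (use M in \<open>auto simp: A_def\<close>)
qed

text \<open>
  A subring that is maximal among those which do not contain \<open>1/z\<close> is a valuation ring:
  if neither \<open>u\<close> nor \<open>1/u\<close> could be adjoined, both adjunctions would express \<open>1/z\<close>
  as a polynomial in \<open>u\<close> and in \<open>1/u\<close>, and the relation of lower degree shortens the other one.
\<close>

theorem exists_valuation_ring:
  fixes R :: "'k::field set"
  assumes R: "subring R" "z \<in> R" "inverse z \<notin> R"
  obtains V where "valuation_ring V" "R \<subseteq> V" "z \<in> nonunits V"
proof -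
  obtain M where M: "subring M" "R \<subseteq> M" "inverse z \<notin> M"
    and max: "\<And>S. subring S \<Longrightarrow> M \<subseteq> S \<Longrightarrow> inverse z \<notin> S \<Longrightarrow> S = M"
    by (rule exists_maximal_subring_avoiding[OF R(1,3)]) blast
  note S = subring_intros[OF M(1)]
  have zM: "z \<in> M" using R M by auto
  have z0: "z \<noteq> 0" using M(3) S(4) by auto
  have adj: "\<exists>p\<in>polys_over M. poly p u = inverse z" if "u \<notin> M" for u
  proof (rule ccontr)
    assume "\<not> ?thesis"
    then have "inverse z \<notin> adjoin M u" unfolding adjoin_def by (metis (lifting) imageE)
    then have "adjoin M u = M" by (intro max subring_adjoin M)
    then show False using subring_adjoin(3)[OF M(1), of u] that by simp
  qed
  \<comment> \<open>By maximality \<open>z\<close> lies in the Jacobson radical.\<close>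
  have unit: "1 - z * a \<noteq> 0 \<and> inverse (1 - z * a) \<in> M" if a: "a \<in> M" for a
  proof
    show ne: "1 - z * a \<noteq> 0"
    proof
      assume "1 - z * a = 0"
      then have "inverse z = a" using z0 by (simp add: field_simps)
      then show False using a M(3) by simp
    qed
    show "inverse (1 - z * a) \<in> M"
    proof (rule ccontr)
      let ?w = "inverse (1 - z * a)"
      assume "?w \<notin> M"
      then obtain p where p: "p \<in> polys_over M" "poly p ?w = inverse z" using adj by blast
      define k where "k = degree p"
      have "(1 - z * a) ^ k * inverse z = (\<Sum>i\<le>k. coeff p i * (1 - z * a) ^ (k - i))"
        unfolding p(2)[symmetric] poly_altdef k_def[symmetric] sum_distrib_left
      proof (rule sum.cong)
        fix i assume "i \<in> {..k}"
        then have "(1 - z * a) ^ k = (1 - z * a) ^ (k - i) * (1 - z * a) ^ i"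
          by (simp add: power_add[symmetric])
        then show "(1 - z * a) ^ k * (coeff p i * ?w ^ i) = coeff p i * (1 - z * a) ^ (k - i)"
          using ne by (simp add: field_simps)
      qed simp
      also have "\<dots> \<in> M" using p(1) a zM by (auto simp: polys_over_def intro!: S)
      finally have 1: "(1 - z * a) ^ k * inverse z \<in> M" .
      have "\<exists>b\<in>M. (1 - z * a) ^ j = 1 - z * b" for j
      proof (induction j)
        case 0 then show ?case by (rule bexI[of _ 0]) (auto intro: S)
      next
        case (Suc j)
        then obtain b where "b \<in> M" "(1 - z * a) ^ j = 1 - z * b" by auto
        moreover have "(1 - z * a) * (1 - z * b) = 1 - z * (a + b - a * z * b)"
          by (simp add: algebra_simps)
        ultimately show ?case
          by (intro bexI[of _ "a + b - a * z * b"]) (auto intro!: S a zM)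
      qed
      then obtain b where b: "b \<in> M" "(1 - z * a) ^ k = 1 - z * b" by blast
      have "inverse z = (1 - z * a) ^ k * inverse z + b"
        unfolding b(2) using z0 by (simp add: field_simps)
      also have "\<dots> \<in> M" by (intro S 1 b)
      finally show False using M(3) by simp
    qed
  qed
  define deg where "deg u = (LEAST n. \<exists>p\<in>polys_over M. poly p u = inverse z \<and> degree p = n)" for u
  have deg: "\<exists>p\<in>polys_over M. poly p u = inverse z \<and> degree p = deg u" if "u \<notin> M" for u
    unfolding deg_def by (rule LeastI_ex) (use adj[OF that] in auto)
  have deg_le: "deg u \<le> degree p" if "p \<in> polys_over M" "poly p u = inverse z" for p u
    unfolding deg_def by (rule Least_le) (use that in auto)
  have contra: False if u: "u \<notin> M" "inverse u \<notin> M" and le: "deg (inverse u) \<le> deg u" for u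
  proof -
    have u0: "u \<noteq> 0" using u S(4) by auto
    obtain p where p: "p \<in> polys_over M" "poly p u = inverse z" "degree p = deg u"
      using deg[OF u(1)] by blast
    obtain r where r: "r \<in> polys_over M" "poly r (inverse u) = inverse z" "degree r = deg (inverse u)"
      using deg[OF u(2)] by blast
    define n where "n = degree p"
    define m where "m = degree r"
    have mn: "m \<le> n" using le p r by (simp add: n_def m_def)
    have cM: "coeff p i \<in> M" "coeff r i \<in> M" for i using p r by (auto simp: polys_over_def)
    have n0: "n > 0"
    proof (rule ccontr)
      assume "\<not> n > 0"
      then have "inverse z = coeff p 0" using p(2) by (simp add: poly_altdef n_def)
      then show False using M(3) cM by simp
    qed
    define c where "c = inverse (1 - z * coeff r 0)"
    have c: "c \<in> M" "c * (1 - z * coeff r 0) = 1" using unit[OF cM(2)[of 0]] by (auto simp: c_def)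
    define g where "g = (\<Sum>j=1..m. monom (z * c * coeff r j) (n - j))"
    \<comment> \<open>The relation for \<open>1/u\<close>, solved for \<open>1\<close> and multiplied by \<open>u^n\<close>, lowers \<open>u^n\<close>.\<close>
    have gu: "poly g u = u ^ n"
    proof -
      have "1 = z * poly r (inverse u)" using r(2) z0 by simp
      also have "\<dots> = z * coeff r 0 + z * (\<Sum>j=1..m. coeff r j * inverse u ^ j)"
        unfolding poly_altdef m_def[symmetric] atMost_atLeast0
        by (subst sum.atLeast_Suc_atMost) (auto simp: algebra_simps)
      finally have "1 - z * coeff r 0 = z * (\<Sum>j=1..m. coeff r j * inverse u ^ j)"
        by (simp add: algebra_simps)
      then have "c * (1 - z * coeff r 0) = c * (z * (\<Sum>j=1..m. coeff r j * inverse u ^ j))"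
        by simp
      then have *: "1 = (\<Sum>j=1..m. z * c * coeff r j * inverse u ^ j)"
        unfolding c(2) by (simp add: sum_distrib_left mult_ac)
      have "u ^ n = u ^ n * (\<Sum>j=1..m. z * c * coeff r j * inverse u ^ j)"
        using * by simp
      also have "\<dots> = (\<Sum>j=1..m. z * c * coeff r j * u ^ (n - j))"
        unfolding sum_distrib_left
      proof (rule sum.cong)
        fix j assume "j \<in> {1..m}"
        then have "u ^ n = u ^ (n - j) * u ^ j" using mn by (simp add: power_add[symmetric])
        then show "u ^ n * (z * c * coeff r j * inverse u ^ j) = z * c * coeff r j * u ^ (n - j)"
          using u0 by (simp add: field_simps)
      qed simp
      finally show ?thesis by (simp add: g_def poly_sum poly_monom)
    qed
    have gM: "coeff g i \<in> M" for i
      unfolding g_def coeff_sum coeff_monom using c cM zM by (auto intro!: S)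
    define p' where "p' = p - smult (lead_coeff p) (monom 1 n - g)"
    have "p' \<in> polys_over M"
      unfolding polys_over_def p'_def using cM gM by (auto intro!: S simp: coeff_monom)
    moreover have "poly p' u = inverse z"
      by (simp add: p'_def p(2) gu poly_monom)
    moreover have "degree p' < n"
    proof -
      have "degree g < n" unfolding g_def
        using n0 by (intro degree_sum_less) (auto intro!: le_less_trans[OF degree_monom_le])
      then have cg: "coeff g i = 0" if "i \<ge> n" for i using that by (intro coeff_eq_0) auto
      have "coeff p' i = 0" if "i > n - 1" for i
      proof (cases "i = n")
        case True
        then show ?thesis using cg[of n] by (simp add: p'_def coeff_monom n_def)
      next
        case False
        then have "i > n" using that by simp
        then show ?thesis using cg[of i] by (simp add: p'_def coeff_monom coeff_eq_0 n_def)
      qed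
      then have "degree p' \<le> n - 1" by (intro degree_le) auto
      then show ?thesis using n0 by linarith
    qed
    ultimately show False using deg_le[of p' u] p(3) n_def by auto
  qed
  have "u \<in> M \<or> inverse u \<in> M" for u
    using contra[of u] contra[of "inverse u"] by fastforce
  then have "valuation_ring M" using M(1) by (simp add: valuation_ring_def)
  moreover have "z \<in> nonunits M" using M(3) zM by (simp add: nonunits_def)
  ultimately show ?thesis using that M(2) by blast
qed

section \<open>Evaluation of polynomials over the constants\<close>

locale constant_embedding =
  fixes \<iota> :: "'a::{finite,field} \<Rightarrow> 'k::field"
  assumes iota_1: "\<iota> 1 = 1"
    and iota_add: "\<iota> (a + b) = \<iota> a + \<iota> b"
    and iota_mult: "\<iota> (a * b) = \<iota> a * \<iota> b"
begin

lemma iota_0 [simp]: "\<iota> 0 = 0"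
proof -
  have "\<iota> 0 + \<iota> 0 = \<iota> 0 + 0" using iota_add[of 0 0] by (simp only: add_0_right)
  then show ?thesis by (rule add_left_imp_eq)
qed
lemma iota_uminus: "\<iota> (- a) = - \<iota> a"
  using iota_add[of a "- a"] by (simp add: eq_neg_iff_add_eq_0 add.commute)
lemma iota_diff: "\<iota> (a - b) = \<iota> a - \<iota> b" using iota_add[of a "- b"] by (simp add: iota_uminus)
lemma iota_power: "\<iota> (a ^ k) = \<iota> a ^ k" by (induction k) (simp_all add: iota_1 iota_mult)
lemma iota_sum: "\<iota> (sum g A) = (\<Sum>i\<in>A. \<iota> (g i))"
  by (induction A rule: infinite_finite_induct) (auto simp: iota_add)
lemma iota_of_nat: "\<iota> (of_nat k) = of_nat k"
  by (induction k) (auto simp: iota_add iota_1)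
lemma iota_eq_0 [simp]: "\<iota> a = 0 \<longleftrightarrow> a = 0"
proof
  assume a: "\<iota> a = 0"
  show "a = 0"
  proof (rule ccontr)
    assume "a \<noteq> 0"
    then have "\<iota> a * \<iota> (inverse a) = 1" by (simp add: iota_mult[symmetric] iota_1)
    then show False using a by simp
  qed
qed simp
lemma iota_inverse: "\<iota> (inverse a) = inverse (\<iota> a)"
proof (cases "a = 0")
  case False
  then have "\<iota> a * \<iota> (inverse a) = 1" by (simp add: iota_1 flip: iota_mult)
  then show ?thesis by (rule inverse_unique[symmetric])
qed simp

lemma q_ge_2: "CARD('a) \<ge> 2" by (rule card_field_ge_2)

lemma frobenius_add_1: "((g::'k) + h) ^ CARD('a) = g ^ CARD('a) + h ^ CARD('a)"
proof -
  have "(g + h) ^ CARD('a) = (\<Sum>k\<le>CARD('a). of_nat (CARD('a) choose k) * g ^ k * h ^ (CARD('a) - k))"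
    by (rule binomial_ring)
  also have "\<dots> = (\<Sum>k\<in>{0, CARD('a)}. of_nat (CARD('a) choose k) * g ^ k * h ^ (CARD('a) - k))"
  proof (rule sum.mono_neutral_right)
    show "\<forall>k\<in>{..CARD('a)} - {0, CARD('a)}. of_nat (CARD('a) choose k) * g ^ k * h ^ (CARD('a) - k) = 0"
    proof
      fix k assume "k \<in> {..CARD('a)} - {0, CARD('a)}"
      then have "\<iota> (of_nat (CARD('a) choose k)) = 0" using of_nat_choose_card_eq_0[of k, where 'a = 'a] by auto
      then show "of_nat (CARD('a) choose k) * g ^ k * h ^ (CARD('a) - k) = 0" by (simp add: iota_of_nat)
    qed
  qed auto
  also have "\<dots> = g ^ CARD('a) + h ^ CARD('a)" using q_ge_2 by simp
  finally show ?thesis .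
qed

lemma frobenius_add: "((g::'k) + h) ^ (CARD('a) ^ r) = g ^ (CARD('a) ^ r) + h ^ (CARD('a) ^ r)"
  by (induction r) (simp_all add: power_Suc2 power_mult frobenius_add_1 del: power_Suc)

lemma frobenius_diff: "((g::'k) - h) ^ (CARD('a) ^ r) = g ^ (CARD('a) ^ r) - h ^ (CARD('a) ^ r)"
  using frobenius_add[of "g - h" h r] by simp

lemma frobenius_iota: "\<iota> a ^ (CARD('a) ^ r) = \<iota> a"
  by (induction r)
     (simp_all add: power_Suc2 power_mult power_card_field del: power_Suc flip: iota_power)

lemma of_nat_q: "of_nat CARD('a) = (0 :: 'k)"
  using of_nat_card_eq_0[where 'a = 'a] iota_of_nat[of "CARD('a)"] by simp

lemma of_nat_nonzero:
  assumes "n dvd CARD('a) - 1"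
  shows "of_nat n \<noteq> (0 :: 'k)"
  using of_nat_dvd_card_minus_1[OF assms] iota_eq_0[of "of_nat n"] by (simp add: iota_of_nat)

abbreviation ev :: "'a poly \<Rightarrow> 'k \<Rightarrow> 'k" where "ev g t \<equiv> poly (map_poly \<iota> g) t"

lemma ev_0 [simp]: "ev 0 t = 0" by simp
lemma ev_pCons: "ev (pCons a g) t = \<iota> a + t * ev g t"
  by (simp add: map_poly_pCons)
lemma ev_1 [simp]: "ev 1 t = 1" by (simp add: one_pCons ev_pCons iota_1)
lemma ev_add: "ev (g + h) t = ev g t + ev h t"
  by (induction g h rule: poly_induct2) (simp_all add: ev_pCons iota_add algebra_simps)
lemma ev_smult: "ev (smult a g) t = \<iota> a * ev g t"
  by (induction g) (simp_all add: ev_pCons iota_mult algebra_simps)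
lemma ev_mult: "ev (g * h) t = ev g t * ev h t"
  by (induction g) (simp_all add: ev_pCons ev_add ev_smult algebra_simps)
lemma ev_uminus: "ev (- g) t = - ev g t" using ev_smult[of "- 1" g t] by (simp add: iota_uminus iota_1)
lemma ev_diff: "ev (g - h) t = ev g t - ev h t" using ev_add[of g "- h" t] by (simp add: ev_uminus)
lemma ev_power: "ev (g ^ k) t = ev g t ^ k" by (induction k) (simp_all add: ev_mult)
lemma ev_sum: "ev (sum g A) t = (\<Sum>i\<in>A. ev (g i) t)"
  by (induction A rule: infinite_finite_induct) (auto simp: ev_add)
lemma ev_prod: "ev (prod g A) t = (\<Prod>i\<in>A. ev (g i) t)"
  by (induction A rule: infinite_finite_induct) (auto simp: ev_mult)
lemma ev_monom: "ev (monom a k) t = \<iota> a * t ^ k" by (simp add: map_poly_monom poly_monom)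
lemma ev_linear: "ev [:- a, 1:] t = t - \<iota> a" by (simp add: ev_pCons iota_uminus iota_1)
lemma ev_altdef: "ev g t = (\<Sum>i\<le>degree g. \<iota> (coeff g i) * t ^ i)"
proof -
  have "ev g t = ev (\<Sum>i\<le>degree g. monom (coeff g i) i) t" by (simp add: poly_as_sum_of_monoms)
  then show ?thesis by (simp add: ev_sum ev_monom)
qed

abbreviation bev :: "'k \<Rightarrow> 'k \<Rightarrow> 'a poly poly \<Rightarrow> 'k" where "bev \<equiv> bivariate_eval \<iota>"

lemma bev_0 [simp]: "bev s t 0 = 0" by (simp add: bivariate_eval_def)
lemma bev_pCons: "bev s t (pCons g B) = ev g s + t * bev s t B"
  by (simp add: bivariate_eval_def map_poly_pCons)
lemma bev_1 [simp]: "bev s t 1 = 1" by (simp add: one_pCons bev_pCons ev_pCons iota_1)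
lemma bev_add: "bev s t (A + B) = bev s t A + bev s t B"
  by (induction A B rule: poly_induct2) (simp_all add: bev_pCons ev_add algebra_simps)
lemma bev_smult: "bev s t (smult g B) = ev g s * bev s t B"
  by (induction B) (simp_all add: bev_pCons ev_mult algebra_simps)
lemma bev_mult: "bev s t (A * B) = bev s t A * bev s t B"
  by (induction A) (simp_all add: bev_pCons bev_add bev_smult algebra_simps)
lemma bev_uminus: "bev s t (- B) = - bev s t B"
  using bev_smult[of s t "- 1" B] by (simp add: ev_uminus)
lemma bev_diff: "bev s t (A - B) = bev s t A - bev s t B"
  using bev_add[of s t A "- B"] by (simp add: bev_uminus)
lemma bev_sum: "bev s t (sum g A) = (\<Sum>i\<in>A. bev s t (g i))"
  by (induction A rule: infinite_finite_induct) (auto simp: bev_add)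
lemma bev_monom: "bev s t (monom g k) = ev g s * t ^ k"
  by (induction k) (simp_all add: monom_0 monom_Suc bev_pCons algebra_simps)
lemma bev_const: "bev s t [:g:] = ev g s" by (simp add: bev_pCons)
lemma bev_altdef: "bev s t B = (\<Sum>i\<le>degree B. ev (coeff B i) s * t ^ i)"
proof -
  have "bev s t B = bev s t (\<Sum>i\<le>degree B. monom (coeff B i) i)" by (simp add: poly_as_sum_of_monoms)
  then show ?thesis by (simp add: bev_sum bev_monom)
qed

section \<open>Subrings and fields generated by two elements\<close>

definition gen_ring :: "'k \<Rightarrow> 'k \<Rightarrow> 'k set" where
  "gen_ring s t = range (bev s t)"

lemma subring_gen_ring: "subring (gen_ring s t)"
  unfolding gen_ring_def
  by (rule subringI)
     (auto simp: bev_diff[symmetric] bev_mult[symmetric] intro: range_eqI[of _ _ 1])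

lemma gen_ring_gens: "\<iota> a \<in> gen_ring s t" "s \<in> gen_ring s t" "t \<in> gen_ring s t"
proof -
  have "bev s t [:[:a:]:] = \<iota> a" "bev s t [:[:0, 1:]:] = s" "bev s t [:0, 1:] = t"
    by (simp_all add: bev_pCons ev_pCons iota_1)
  then show "\<iota> a \<in> gen_ring s t" "s \<in> gen_ring s t" "t \<in> gen_ring s t"
    unfolding gen_ring_def by (metis rangeI)+
qed

lemma ev_in_subring:
  assumes "subring S" "range \<iota> \<subseteq> S" "s \<in> S"
  shows "ev g s \<in> S"
proof (induction g)
  case (pCons a g)
  have "\<iota> a \<in> S" using assms by auto
  then show ?case using pCons assms unfolding ev_pCons by (intro subring_intros[OF assms(1)])
qed (simp add: subring_zero assms)

lemma bev_in_subring:
  assumes "subring S" "range \<iota> \<subseteq> S" "s \<in> S" "t \<in> S"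
  shows "bev s t B \<in> S"
proof (induction B)
  case (pCons g B)
  then show ?case using assms unfolding bev_pCons
    by (intro subring_intros[OF assms(1)] ev_in_subring)
qed (simp add: subring_zero assms)

lemma gen_ring_subset:
  assumes "subring S" "range \<iota> \<subseteq> S" "s \<in> S" "t \<in> S"
  shows "gen_ring s t \<subseteq> S"
  using bev_in_subring[OF assms] by (auto simp: gen_ring_def)

lemma ev_in_gen_ring: "ev g s \<in> gen_ring s t"
  by (rule ev_in_subring[OF subring_gen_ring]) (auto intro: gen_ring_gens)

definition generates :: "'k \<Rightarrow> 'k \<Rightarrow> bool" where
  "generates s t \<longleftrightarrow> (\<forall>h. \<exists>a\<in>gen_ring s t. \<exists>b\<in>gen_ring s t. b \<noteq> 0 \<and> h = a / b)"

lemma generates_subfield: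
  assumes "generates s t" "subring F" "\<And>h. h \<in> F \<Longrightarrow> h \<noteq> 0 \<Longrightarrow> inverse h \<in> F"
    and "range \<iota> \<subseteq> F" "s \<in> F" "t \<in> F"
  shows "h \<in> F"
proof -
  obtain a b where ab: "a \<in> gen_ring s t" "b \<in> gen_ring s t" "b \<noteq> 0" "h = a / b"
    using assms(1) unfolding generates_def by blast
  then have "a \<in> F" "b \<in> F" using gen_ring_subset[OF assms(2,4-6)] by auto
  then have "a * inverse b \<in> F" using ab by (intro subring_mult[OF assms(2)] assms(3))
  then show ?thesis using ab by (simp add: divide_inverse)
qed

text \<open>Fractions of elements of \<open>gen_ring s t\<close> form a field, so it suffices to reach \<open>x\<close> and \<open>y\<close>.\<close>

lemma generates_change:
  assumes xy: "generates x y"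
    and x: "x = a / b" "a \<in> gen_ring s t" "b \<in> gen_ring s t" "b \<noteq> 0"
    and y: "y = a' / b'" "a' \<in> gen_ring s t" "b' \<in> gen_ring s t" "b' \<noteq> 0"
  shows "generates s t"
proof -
  let ?R = "gen_ring s t"
  note R = subring_intros[OF subring_gen_ring]
  define F where "F = {a / b | a b. a \<in> ?R \<and> b \<in> ?R \<and> b \<noteq> 0}"
  have RF: "c \<in> F" if "c \<in> ?R" for c
  proof -
    have "c = c / 1" "(1 :: 'k) \<noteq> 0" by simp_all
    then show ?thesis unfolding F_def using that R(1) by blast
  qed
  have "subring F"
  proof (rule subringI)
    show "1 \<in> F" by (rule RF[OF R(1)])
  next
    fix g h assume "g \<in> F" "h \<in> F"
    then obtain a b a' b' where *: "g = a / b" "h = a' / b'" "a \<in> ?R" "b \<in> ?R" "b \<noteq> 0"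
      "a' \<in> ?R" "b' \<in> ?R" "b' \<noteq> 0" by (auto simp: F_def)
    have "g - h = (a * b' - a' * b) / (b * b')" "g * h = (a * a') / (b * b')"
      using * by (auto simp: field_simps)
    moreover have "a * b' - a' * b \<in> ?R" "a * a' \<in> ?R" "b * b' \<in> ?R" "b * b' \<noteq> 0"
      using * by (auto intro: R)
    ultimately show "g - h \<in> F" "g * h \<in> F" unfolding F_def by blast+
  qed
  moreover have "inverse h \<in> F" if h: "h \<in> F" "h \<noteq> 0" for h
  proof -
    obtain a b where "h = a / b" "a \<in> ?R" "b \<in> ?R" "b \<noteq> 0" using h by (auto simp: F_def)
    then have "inverse h = b / a" "a \<noteq> 0" using h by auto
    then show ?thesis using \<open>a \<in> ?R\<close> \<open>b \<in> ?R\<close> unfolding F_def by blast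
  qed
  moreover have "x \<in> F" "y \<in> F" using x y by (auto simp: F_def)
  moreover have "range \<iota> \<subseteq> F" using RF gen_ring_gens by auto
  ultimately have "h \<in> F" for h
    using generates_subfield[OF xy, of F h] by simp
  then show ?thesis unfolding generates_def F_def by blast
qed

end

section \<open>Local coordinates\<close>

text \<open>
  \<open>V\<close> is the valuation ring of the point, \<open>s\<close> and \<open>t\<close> are affine coordinates around it, and \<open>\<pi>\<close> is
  a candidate for a uniformiser. The ring \<open>loc\<close> is the local ring of the affine curve at the point,
  and \<open>frob_fixed\<close> consists of the elements that the map \<open>h \<mapsto> h^Q\<close>, with \<open>Q = q^r\<close>, fixes modulo
  \<open>\<pi>\<close>.
\<close>

locale local_coordinates = constant_embedding \<iota>
  for \<iota> :: "'a::{finite,field} \<Rightarrow> 'k::field" +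
  fixes V :: "'k set" and s t \<pi> :: 'k and r :: nat
  assumes V: "valuation_ring V" "range \<iota> \<subseteq> V" "s \<in> V" "t \<in> V"
    and gens: "generates s t"
    and unif: "\<pi> \<in> nonunits V"
    and r: "r > 0"
begin

definition loc :: "'k set" where
  "loc = {a / b | a b. a \<in> gen_ring s t \<and> b \<in> gen_ring s t \<and> b \<notin> nonunits V}"

lemma gen_ring_V: "gen_ring s t \<subseteq> V"
  using gen_ring_subset[OF valuation_ring_subring[OF V(1)] V(2-4)] .

lemma denominator_nonzero: "b \<notin> nonunits V \<Longrightarrow> b \<noteq> 0"
  using zero_nonunits[OF V(1)] by auto

lemma loc_V: "loc \<subseteq> V"
proof
  fix h assume "h \<in> loc"
  then obtain a b where ab: "h = a / b" "a \<in> gen_ring s t" "b \<in> gen_ring s t" "b \<notin> nonunits V"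
    by (auto simp: loc_def)
  then have "a * inverse b \<in> V"
    using gen_ring_V by (intro valuation_ring_intros(3)[OF V(1)] inverse_unit[OF V(1)]) auto
  then show "h \<in> V" using ab by (simp add: divide_inverse)
qed

lemma gen_ring_loc: "gen_ring s t \<subseteq> loc"
proof
  fix a assume "a \<in> gen_ring s t"
  moreover have "a = a / 1" by simp
  ultimately show "a \<in> loc"
    unfolding loc_def using one_notin_nonunits[OF V(1)] subring_one[OF subring_gen_ring[of s t]]
    by blast
qed

lemma subring_loc: "subring loc"
proof (rule subringI)
  note R = subring_intros[OF subring_gen_ring[of s t]]
  show "1 \<in> loc" using gen_ring_loc R(1) by auto
  fix g h assume "g \<in> loc" "h \<in> loc"
  then obtain a b a' b' where *: "g = a / b" "h = a' / b'" "a \<in> gen_ring s t" "b \<in> gen_ring s t"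
    "b \<notin> nonunits V" "a' \<in> gen_ring s t" "b' \<in> gen_ring s t" "b' \<notin> nonunits V"
    by (auto simp: loc_def)
  have "b \<noteq> 0" "b' \<noteq> 0" using * denominator_nonzero by auto
  then have "g - h = (a * b' - a' * b) / (b * b')" "g * h = (a * a') / (b * b')"
    using * by (auto simp: field_simps)
  moreover have "a * b' - a' * b \<in> gen_ring s t" "a * a' \<in> gen_ring s t" "b * b' \<in> gen_ring s t"
    using * by (auto intro: R)
  moreover have "b * b' \<notin> nonunits V"
    using nonunits_prime[OF V(1), of b b'] * gen_ring_V by auto
  ultimately show "g - h \<in> loc" "g * h \<in> loc" unfolding loc_def by blast+
qed

lemmas loc_intros = subring_intros[OF subring_loc]

lemma loc_inverse:
  assumes "h \<in> loc" "h \<notin> nonunits V"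
  shows "inverse h \<in> loc"
proof -
  obtain a b where *: "h = a / b" "a \<in> gen_ring s t" "b \<in> gen_ring s t" "b \<notin> nonunits V"
    using assms(1) by (auto simp: loc_def)
  have "b \<noteq> 0" using * denominator_nonzero by auto
  then have "a = h * b" using * by simp
  then have "a \<notin> nonunits V"
    using nonunits_prime[OF V(1), of h b] * assms loc_V gen_ring_V by auto
  then have "b / a \<in> loc" unfolding loc_def using * by blast
  then show ?thesis using * by simp
qed

definition unif_ideal :: "'k set" where "unif_ideal = (\<lambda>g. \<pi> * g) ` loc"

lemma unif_idealI: "h = \<pi> * g \<Longrightarrow> g \<in> loc \<Longrightarrow> h \<in> unif_ideal"
  by (auto simp: unif_ideal_def)

lemma unif_ideal_add: "g \<in> unif_ideal \<Longrightarrow> h \<in> unif_ideal \<Longrightarrow> g + h \<in> unif_ideal"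
  unfolding unif_ideal_def by (auto simp: distrib_left[symmetric] loc_intros)

lemma unif_ideal_mult: "g \<in> loc \<Longrightarrow> h \<in> unif_ideal \<Longrightarrow> g * h \<in> unif_ideal"
  unfolding unif_ideal_def by (auto simp: loc_intros mult.left_commute)

lemma unif_ideal_uminus: "h \<in> unif_ideal \<Longrightarrow> - h \<in> unif_ideal"
  using unif_ideal_mult[of "- 1" h] by (simp add: loc_intros)

lemma unif_ideal_diff: "g \<in> unif_ideal \<Longrightarrow> h \<in> unif_ideal \<Longrightarrow> g - h \<in> unif_ideal"
  using unif_ideal_add[of g "- h"] unif_ideal_uminus by simp

definition frob_fixed :: "'k set" where
  "frob_fixed = {h \<in> loc. h ^ (CARD('a) ^ r) - h \<in> unif_ideal}"

text \<open>Additivity of the Frobenius map extends a congruence on the coordinates to the whole ring.\<close>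

lemma subring_frob_fixed: "subring frob_fixed"
proof (rule subringI)
  show "1 \<in> frob_fixed"
    by (auto simp: frob_fixed_def loc_intros unif_ideal_def intro!: image_eqI[of _ _ 0])
next
  fix g h assume gh: "g \<in> frob_fixed" "h \<in> frob_fixed"
  have "(g - h) ^ (CARD('a) ^ r) - (g - h) = (g ^ (CARD('a) ^ r) - g) - (h ^ (CARD('a) ^ r) - h)"
    by (simp add: frobenius_diff)
  also have "\<dots> \<in> unif_ideal" using gh by (auto simp: frob_fixed_def intro: unif_ideal_diff)
  finally show "g - h \<in> frob_fixed" using gh by (auto simp: frob_fixed_def loc_intros)
  have "(g * h) ^ (CARD('a) ^ r) - g * h = g ^ (CARD('a) ^ r) * (h ^ (CARD('a) ^ r) - h) + h * (g ^ (CARD('a) ^ r) - g)"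
    by (simp add: power_mult_distrib algebra_simps)
  then show "g * h \<in> frob_fixed" using gh
    by (auto simp: frob_fixed_def loc_intros intro!: unif_ideal_add unif_ideal_mult)
qed

lemma iota_frob_fixed: "range \<iota> \<subseteq> frob_fixed"
  using gen_ring_loc gen_ring_gens loc_intros(4)
  by (auto simp: frob_fixed_def frobenius_iota unif_ideal_def intro!: image_eqI[of _ _ 0])

text \<open>
  Roots of order prime to the characteristic of a fixed element are fixed as well, because the
  difference quotient \<open>(u^k - w^k) / (u - w)\<close> at \<open>u = w^Q\<close> is congruent to \<open>k w^(k-1)\<close>.
\<close>

lemma frob_fixed_root:
  assumes w: "w \<in> gen_ring s t" "w \<notin> nonunits V" and wQ: "w ^ (CARD('a) ^ r) - w \<in> nonunits V"
    and k: "of_nat k \<noteq> (0 :: 'a)" and wk: "w ^ k \<in> frob_fixed"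
  shows "w \<in> frob_fixed"
proof -
  note R = subring_intros[OF subring_gen_ring[of s t]]
  note VI = valuation_ring_intros[OF V(1)]
  let ?u = "w ^ (CARD('a) ^ r)"
  define d where "d = (\<Sum>i<k. w ^ (k - Suc i) * ?u ^ i)"
  have wV: "w \<in> V" using w gen_ring_V by auto
  have eq: "(?u - w) * d = (w ^ k) ^ (CARD('a) ^ r) - w ^ k"
    unfolding d_def power_mult[symmetric] mult.commute[of k]
    unfolding power_mult by (simp add: power_diff_sumr2 mult_ac)
  have "d \<in> gen_ring s t" unfolding d_def by (intro R w)
  have cong: "?u ^ j - w ^ j \<in> nonunits V" for j
  proof -
    have "?u ^ j - w ^ j = (?u - w) * (\<Sum>i<j. w ^ (j - Suc i) * ?u ^ i)"
      by (simp add: power_diff_sumr2)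
    also have "\<dots> \<in> nonunits V" by (intro nonunits_mult[OF V(1)] wQ VI wV)
    finally show ?thesis .
  qed
  have "d - of_nat k * w ^ (k - 1) = (\<Sum>i<k. w ^ (k - Suc i) * (?u ^ i - w ^ i))"
  proof -
    have "(\<Sum>i<k. w ^ (k - Suc i) * w ^ i) = (\<Sum>i<k. w ^ (k - 1))"
      by (rule sum.cong) (auto simp: power_add[symmetric])
    then show ?thesis by (simp add: d_def sum_subtractf right_diff_distrib)
  qed
  also have "\<dots> \<in> nonunits V"
    by (intro nonunits_sum[OF V(1)] nonunits_mult(1)[OF V(1)] cong VI wV)
  finally have dk: "d - of_nat k * w ^ (k - 1) \<in> nonunits V" .
  have "of_nat k \<notin> nonunits V"
  proof -
    have "inverse (of_nat k) = \<iota> (inverse (of_nat k))" by (simp add: iota_inverse iota_of_nat)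
    then have "inverse (of_nat k) \<in> V" using V(2) by auto
    moreover have "of_nat k \<noteq> (0 :: 'k)" using k iota_of_nat[of k] by (metis iota_eq_0)
    ultimately show ?thesis by (simp add: nonunits_def)
  qed
  then have "of_nat k * w ^ (k - 1) \<notin> nonunits V"
    using nonunits_prime[OF V(1), of "of_nat k" "w ^ (k - 1)"] nonunits_power[OF V(1)] w wV
    by (auto intro: VI)
  then have "d \<notin> nonunits V" using unit_cong[OF V(1) _ dk] by blast
  then have "inverse d \<in> loc" "d \<noteq> 0"
    using \<open>d \<in> gen_ring s t\<close> gen_ring_loc denominator_nonzero by (auto intro: loc_inverse)
  moreover have "(?u - w) * d \<in> unif_ideal" using wk unfolding eq by (simp add: frob_fixed_def)
  ultimately have "inverse d * ((?u - w) * d) \<in> unif_ideal" by (blast intro: unif_ideal_mult)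
  moreover have "inverse d * ((?u - w) * d) = ?u - w" using \<open>d \<noteq> 0\<close> by simp
  ultimately have "?u - w \<in> unif_ideal" by (simp only:)
  then show ?thesis using w gen_ring_loc by (auto simp: frob_fixed_def)
qed

end

text \<open>
  The last condition excludes valuation rings that are not discrete. It holds for places, and for
  the rings supplied by Zorn's lemma it follows from the algebraicity of the function field over \<open>k(x)\<close>.
\<close>

locale smooth_point = local_coordinates +
  assumes coords_fixed: "s \<in> frob_fixed" "t \<in> frob_fixed"
    and unif_nonzero: "\<pi> \<noteq> 0"
    and separated: "h \<noteq> 0 \<Longrightarrow> \<exists>i. \<forall>g\<in>V. h \<noteq> \<pi> ^ i * g"
begin

lemma gen_ring_fixed: "gen_ring s t \<subseteq> frob_fixed"
  by (rule gen_ring_subset[OF subring_frob_fixed iota_frob_fixed coords_fixed])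

text \<open>
  For \<open>a\<close> in the maximal ideal, \<open>\<pi>\<close> divides \<open>a - a^Q = (1 - a^(Q-1)) a\<close>, where the first factor is a
  unit.
\<close>

lemma nonunits_unif_ideal:
  assumes h: "h \<in> loc" "h \<in> nonunits V"
  shows "h \<in> unif_ideal"
proof -
  obtain a b where *: "h = a / b" "a \<in> gen_ring s t" "b \<in> gen_ring s t" "b \<notin> nonunits V"
    using h(1) by (auto simp: loc_def)
  have b0: "b \<noteq> 0" using * denominator_nonzero by auto
  have ib: "inverse b \<in> loc" using * gen_ring_loc by (auto intro: loc_inverse)
  have "a = h * b" using * b0 by simp
  then have aV: "a \<in> nonunits V" using nonunits_mult(2)[OF V(1) h(2), of b] * gen_ring_V by auto
  let ?Q = "CARD('a) ^ r"
  have Q: "?Q \<ge> 2" using r card_field_ge_2[where 'a = 'a] by (metis self_le_power le_trans one_le_numeral)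
  define w where "w = 1 - a ^ (?Q - 1)"
  have "a ^ (?Q - 1) \<in> nonunits V" using aV Q by (intro nonunits_power_pos[OF V(1)]) auto
  then have wn: "w \<notin> nonunits V"
    using unit_add_nonunit[OF V(1) one_notin_nonunits[OF V(1)] nonunits_uminus[OF V(1)]]
    unfolding w_def by fastforce
  have wl: "w \<in> loc" using * gen_ring_loc unfolding w_def by (auto intro!: loc_intros)
  have "- (a ^ ?Q - a) \<in> unif_ideal"
    using gen_ring_fixed * by (intro unif_ideal_uminus) (auto simp: frob_fixed_def)
  moreover have "- (a ^ ?Q - a) = w * a"
  proof -
    have "a ^ ?Q = a * a ^ (?Q - 1)" using Q by (metis power_eq_if not_numeral_le_zero)
    then show ?thesis by (simp add: w_def algebra_simps)
  qed
  ultimately have "inverse b * (inverse w * (w * a)) \<in> unif_ideal"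
    using loc_inverse[OF wl wn] ib by (auto intro: unif_ideal_mult)
  moreover have "inverse b * (inverse w * (w * a)) = h"
    using * b0 denominator_nonzero[OF wn] by (simp add: field_simps)
  ultimately show ?thesis by simp
qed

lemma factor_loc:
  assumes h: "h \<in> loc" "h \<noteq> 0"
  obtains i u where "u \<in> loc" "u \<notin> nonunits V" "h = \<pi> ^ i * u"
proof -
  have "\<exists>j u. u \<in> loc \<and> u \<notin> nonunits V \<and> h = \<pi> ^ j * u"
    if "h \<in> loc" "\<forall>g\<in>V. h \<noteq> \<pi> ^ i * g" for i h
    using that
  proof (induction i arbitrary: h)
    case 0
    then show ?case using loc_V by auto
  next
    case (Suc i)
    show ?case
    proof (cases "h \<in> nonunits V")
      case False
      then show ?thesis using Suc.prems by (intro exI[of _ 0] exI[of _ h]) auto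
    next
      case True
      then obtain g where g: "g \<in> loc" "h = \<pi> * g"
        using nonunits_unif_ideal Suc.prems by (auto simp: unif_ideal_def)
      then have "\<forall>g'\<in>V. g \<noteq> \<pi> ^ i * g'" using Suc.prems by (auto simp: mult.assoc)
      from Suc.IH[OF g(1) this] obtain j u where "u \<in> loc" "u \<notin> nonunits V" "g = \<pi> ^ j * u" by blast
      then show ?thesis using g by (intro exI[of _ "Suc j"] exI[of _ u]) auto
    qed
  qed
  then show ?thesis using separated[OF h(2)] h(1) that by blast
qed

lemma loc_unit_inverse:
  assumes "u \<in> loc" "u \<notin> nonunits V"
  shows "inverse u \<in> loc" "inverse u \<notin> nonunits V"
proof -
  show 1: "inverse u \<in> loc" by (rule loc_inverse[OF assms])
  show "inverse u \<notin> nonunits V"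
  proof
    assume "inverse u \<in> nonunits V"
    then have "inverse u = 0 \<or> u \<notin> V" by (simp add: nonunits_def)
    then show False using assms loc_V denominator_nonzero[of u] by auto
  qed
qed

lemma unit_mult:
  assumes "u \<in> loc" "u \<notin> nonunits V" "w \<in> loc" "w \<notin> nonunits V"
  shows "u * w \<notin> nonunits V"
  using nonunits_prime[OF V(1), of u w] assms loc_V by auto

lemma factor:
  assumes h: "h \<noteq> 0"
  obtains m u where "u \<in> loc" "u \<notin> nonunits V" "h = \<pi> powi m * u"
proof -
  obtain a b where ab: "a \<in> gen_ring s t" "b \<in> gen_ring s t" "b \<noteq> 0" "h = a / b"
    using gens unfolding generates_def by blast
  have "a \<in> loc" "a \<noteq> 0" "b \<in> loc" using ab h gen_ring_loc by auto
  then obtain i u where u: "u \<in> loc" "u \<notin> nonunits V" "a = \<pi> ^ i * u" using factor_loc by blast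
  obtain j w where w: "w \<in> loc" "w \<notin> nonunits V" "b = \<pi> ^ j * w"
    using factor_loc[OF \<open>b \<in> loc\<close> ab(3)] by blast
  have "w \<noteq> 0" using w denominator_nonzero by auto
  then have "h = \<pi> powi (int i - int j) * (u * inverse w)"
    using unif_nonzero unfolding ab(4) u(3) w(3) by (simp add: power_int_diff field_simps)
  moreover have "u * inverse w \<in> loc" "u * inverse w \<notin> nonunits V"
    using u w loc_unit_inverse[of w] unit_mult[of u "inverse w"] loc_intros(3)[of u "inverse w"] by auto
  ultimately show ?thesis using that by blast
qed

lemma unit_power_unique:
  assumes "u \<in> V" "u \<notin> nonunits V" "w \<in> V" "w \<notin> nonunits V"
    and eq: "\<pi> powi m * u = \<pi> powi k * w"
  shows "m = k"
proof -
  have *: False if "m < k" "u \<in> V" "u \<notin> nonunits V" "w \<in> V" "w \<notin> nonunits V"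
    and eq: "\<pi> powi m * u = \<pi> powi k * w" for m k u w
  proof -
    have "\<pi> powi k = \<pi> powi m * \<pi> ^ nat (k - m)"
      using that(1) unif_nonzero by (simp add: power_int_add[symmetric] flip: power_int_of_nat)
    then have "u = \<pi> ^ nat (k - m) * w" using eq unif_nonzero by simp
    also have "\<dots> \<in> nonunits V"
      using that by (intro nonunits_mult(2)[OF V(1)] nonunits_power_pos[OF V(1)] unif) auto
    finally show False using that by simp
  qed
  show ?thesis using *[of m k u w] *[of k m w u] assms by fastforce
qed

text \<open>Reading off the exponent of \<open>\<pi>\<close> turns the abstract valuation ring into a place.\<close>

definition unif_order :: "'b \<Rightarrow> int" where
  "unif_order h = (if h = 0 then 0
     else (THE m. \<exists>u. u \<in> V \<and> u \<notin> nonunits V \<and> h = \<pi> powi m * u))"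

lemma unif_order_eq:
  assumes "u \<in> V" "u \<notin> nonunits V"
  shows "unif_order (\<pi> powi m * u) = m"
proof -
  have "u \<noteq> 0" using assms denominator_nonzero by auto
  then have "\<pi> powi m * u \<noteq> 0" using unif_nonzero by simp
  then show ?thesis
    unfolding unif_order_def using assms unit_power_unique by (auto intro!: the_equality)
qed

lemma unif_order_regular:
  assumes "h \<noteq> 0"
  shows "h \<in> V \<longleftrightarrow> 0 \<le> unif_order h" "h \<in> nonunits V \<longleftrightarrow> 0 < unif_order h"
proof -
  obtain m u where u: "u \<in> loc" "u \<notin> nonunits V" "h = \<pi> powi m * u" using factor[OF assms] .
  then have o: "unif_order h = m" using unif_order_eq loc_V by auto
  have uV: "u \<in> V" using u loc_V by auto
  have pos: "h \<in> nonunits V" if "m > 0"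
  proof -
    have "h = \<pi> ^ nat m * u" using u that by (simp flip: power_int_of_nat)
    then show ?thesis using that uV
      by (simp add: nonunits_mult[OF V(1)] nonunits_power_pos[OF V(1)] unif)
  qed
  have neg: "h \<notin> V" if "m < 0"
  proof
    assume "h \<in> V"
    have "u = \<pi> ^ nat (- m) * h"
      using u that unif_nonzero by (simp flip: power_int_of_nat mult.assoc power_int_add)
    then have "u \<in> nonunits V" using \<open>h \<in> V\<close> that
      by (simp add: nonunits_mult[OF V(1)] nonunits_power_pos[OF V(1)] unif)
    then show False using u by simp
  qed
  have zero: "h = u" if "m = 0" using u that by simp
  show "h \<in> V \<longleftrightarrow> 0 \<le> unif_order h"
    using pos neg zero uV nonunits_subset[OF V(1), of h] unfolding o
    by (cases m "0::int" rule: linorder_cases) auto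
  show "h \<in> nonunits V \<longleftrightarrow> 0 < unif_order h"
    using pos neg zero u nonunits_subset[OF V(1), of h] unfolding o
    by (cases m "0::int" rule: linorder_cases) auto
qed

theorem unif_order_place:
  shows "unif_order \<in> places \<iota>" "unif_order \<pi> = 1"
    "regular_at unif_order h \<longleftrightarrow> h \<in> V" "vanishes_at unif_order h \<longleftrightarrow> h \<in> nonunits V"
proof -
  have mult: "unif_order (g * h) = unif_order g + unif_order h" if gh: "g \<noteq> 0" "h \<noteq> 0" for g h
  proof -
    obtain m u where u: "u \<in> loc" "u \<notin> nonunits V" "g = \<pi> powi m * u" using factor[OF gh(1)] .
    obtain k w where w: "w \<in> loc" "w \<notin> nonunits V" "h = \<pi> powi k * w" using factor[OF gh(2)] .
    have "g * h = \<pi> powi (m + k) * (u * w)"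
      using u w unif_nonzero by (simp add: power_int_add mult_ac)
    moreover have "u * w \<in> V" "u * w \<notin> nonunits V" using u w unit_mult loc_V loc_intros(3) by blast+
    ultimately have "unif_order (g * h) = m + k" using unif_order_eq by simp
    moreover have "unif_order g = m" "unif_order h = k" using u w unif_order_eq loc_V by auto
    ultimately show ?thesis by simp
  qed
  have one: "unif_order 1 = 0"
    using unif_order_eq[of 1 0] one_notin_nonunits[OF V(1)] valuation_ring_intros(1)[OF V(1)] by simp
  have *: "unif_order g \<le> unif_order (g + h)"
    if "g \<noteq> 0" "h \<noteq> 0" "g + h \<noteq> 0" "unif_order g \<le> unif_order h" for g h
  proof -
    have "g * (h / g) = h" using that by simp
    then have "unif_order h = unif_order g + unif_order (h / g)"
      using mult[of g "h / g"] that by simp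
    then have "h / g \<in> V" using unif_order_regular(1)[of "h / g"] that by simp
    then have "1 + h / g \<in> V" by (intro valuation_ring_intros[OF V(1)])
    moreover have gh: "g + h = g * (1 + h / g)" using that by (simp add: field_simps)
    moreover have "1 + h / g \<noteq> 0" using gh that by auto
    ultimately show ?thesis using mult[of g "1 + h / g"] unif_order_regular(1)[of "1 + h / g"] that by simp
  qed
  have add: "min (unif_order g) (unif_order h) \<le> unif_order (g + h)"
    if "g \<noteq> 0" "h \<noteq> 0" "g + h \<noteq> 0" for g h
    using *[of g h] *[of h g] that by (auto simp: min_def add.commute)
  have const: "unif_order (\<iota> a) = 0" if "a \<noteq> 0" for a
  proof -
    have "\<iota> a \<in> V" "\<iota> (inverse a) \<in> V" using V(2) by auto
    then have "0 \<le> unif_order (\<iota> a)" "0 \<le> unif_order (\<iota> (inverse a))"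
      using unif_order_regular(1) that by auto
    moreover have "unif_order (\<iota> a) + unif_order (\<iota> (inverse a)) = 0"
      using mult[of "\<iota> a" "\<iota> (inverse a)"] that one by (simp add: iota_1 flip: iota_mult)
    ultimately show ?thesis by linarith
  qed
  show pi: "unif_order \<pi> = 1"
    using unif_order_eq[of 1 1] one_notin_nonunits[OF V(1)] valuation_ring_intros(1)[OF V(1)] by simp
  have "unif_order 0 = 0" by (simp add: unif_order_def)
  then show "unif_order \<in> places \<iota>"
    unfolding places_def using mult add const pi unif_nonzero by blast
  show "regular_at unif_order h \<longleftrightarrow> h \<in> V"
    using unif_order_regular(1)[of h] valuation_ring_intros(4)[OF V(1)] by (auto simp: regular_at_def)
  show "vanishes_at unif_order h \<longleftrightarrow> h \<in> nonunits V"
    using unif_order_regular(2)[of h] zero_nonunits[OF V(1)] by (auto simp: vanishes_at_def)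
qed

end

section \<open>Derivations and local coordinates\<close>

context constant_embedding
begin

lemma derivation_quotient:
  assumes \<delta>: "derivation_over \<iota> \<delta>" and b: "b \<noteq> 0"
  shows "\<delta> (a / b) = (\<delta> a * b - a * \<delta> b) / b ^ 2"
proof -
  have "\<delta> a = \<delta> (b * (a / b))" using b by simp
  also have "\<dots> = b * \<delta> (a / b) + (a / b) * \<delta> b" using \<delta> unfolding derivation_over_def by blast
  finally show ?thesis using b by (simp add: field_simps power2_eq_square)
qed

lemma derivation_basic:
  assumes \<delta>: "derivation_over \<iota> \<delta>"
  shows "\<delta> 0 = 0" "\<delta> 1 = 0" "\<delta> (g + h) = \<delta> g + \<delta> h" "\<delta> (g * h) = g * \<delta> h + h * \<delta> g"
    "\<delta> (- h) = - \<delta> h" "\<delta> (g - h) = \<delta> g - \<delta> h" "\<delta> (\<iota> a) = 0"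
    "\<delta> (h ^ k) = of_nat k * h ^ (k - 1) * \<delta> h"
proof -
  have add: "\<delta> (g + h) = \<delta> g + \<delta> h" and mult: "\<delta> (g * h) = g * \<delta> h + h * \<delta> g"
    and const: "\<delta> (\<iota> a) = 0" for g h a
    using \<delta> unfolding derivation_over_def by blast+
  show "\<delta> (g + h) = \<delta> g + \<delta> h" "\<delta> (g * h) = g * \<delta> h + h * \<delta> g" "\<delta> (\<iota> a) = 0"
    by (fact add mult const)+
  show zero: "\<delta> 0 = 0" and one: "\<delta> 1 = 0" using const[of 0] const[of 1] by (simp_all add: iota_1)
  have um: "\<delta> (- h) = - \<delta> h" for h
    using add[of h "- h"] zero by (simp add: eq_neg_iff_add_eq_0 add.commute)
  then show "\<delta> (- h) = - \<delta> h" .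
  show "\<delta> (g - h) = \<delta> g - \<delta> h" using add[of g "- h"] um by simp
  show "\<delta> (h ^ k) = of_nat k * h ^ (k - 1) * \<delta> h"
  proof (induction k)
    case (Suc k)
    have "\<delta> (h ^ Suc k) = h * \<delta> (h ^ k) + h ^ k * \<delta> h" by (simp add: mult)
    also have "\<dots> = of_nat k * (h * h ^ (k - 1)) * \<delta> h + h ^ k * \<delta> h" by (simp add: Suc)
    also have "\<dots> = of_nat (Suc k) * h ^ k * \<delta> h"
      by (cases k) (simp_all add: algebra_simps)
    finally show ?case by simp
  qed (simp add: one)
qed

lemma derivation_scale:
  assumes \<delta>: "derivation_over \<iota> \<delta>"
  shows "derivation_over \<iota> (\<lambda>h. m * \<delta> h)"
  unfolding derivation_over_def
proof (intro conjI allI)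
  show "m * \<delta> (\<iota> a) = 0" for a by (simp add: derivation_basic(7)[OF \<delta>])
  show "m * \<delta> (g + h) = m * \<delta> g + m * \<delta> h" for g h
    unfolding derivation_basic(3)[OF \<delta>] by (rule distrib_left)
  show "m * \<delta> (g * h) = g * (m * \<delta> h) + h * (m * \<delta> g)" for g h
    unfolding derivation_basic(4)[OF \<delta>] by (simp add: distrib_left mult.left_commute)
qed

lemma derivation_ev:
  assumes \<delta>: "derivation_over \<iota> \<delta>"
  shows "\<delta> (ev g t) = ev (pderiv g) t * \<delta> t"
proof (induction g)
  case (pCons a g)
  have "\<delta> (ev (pCons a g) t) = t * \<delta> (ev g t) + ev g t * \<delta> t"
    by (simp add: ev_pCons derivation_basic(3,4,7)[OF \<delta>])
  then show ?case by (simp add: pCons pderiv_pCons ev_add ev_pCons algebra_simps)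
qed (simp add: derivation_basic(1)[OF \<delta>])

end

context local_coordinates
begin

text \<open>By the product and quotient rules, regularity of \<open>\<theta>\<close> need only be tested on the coordinates.\<close>

lemma derivation_loc:
  assumes \<theta>: "derivation_over \<iota> \<theta>" and st: "\<theta> s \<in> V" "\<theta> t \<in> V" and h: "h \<in> loc"
  shows "\<theta> h \<in> V"
proof -
  note VI = valuation_ring_intros[OF V(1)]
  have "subring {h \<in> V. \<theta> h \<in> V}"
    by (rule subringI) (auto simp: derivation_basic[OF \<theta>] intro!: VI)
  then have R: "gen_ring s t \<subseteq> {h \<in> V. \<theta> h \<in> V}"
    by (rule gen_ring_subset) (use V st in \<open>auto simp: derivation_basic[OF \<theta>] intro: VI\<close>)
  obtain a b where *: "h = a / b" "a \<in> gen_ring s t" "b \<in> gen_ring s t" "b \<notin> nonunits V"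
    using h by (auto simp: loc_def)
  have "\<theta> h = (\<theta> a * b - a * \<theta> b) * inverse b ^ 2"
    using derivation_quotient[OF \<theta>, of b a] * denominator_nonzero
    by (simp add: divide_inverse power_inverse)
  moreover have "inverse b \<in> V" using inverse_unit[OF V(1), of b] * R by auto
  ultimately show ?thesis using R * by (auto intro!: VI)
qed

end

section \<open>Places\<close>

definition place_ring :: "'k::field point \<Rightarrow> 'k set" where
  "place_ring P = {h. regular_at P h}"

context constant_embedding
begin

context
  fixes P :: "'k point"
  assumes P: "P \<in> places \<iota>"
begin

lemma place_0: "P 0 = 0" using P by (simp add: places_def)
lemma place_mult: "g \<noteq> 0 \<Longrightarrow> h \<noteq> 0 \<Longrightarrow> P (g * h) = P g + P h" using P by (simp add: places_def)
lemma place_add: "g \<noteq> 0 \<Longrightarrow> h \<noteq> 0 \<Longrightarrow> g + h \<noteq> 0 \<Longrightarrow> min (P g) (P h) \<le> P (g + h)"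
  using P by (simp add: places_def)
lemma place_iota: "P (\<iota> a) = 0" using P place_0 by (cases "a = 0") (simp_all add: places_def)
lemma place_unif: "\<exists>t. P t = 1" using P by (auto simp: places_def)
lemma place_1: "P 1 = 0" using place_iota[of 1] by (simp add: iota_1)
lemma place_uminus: "P (- h) = P h"
proof (cases "h = 0")
  case False
  have "P (- h) = P (\<iota> (- 1)) + P h"
    using place_mult[of "- 1" h] False by (simp add: iota_uminus iota_1)
  then show ?thesis by (simp only: place_iota)
qed simp
lemma place_inverse: "P (inverse h) = - P h"
  by (cases "h = 0") (use place_mult[of h "inverse h"] in \<open>simp_all add: place_0 place_1\<close>)
lemma place_divide: "g \<noteq> 0 \<Longrightarrow> h \<noteq> 0 \<Longrightarrow> P (g / h) = P g - P h"
  using place_mult[of g "inverse h"] by (simp add: divide_inverse place_inverse)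
lemma place_power: "P (h ^ k) = int k * P h"
proof (cases "h = 0")
  case False
  then show ?thesis by (induction k) (simp_all add: place_1 place_mult algebra_simps)
qed (cases k; simp add: place_0 place_1)
lemma place_powi: "P (h powi m) = m * P h"
  by (simp add: power_int_def place_power place_inverse)

lemma valuation_ring_place: "valuation_ring (place_ring P)"
  unfolding valuation_ring_def
proof (intro conjI allI)
  show "subring (place_ring P)"
  proof (rule subringI)
    show "1 \<in> place_ring P" by (simp add: place_ring_def regular_at_def place_1)
  next
    fix a b assume "a \<in> place_ring P" "b \<in> place_ring P"
    then have ab: "a = 0 \<or> 0 \<le> P a" "b = 0 \<or> 0 \<le> P b" by (auto simp: place_ring_def regular_at_def)
    show "a * b \<in> place_ring P"
      using ab place_mult[of a b] by (cases "a = 0 \<or> b = 0") (auto simp: place_ring_def regular_at_def)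
    show "a - b \<in> place_ring P"
    proof (cases "a = 0 \<or> b = 0 \<or> a - b = 0")
      case True
      then show ?thesis using ab by (auto simp: place_ring_def regular_at_def place_uminus)
    next
      case False
      then have "0 \<le> P (a - b)" using ab place_add[of a "- b"] by (simp add: place_uminus)
      then show ?thesis by (simp add: place_ring_def regular_at_def)
    qed
  qed
  show "u \<in> place_ring P \<or> inverse u \<in> place_ring P" for u
    by (auto simp: place_ring_def regular_at_def place_inverse)
qed

lemma nonunits_place: "nonunits (place_ring P) = {h. vanishes_at P h}"
proof (intro set_eqI)
  show "h \<in> nonunits (place_ring P) \<longleftrightarrow> h \<in> {h. vanishes_at P h}" for h
    by (cases "h = 0") (auto simp: nonunits_def place_ring_def regular_at_def vanishes_at_def place_inverse)
qed

lemma unit_place: "h \<in> place_ring P \<Longrightarrow> h \<notin> nonunits (place_ring P) \<longleftrightarrow> h \<noteq> 0 \<and> P h = 0"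
  unfolding nonunits_place
  by (cases "h = 0") (auto simp: place_ring_def regular_at_def vanishes_at_def)

lemma iota_place_ring: "range \<iota> \<subseteq> place_ring P"
proof
  fix h assume "h \<in> range \<iota>"
  then obtain a where "h = \<iota> a" by blast
  then show "h \<in> place_ring P" by (simp add: place_ring_def regular_at_def place_iota)
qed

lemma separated_place:
  assumes "vanishes_at P \<pi>" "\<pi> \<noteq> 0" "h \<noteq> 0"
  shows "\<exists>i. \<forall>g\<in>place_ring P. h \<noteq> \<pi> ^ i * g"
proof (intro exI ballI notI)
  fix g assume g: "g \<in> place_ring P" "h = \<pi> ^ nat (P h + 1) * g"
  then have g0: "g \<noteq> 0" "P g \<ge> 0" using assms by (auto simp: place_ring_def regular_at_def)
  have "P h = int (nat (P h + 1)) * P \<pi> + P g"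
    using g g0 assms by (metis place_mult place_power power_not_zero)
  moreover have "int (nat (P h + 1)) * P \<pi> \<ge> int (nat (P h + 1)) * 1"
    using assms by (intro mult_left_mono) (auto simp: vanishes_at_def)
  ultimately show False using g0 by linarith
qed

lemma place_add_unequal:
  assumes "g \<noteq> 0" "h = 0 \<or> P g < P h"
  shows "P (g + h) = P g \<and> g + h \<noteq> 0"
proof (cases "h = 0")
  case False
  then have lt: "P g < P h" using assms by simp
  have ne: "g + h \<noteq> 0"
  proof
    assume "g + h = 0"
    then have "g = - h" by (simp add: eq_neg_iff_add_eq_0)
    then show False using lt place_uminus by simp
  qed
  have "P (g + h) \<ge> P g" using place_add[of g h] assms False ne lt by simp
  moreover have "P g \<ge> min (P (g + h)) (P (- h))"
    using place_add[of "g + h" "- h"] assms False ne by simp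
  ultimately show ?thesis using lt ne by (auto simp: place_uminus)
next
  case True
  then show ?thesis using assms(1) by simp
qed

end

end

text \<open>Some element has order one, and it is a power of \<open>\<pi>\<close> times a unit.\<close>

lemma (in smooth_point) place_of_unif:
  assumes P: "P \<in> places \<iota>" and VP: "V = place_ring P"
  shows "P \<pi> = 1"
    and "h = \<pi> powi m * u \<Longrightarrow> u \<in> loc \<Longrightarrow> u \<notin> nonunits V \<Longrightarrow> P h = m"
proof -
  have u0: "P u = 0 \<and> u \<noteq> 0" if "u \<in> loc" "u \<notin> nonunits V" for u
    using that loc_V unit_place[OF P] VP by auto
  obtain \<tau> where \<tau>: "P \<tau> = 1" using place_unif[OF P] by blast
  then have "\<tau> \<noteq> 0" using place_0[OF P] by auto
  then obtain k w where kw: "w \<in> loc" "w \<notin> nonunits V" "\<tau> = \<pi> powi k * w" by (rule factor)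
  then have "k * P \<pi> = 1"
    using \<tau> u0 place_mult[OF P, of "\<pi> powi k" w] unif_nonzero by (simp add: place_powi[OF P])
  moreover have "P \<pi> > 0"
    using unif unif_nonzero VP nonunits_place[OF P] by (auto simp: vanishes_at_def)
  ultimately show 1: "P \<pi> = 1" using zmult_eq_1_iff by auto
  assume "h = \<pi> powi m * u" "u \<in> loc" "u \<notin> nonunits V"
  then show "P h = m"
    using u0 place_mult[OF P, of "\<pi> powi m" u] unif_nonzero 1 by (simp add: place_powi[OF P])
qed

text \<open>
  A multiple \<open>\<theta> = m \<delta>\<close> of a derivation that is regular on the coordinates and does not vanish on
  \<open>\<pi>\<close> has unit values on all uniformisers; so \<open>\<delta>\<close> itself has order \<open>- ord m\<close> on them.
\<close>

lemma (in smooth_point) derivation_order: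
  assumes P: "P \<in> places \<iota>" and VP: "V = place_ring P"
    and \<delta>: "derivation_over \<iota> \<delta>" and m: "m \<noteq> 0"
    and st: "m * \<delta> s \<in> V" "m * \<delta> t \<in> V" and unit: "m * \<delta> \<pi> \<in> V" "m * \<delta> \<pi> \<notin> nonunits V"
    and \<tau>: "P \<tau> = 1"
  shows "\<delta> \<tau> \<noteq> 0" "P (\<delta> \<tau>) = - P m"
proof -
  let ?\<theta> = "\<lambda>h. m * \<delta> h"
  note VI = valuation_ring_intros[OF V(1)]
  have \<theta>: "derivation_over \<iota> ?\<theta>" by (rule derivation_scale[OF \<delta>])
  have "\<tau> \<noteq> 0" using place_0[OF P] \<tau> by auto
  then obtain k u where u: "u \<in> loc" "u \<notin> nonunits V" "\<tau> = \<pi> powi k * u" by (rule factor)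
  then have "k = 1" using place_of_unif(2)[OF P VP u(3,1,2)] \<tau> by simp
  then have \<tau>u: "\<tau> = \<pi> * u" using u by simp
  have "?\<theta> \<tau> = u * ?\<theta> \<pi> + \<pi> * ?\<theta> u"
    using derivation_basic(4)[OF \<theta>, of \<pi> u] \<tau>u by simp
  moreover have "u * ?\<theta> \<pi> \<notin> nonunits V"
    using nonunits_prime[OF V(1), of u "?\<theta> \<pi>"] u unit loc_V by auto
  moreover have "\<pi> * ?\<theta> u \<in> nonunits V"
    by (intro nonunits_mult(2)[OF V(1) unif] derivation_loc[OF \<theta> st] u)
  moreover have "?\<theta> \<tau> \<in> V"
    using \<tau>u u loc_V unit derivation_loc[OF \<theta> st u(1)] nonunits_subset[OF V(1) unif] calculation(1)
    by (auto intro!: VI)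
  ultimately have "?\<theta> \<tau> \<noteq> 0 \<and> P (?\<theta> \<tau>) = 0"
    using unit_add_nonunit[OF V(1)] unit_place[OF P] VP by metis
  then show "\<delta> \<tau> \<noteq> 0" "P (\<delta> \<tau>) = - P m" using place_mult[OF P, of m "\<delta> \<tau>"] m by auto
qed

context constant_embedding
begin

lemma ev_bound:
  assumes "degree g \<le> m"
  shows "ev g t = (\<Sum>i\<le>m. \<iota> (coeff g i) * t ^ i)"
  unfolding ev_altdef by (rule sum.mono_neutral_left) (use assms in \<open>auto simp: coeff_eq_0\<close>)

lemma ev_pcompose: "ev (pcompose g h) t = ev g (ev h t)"
  by (induction g) (simp_all add: pcompose_pCons ev_add ev_mult ev_pCons)

lemma bev_pcompose: "bev s t (pcompose A B) = bev s (bev s t B) A"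
  by (induction A) (simp_all add: pcompose_pCons bev_add bev_mult bev_pCons)

lemma ev_reflect_poly:
  assumes "t \<noteq> 0"
  shows "ev g t = t ^ degree g * ev (reflect_poly g) (inverse t)"
proof -
  let ?d = "degree g"
  have "ev (reflect_poly g) (inverse t) = (\<Sum>i\<le>?d. \<iota> (coeff (reflect_poly g) i) * inverse t ^ i)"
    by (rule ev_bound[OF degree_reflect_poly_le])
  also have "\<dots> = (\<Sum>i\<le>?d. \<iota> (coeff g (?d - i)) * inverse t ^ i)"
    by (rule sum.cong) (auto simp: coeff_reflect_poly)
  also have "\<dots> = (\<Sum>i\<le>?d. \<iota> (coeff g i) * inverse t ^ (?d - i))"
    by (rule sum.reindex_bij_witness[of _ "\<lambda>i. ?d - i" "\<lambda>i. ?d - i"]) auto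
  finally have "t ^ ?d * ev (reflect_poly g) (inverse t)
      = (\<Sum>i\<le>?d. t ^ ?d * (\<iota> (coeff g i) * inverse t ^ (?d - i)))"
    by (simp add: sum_distrib_left)
  also have "\<dots> = (\<Sum>i\<le>?d. \<iota> (coeff g i) * t ^ i)"
  proof (rule sum.cong)
    fix i assume "i \<in> {..?d}"
    then have "t ^ ?d = t ^ i * t ^ (?d - i)" by (simp add: power_add[symmetric])
    then show "t ^ ?d * (\<iota> (coeff g i) * inverse t ^ (?d - i)) = \<iota> (coeff g i) * t ^ i"
      using assms by (simp add: field_simps)
  qed simp
  finally show ?thesis by (simp add: ev_altdef)
qed

definition transcendental :: "'k \<Rightarrow> bool" where
  "transcendental t \<longleftrightarrow> (\<forall>g. ev g t = 0 \<longrightarrow> g = 0)"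

text \<open>The ring of polynomials in \<open>t\<close> does not contain \<open>1/t\<close>.\<close>

lemma transcendental_valuation_ring:
  assumes t: "transcendental t"
  obtains V where "valuation_ring V" "range \<iota> \<subseteq> V" "t \<in> nonunits V"
proof -
  let ?R = "range (\<lambda>g. ev g t)"
  have "subring ?R"
    by (rule subringI) (auto simp: ev_diff[symmetric] ev_mult[symmetric] intro: range_eqI[of _ _ 1])
  moreover have tR: "t \<in> ?R" by (rule range_eqI[of _ _ "[:0, 1:]"]) (simp add: ev_pCons iota_1)
  moreover have "inverse t \<notin> ?R"
  proof
    assume "inverse t \<in> ?R"
    then obtain g where g: "inverse t = ev g t" by auto
    have "t \<noteq> 0"
    proof
      assume "t = 0"
      then have "ev [:0, 1:] t = 0" by (simp add: ev_pCons)
      then show False using t unfolding transcendental_def by (metis pCons_eq_0_iff zero_neq_one)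
    qed
    then have "ev ([:0, 1:] * g - 1) t = 0"
      using g[symmetric] by (simp add: ev_diff ev_pCons)
    then have "[:0, 1:] * g - 1 = 0" using t unfolding transcendental_def by blast
    then have "coeff ([:0, 1:] * g - 1) 0 = 0" by simp
    then show False by simp
  qed
  ultimately obtain V where V: "valuation_ring V" "?R \<subseteq> V" "t \<in> nonunits V"
    by (rule exists_valuation_ring)
  have "\<iota> a \<in> ?R" for a by (rule range_eqI[of _ _ "[:a:]"]) (simp add: ev_pCons)
  then show ?thesis using V that by blast
qed

end

section \<open>The function field of a superelliptic curve with split branch locus\<close>

locale split_superelliptic = superelliptic_function_field \<iota> n f x y
  for \<iota> :: "'a::{finite,field} \<Rightarrow> 'k::field" and n f x y +
  fixes roots :: "'a set"
  assumes n: "n \<ge> 2" "n dvd CARD('a) - 1"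
    and degree_f: "degree f \<ge> 3" "card roots = degree f"
    and split: "f = smult (lead_coeff f) (\<Prod>a\<in>roots. [:- a, 1:])"
begin

sublocale constant_embedding \<iota>
  by unfold_locales (rule embed_one embed_add embed_mult)+

lemma n_nonzero: "of_nat n \<noteq> (0 :: 'a)" "of_nat n \<noteq> (0 :: 'k)"
  using of_nat_dvd_card_minus_1[OF n(2)] of_nat_nonzero[OF n(2)] by auto

lemma f_nonzero: "f \<noteq> 0" using degree_f by auto

lemma finite_roots: "finite roots" using degree_f by (metis card.infinite not_numeral_le_zero)

lemma poly_f: "poly f a = 0 \<longleftrightarrow> a \<in> roots"
  by (subst split) (simp add: poly_prod f_nonzero prod_zero_iff finite_roots eq_neg_iff_add_eq_0)

lemma root_factor:
  assumes "a \<in> roots"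
  obtains f1 where "f = [:- a, 1:] * f1" "poly f1 a \<noteq> 0"
proof
  let ?g = "smult (lead_coeff f) (\<Prod>b\<in>roots - {a}. [:- b, 1:])"
  show "f = [:- a, 1:] * ?g"
    by (subst split) (simp add: prod.remove[OF finite_roots assms])
  show "poly ?g a \<noteq> 0"
    using f_nonzero finite_roots by (simp add: poly_prod prod_zero_iff)
qed

lemma roots_nonempty: obtains a where "a \<in> roots"
  using degree_f by (metis card.empty equals0I not_numeral_le_zero)

lemma ev_x_eq_0 [simp]: "ev g x = 0 \<longleftrightarrow> g = 0" using x_transcendental by auto

lemma y_nonzero: "y \<noteq> 0"
proof
  assume "y = 0"
  then have "ev f x = 0" using curve_equation n by (simp add: power_0_left)
  then show False using f_nonzero by simp
qed

lemma generates_xy: "generates x y"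
  unfolding generates_def gen_ring_def using generated by blast

lemma transcendental_x_minus: "transcendental (x - \<iota> a)"
  unfolding transcendental_def
proof (intro allI impI)
  fix g assume "ev g (x - \<iota> a) = 0"
  then have "ev (pcompose g [:- a, 1:]) x = 0" by (simp add: ev_pcompose ev_linear)
  then show "g = 0" by (simp add: pcompose_eq_0_iff)
qed

lemma x_nonzero: "x \<noteq> 0" using transcendental_x_minus[of 0] unfolding transcendental_def
  by (metis diff_zero ev_pCons iota_0 add_0 mult_zero_left pCons_eq_0_iff zero_neq_one)

lemma transcendental_inverse_x: "transcendental (inverse x)"
  unfolding transcendental_def
proof (intro allI impI)
  fix g assume g: "ev g (inverse x) = 0"
  have "ev g (inverse x) = inverse x ^ degree g * ev (reflect_poly g) x"
    using ev_reflect_poly[of "inverse x" g] x_nonzero by simp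
  then have "reflect_poly g = 0" using g x_nonzero by simp
  then show "g = 0" by simp
qed

lemma (in constant_embedding) ev_residue:
  assumes V: "valuation_ring V" "range \<iota> \<subseteq> V" and t: "t - \<iota> a \<in> nonunits V"
  shows "ev g t - \<iota> (poly g a) \<in> nonunits V" "t \<in> V"
proof -
  have "t - \<iota> a + \<iota> a \<in> V"
    using V t nonunits_subset[OF V(1)] by (intro valuation_ring_intros(6)[OF V(1)]) auto
  then show tV: "t \<in> V" by simp
  show "ev g t - \<iota> (poly g a) \<in> nonunits V"
  proof (induction g)
    case (pCons c g)
    have "ev (pCons c g) t - \<iota> (poly (pCons c g) a)
        = t * (ev g t - \<iota> (poly g a)) + (t - \<iota> a) * \<iota> (poly g a)"
      by (simp add: ev_pCons iota_add iota_mult algebra_simps)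
    also have "\<dots> \<in> nonunits V"
      using V pCons t tV by (intro nonunits_add[OF V(1)] nonunits_mult[OF V(1)]) auto
    finally show ?case .
  qed (simp add: zero_nonunits[OF V(1)])
qed

lemma (in constant_embedding) iota_unit:
  assumes V: "valuation_ring V" "range \<iota> \<subseteq> V"
  shows "\<iota> a \<in> nonunits V \<longleftrightarrow> a = 0"
proof
  assume a: "\<iota> a \<in> nonunits V"
  show "a = 0"
  proof (rule ccontr)
    assume "a \<noteq> 0"
    then have "\<iota> a * \<iota> (inverse a) = 1" by (simp add: iota_1 flip: iota_mult)
    moreover have "\<iota> a * \<iota> (inverse a) \<in> nonunits V"
      using V a by (intro nonunits_mult[OF V(1)]) auto
    ultimately show False using one_notin_nonunits[OF V(1)] by simp
  qed
qed (simp add: zero_nonunits[OF V(1)])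

lemma (in constant_embedding) ev_nonunit_iff:
  assumes V: "valuation_ring V" "range \<iota> \<subseteq> V" and t: "t - \<iota> a \<in> nonunits V"
  shows "ev g t \<in> nonunits V \<longleftrightarrow> poly g a = 0"
proof -
  have *: "ev g t - \<iota> (poly g a) \<in> nonunits V" by (rule ev_residue(1)[OF V t])
  have "ev g t \<in> nonunits V \<longleftrightarrow> \<iota> (poly g a) \<in> nonunits V"
    using nonunits_add[OF V(1) *, of "\<iota> (poly g a)"] nonunits_diff[OF V(1) _ *, of "ev g t"] by auto
  then show ?thesis by (simp add: iota_unit[OF V])
qed

lemma y_integral:
  assumes V: "valuation_ring V" "range \<iota> \<subseteq> V" "x \<in> V"
  shows "y \<in> V"
proof (rule integrally_closed_power[OF V(1)])
  show "y ^ n \<in> V"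
    unfolding curve_equation by (rule ev_in_subring[OF valuation_ring_subring[OF V(1)] V(2,3)])
qed (use n in simp)

text \<open>
  The roots of \<open>f\<close> are simple, so the cofactor \<open>f1\<close> of \<open>X - a\<close> is a unit over \<open>a\<close>: the cover is
  totally ramified there.
\<close>

lemma over_root:
  assumes V: "valuation_ring V" "range \<iota> \<subseteq> V" and x: "x - \<iota> a \<in> nonunits V" and a: "a \<in> roots"
  obtains f1 where "f = [:- a, 1:] * f1" "poly f1 a \<noteq> 0" "ev f1 x \<in> V" "ev f1 x \<notin> nonunits V"
    "x - \<iota> a = y ^ n * inverse (ev f1 x)" "y \<in> nonunits V"
proof -
  obtain f1 where f1: "f = [:- a, 1:] * f1" "poly f1 a \<noteq> 0" using root_factor[OF a] .
  have xV: "x \<in> V" by (rule ev_residue(2)[OF V x])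
  have f1V: "ev f1 x \<in> V" by (rule ev_in_subring[OF valuation_ring_subring[OF V(1)] V(2) xV])
  have unit: "ev f1 x \<notin> nonunits V" using ev_nonunit_iff[OF V x] f1 by simp
  then have nz: "ev f1 x \<noteq> 0" using zero_nonunits[OF V(1)] by metis
  have yn: "y ^ n = (x - \<iota> a) * ev f1 x" unfolding curve_equation f1(1) ev_mult ev_linear ..
  have "y ^ n \<in> nonunits V" unfolding yn by (rule nonunits_mult(2)[OF V(1) x f1V])
  then have "y \<in> nonunits V" by (rule nonunits_power[OF V(1) _ y_integral[OF V xV]])
  moreover have "x - \<iota> a = y ^ n * inverse (ev f1 x)" using yn nz by simp
  ultimately show ?thesis using that f1 f1V unit by blast
qed

section \<open>Independence of the powers of \<open>y\<close>\<close>

text \<open>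
  In a vanishing combination of \<open>1, y, ..., y^(n-1)\<close> over \<open>k[x]\<close>, the first coefficient not
  vanishing at a root \<open>a\<close> of \<open>f\<close> would give a term that no other term can cancel, since
  \<open>x - a\<close> is divisible by \<open>y^n\<close> over \<open>a\<close>.
\<close>

lemma independent_step:
  assumes zero: "bev x y B = 0" and deg: "degree B < n" and a: "a \<in> roots"
  shows "poly (coeff B j) a = 0"
proof (rule ccontr)
  assume "\<not> ?thesis"
  then obtain k where k: "poly (coeff B k) a \<noteq> 0" "\<And>i. i < k \<Longrightarrow> poly (coeff B i) a = 0"
    using exists_least_iff[of "\<lambda>j. poly (coeff B j) a \<noteq> 0"] by auto
  obtain V where V: "valuation_ring V" "range \<iota> \<subseteq> V" "x - \<iota> a \<in> nonunits V"
    using transcendental_valuation_ring[OF transcendental_x_minus] .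
  obtain f1 where f1: "ev f1 x \<in> V" "ev f1 x \<notin> nonunits V" "x - \<iota> a = y ^ n * inverse (ev f1 x)"
    and y: "y \<in> nonunits V"
    using over_root[OF V a] by metis
  note VI = valuation_ring_intros[OF V(1)]
  have xV: "x \<in> V" by (rule ev_residue(2)[OF V])
  have yV: "y \<in> V" by (rule y_integral[OF V(1,2) xV])
  have evV: "ev g x \<in> V" for g by (rule ev_in_subring[OF valuation_ring_subring[OF V(1)] V(2) xV])
  have kn: "k < n"
  proof (rule ccontr)
    assume "\<not> k < n"
    then have "coeff B k = 0" using deg by (intro coeff_eq_0) auto
    then show False using k(1) by simp
  qed
  have div: "\<exists>g\<in>V. ev (coeff B i) x * y ^ i = y ^ Suc k * g" if "i \<noteq> k" for i
  proof (cases "i < k")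
    case True
    then obtain g where g: "coeff B i = [:- a, 1:] * g" using k(2) by (metis poly_eq_0_iff_dvd dvdE)
    have "ev (coeff B i) x * y ^ i = y ^ n * (inverse (ev f1 x) * ev g x * y ^ i)"
      unfolding g ev_mult ev_linear f1(3) by (simp add: mult_ac)
    also have "y ^ n = y ^ Suc k * y ^ (n - Suc k)" using kn by (simp flip: power_add del: power_Suc)
    finally have "ev (coeff B i) x * y ^ i = y ^ Suc k * (y ^ (n - Suc k) * (inverse (ev f1 x) * ev g x * y ^ i))"
      by (simp only: mult.assoc)
    moreover have "y ^ (n - Suc k) * (inverse (ev f1 x) * ev g x * y ^ i) \<in> V"
      by (intro VI yV evV inverse_unit[OF V(1)] f1)
    ultimately show ?thesis by blast
  next
    case False
    then have "y ^ i = y ^ Suc k * y ^ (i - Suc k)" using that by (simp flip: power_add del: power_Suc)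
    then have "ev (coeff B i) x * y ^ i = y ^ Suc k * (ev (coeff B i) x * y ^ (i - Suc k))"
      by (simp only: mult_ac)
    moreover have "ev (coeff B i) x * y ^ (i - Suc k) \<in> V" by (intro VI yV evV)
    ultimately show ?thesis by blast
  qed
  have kd: "k \<in> {..degree B}" using k(1) by (metis atMost_iff le_degree poly_0)
  have "0 = ev (coeff B k) x * y ^ k + (\<Sum>i\<in>{..degree B} - {k}. ev (coeff B i) x * y ^ i)"
    using zero unfolding bev_altdef by (subst (asm) sum.remove[OF _ kd]) auto
  moreover have "\<exists>g\<in>V. (\<Sum>i\<in>A. ev (coeff B i) x * y ^ i) = y ^ Suc k * g" if "k \<notin> A" for A
    using that
  proof (induction A rule: infinite_finite_induct)
    case (insert i A)
    obtain g where g: "g \<in> V" "(\<Sum>i\<in>A. ev (coeff B i) x * y ^ i) = y ^ Suc k * g"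
      using insert by auto
    obtain g' where g': "g' \<in> V" "ev (coeff B i) x * y ^ i = y ^ Suc k * g'"
      using insert.prems div[of i] by auto
    have "(\<Sum>i\<in>insert i A. ev (coeff B i) x * y ^ i) = y ^ Suc k * (g' + g)"
      using insert.hyps g g' by (simp add: distrib_left)
    then show ?case using g(1) g'(1) VI(6) by blast
  qed (auto intro!: bexI[of _ 0] VI)
  then obtain g where "g \<in> V" "(\<Sum>i\<in>{..degree B} - {k}. ev (coeff B i) x * y ^ i) = y ^ Suc k * g"
    by blast
  ultimately have "y ^ k * ev (coeff B k) x = y ^ k * - (y * g)"
    by (simp add: eq_neg_iff_add_eq_0 mult_ac)
  then have "ev (coeff B k) x = - (y * g)"
    using y_nonzero by (metis mult_left_cancel power_not_zero)
  also have "\<dots> \<in> nonunits V"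
    by (intro nonunits_uminus[OF V(1)] nonunits_mult(2)[OF V(1) y \<open>g \<in> V\<close>])
  finally show False using ev_nonunit_iff[OF V] k(1) by simp
qed

text \<open>
  Dividing the relation by \<open>x - a\<close> gives another one, so the coefficients are divisible by all powers
  of \<open>X - a\<close>.
\<close>

lemma independent_powers_y:
  assumes "bev x y B = 0" "degree B < n"
  shows "B = 0"
proof -
  obtain a where a: "a \<in> roots" using roots_nonempty .
  let ?l = "[:- a, 1:]"
  have *: "?l ^ m dvd coeff B j" if "bev x y B = 0" "degree B < n" for m B j
    using that
  proof (induction m arbitrary: B j)
    case (Suc m)
    have "\<forall>i. ?l dvd coeff B i" using independent_step[OF Suc.prems a] poly_eq_0_iff_dvd by blast
    then have "[:?l:] dvd B" by (simp add: const_poly_dvd_iff)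
    then obtain C where C: "B = [:?l:] * C" by (auto elim: dvdE)
    have "bev x y B = ev ?l x * bev x y C" unfolding C bev_mult bev_const ..
    then have "bev x y C = 0" using Suc.prems(1) ev_x_eq_0[of ?l] by simp
    moreover have "degree C < n" using Suc.prems(2) C by simp
    ultimately have "?l ^ m dvd coeff C j" by (rule Suc.IH)
    moreover have "coeff B j = ?l * coeff C j" by (simp add: C)
    ultimately show ?case by (simp add: mult_dvd_mono del: mult_pCons_left)
  qed simp
  have "coeff B j = 0" for j
  proof (rule ccontr)
    assume nz: "coeff B j \<noteq> 0"
    have "degree (?l ^ Suc (degree (coeff B j))) \<le> degree (coeff B j)"
      by (rule dvd_imp_degree_le[OF *[OF assms] nz])
    then show False by (simp add: degree_power_eq del: power_Suc)
  qed
  then show ?thesis by (intro poly_eqI) simp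
qed

definition curve_poly :: "'a poly poly" where "curve_poly = monom 1 n - [:f:]"

lemma bev_curve_poly: "t ^ n = ev f x \<Longrightarrow> bev x t curve_poly = 0"
  by (simp add: curve_poly_def bev_diff bev_monom bev_const)

lemma curve_poly_division:
  obtains C B where "A = curve_poly * C + B" "degree B < n"
proof -
  have deg: "degree curve_poly = n" and lc: "coeff curve_poly n = 1"
  proof -
    have "degree [:f:] < degree (monom (1::'a poly) n)" using n by (simp add: degree_monom_eq)
    then show "degree curve_poly = n"
      unfolding curve_poly_def diff_conv_add_uminus
      by (subst degree_add_eq_left) (simp_all add: degree_monom_eq)
    show "coeff curve_poly n = 1"
      using n by (simp add: curve_poly_def coeff_monom coeff_pCons split: nat.splits)
  qed
  have nz: "curve_poly \<noteq> 0" using deg n by auto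
  obtain C B where CB: "pseudo_divmod A curve_poly = (C, B)" by fastforce
  have "A = curve_poly * C + B" "B = 0 \<or> degree B < n"
    using pseudo_divmod[OF nz CB] deg lc by auto
  then show ?thesis using that[of C B] n by auto
qed

lemma bev_eq_0D:
  assumes "bev x y A = 0"
  obtains C where "A = curve_poly * C"
proof -
  obtain C B where CB: "A = curve_poly * C + B" "degree B < n" by (rule curve_poly_division)
  have "bev x y B = 0"
    using assms bev_curve_poly[OF curve_equation] by (simp add: CB(1) bev_add bev_mult)
  then have "B = 0" using CB(2) by (rule independent_powers_y)
  then show ?thesis using that[of C] CB(1) by simp
qed

lemma gen_ring_expansion:
  assumes "h \<in> gen_ring x y"
  obtains B where "degree B < n" "h = bev x y B"
proof -
  obtain A where A: "h = bev x y A" using assms by (auto simp: gen_ring_def)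
  obtain C B where CB: "A = curve_poly * C + B" "degree B < n" by (rule curve_poly_division)
  then have "h = bev x y B"
    using bev_curve_poly[OF curve_equation] by (simp add: A bev_add bev_mult)
  then show ?thesis using that CB by blast
qed

section \<open>The automorphisms \<open>y \<mapsto> \<zeta> y\<close>\<close>

definition twist :: "'a \<Rightarrow> 'a poly poly \<Rightarrow> 'a poly poly" where
  "twist z A = pcompose A [:0, [:z:]:]"

lemma bev_twist: "bev s t (twist z A) = bev s (\<iota> z * t) A"
  by (simp add: twist_def bev_pcompose bev_pCons ev_pCons mult.commute)

lemma curve_equation_twist: "z \<in> unity_roots n \<Longrightarrow> (\<iota> z * y) ^ n = ev f x"
  by (simp add: unity_roots_def power_mult_distrib curve_equation iota_1 flip: iota_power)

lemma unity_roots_nonzero: "z \<in> unity_roots n \<Longrightarrow> z \<noteq> (0 :: 'a)"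
  using n by (auto simp: unity_roots_def power_0_left)

text \<open>
  The relations between \<open>x\<close> and \<open>y\<close> are the multiples of \<open>Y^n - f\<close>, which also annihilates
  \<open>(x, \<zeta> y)\<close>; the rotation by \<open>1/\<zeta>\<close> gives the converse.
\<close>

lemma bev_twist_eq_0_iff:
  assumes z: "z \<in> unity_roots n"
  shows "bev x (\<iota> z * y) A = 0 \<longleftrightarrow> bev x y A = 0"
proof
  assume "bev x y A = 0"
  then obtain C where "A = curve_poly * C" by (rule bev_eq_0D)
  then show "bev x (\<iota> z * y) A = 0"
    by (simp add: bev_mult bev_curve_poly[OF curve_equation_twist[OF z]])
next
  assume "bev x (\<iota> z * y) A = 0"
  then have "bev x y (twist z A) = 0" by (simp add: bev_twist)
  then obtain C where C: "twist z A = curve_poly * C" by (rule bev_eq_0D)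
  let ?w = "inverse z"
  have w: "?w \<in> unity_roots n" using z by (simp add: unity_roots_def power_inverse)
  have "\<iota> z * (\<iota> ?w * y) = y"
    using unity_roots_nonzero[OF z] by (simp add: iota_inverse)
  then have "bev x y A = bev x (\<iota> ?w * y) (twist z A)" by (simp only: bev_twist)
  also have "\<dots> = 0"
    unfolding C bev_mult bev_curve_poly[OF curve_equation_twist[OF w]] by simp
  finally show "bev x y A = 0" .
qed

text \<open>
  The automorphism fixing \<open>x\<close> with \<open>y \<mapsto> z y\<close>, computed on an arbitrary representation as a
  fraction; by \<open>bev_twist_eq_0_iff\<close> the choice does not matter when \<open>z^n = 1\<close>.
\<close>

definition rotation :: "'a \<Rightarrow> 'k \<Rightarrow> 'k" where
  "rotation z h = (SOME r. \<exists>A B. bev x y B \<noteq> 0 \<and> h = bev x y A / bev x y B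
     \<and> r = bev x (\<iota> z * y) A / bev x (\<iota> z * y) B)"

lemma function_cases:
  obtains A B where "bev x y B \<noteq> 0" "h = bev x y A / bev x y B"
  using generated[of h] by blast

lemma rotation_eq:
  assumes z: "z \<in> unity_roots n" and B: "bev x y B \<noteq> 0"
  shows "rotation z (bev x y A / bev x y B) = bev x (\<iota> z * y) A / bev x (\<iota> z * y) B"
proof -
  let ?h = "bev x y A / bev x y B"
  obtain A' B' where AB': "bev x y B' \<noteq> 0" "?h = bev x y A' / bev x y B'"
    and r: "rotation z ?h = bev x (\<iota> z * y) A' / bev x (\<iota> z * y) B'"
    using someI_ex[of "\<lambda>r. \<exists>A' B'. bev x y B' \<noteq> 0 \<and> ?h = bev x y A' / bev x y B'
        \<and> r = bev x (\<iota> z * y) A' / bev x (\<iota> z * y) B'"] B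
    unfolding rotation_def by blast
  have "bev x y (A * B' - A' * B) = 0"
    using AB' B by (simp add: bev_diff bev_mult field_simps)
  then have "bev x (\<iota> z * y) (A * B' - A' * B) = 0" by (simp only: bev_twist_eq_0_iff[OF z])
  then show ?thesis
    using AB'(1) B bev_twist_eq_0_iff[OF z] unfolding r by (simp add: bev_diff bev_mult field_simps)
qed

lemma rotation_bev: "z \<in> unity_roots n \<Longrightarrow> rotation z (bev x y A) = bev x (\<iota> z * y) A"
  using rotation_eq[of z 1 A] by simp

context
  fixes z :: 'a
  assumes z: "z \<in> unity_roots n"
begin

lemma rotation_arith:
  "rotation z (g + h) = rotation z g + rotation z h"
  "rotation z (g * h) = rotation z g * rotation z h"
  "rotation z (g - h) = rotation z g - rotation z h"
proof -
  let ?b = "bev x (\<iota> z * y)"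
  obtain A B where g: "bev x y B \<noteq> 0" "g = bev x y A / bev x y B" by (rule function_cases)
  obtain A' B' where h: "bev x y B' \<noteq> 0" "h = bev x y A' / bev x y B'" by (rule function_cases)
  have BB: "bev x y (B * B') \<noteq> 0" using g h by (simp add: bev_mult)
  have nz: "?b B \<noteq> 0" "?b B' \<noteq> 0" using g h bev_twist_eq_0_iff[OF z] by auto
  have gh: "g + h = bev x y (A * B' + A' * B) / bev x y (B * B')"
    "g * h = bev x y (A * A') / bev x y (B * B')"
    "g - h = bev x y (A * B' - A' * B) / bev x y (B * B')"
    using g(1) h(1) unfolding g(2) h(2) by (simp_all add: bev_add bev_mult bev_diff field_simps)
  have rg: "rotation z g = ?b A / ?b B" and rh: "rotation z h = ?b A' / ?b B'"
    using rotation_eq[OF z] g h by auto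
  show "rotation z (g + h) = rotation z g + rotation z h"
    "rotation z (g * h) = rotation z g * rotation z h"
    "rotation z (g - h) = rotation z g - rotation z h"
    unfolding gh rotation_eq[OF z BB] unfolding rg rh
    using nz by (simp_all add: bev_add bev_mult bev_diff field_simps)
qed

lemma rotation_values:
  "rotation z (\<iota> a) = \<iota> a" "rotation z x = x" "rotation z y = \<iota> z * y"
  "rotation z 0 = 0" "rotation z 1 = 1" "rotation z (ev g x) = ev g x"
proof -
  have "bev s t [:[:a:]:] = \<iota> a" "bev s t [:[:0, 1:]:] = s" "bev s t [:0, 1:] = t" for s t a
    by (simp_all add: bev_pCons ev_pCons iota_1)
  then show "rotation z (\<iota> a) = \<iota> a" "rotation z x = x" "rotation z y = \<iota> z * y"
    using rotation_bev[OF z] by metis+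
  show "rotation z 0 = 0" "rotation z 1 = 1" "rotation z (ev g x) = ev g x"
    using rotation_bev[OF z, of 0] rotation_bev[OF z, of 1] rotation_bev[OF z, of "[:g:]"]
    by (simp_all add: bev_const)
qed

lemma rotation_eq_0_iff: "rotation z h = 0 \<longleftrightarrow> h = 0"
proof -
  obtain A B where h: "bev x y B \<noteq> 0" "h = bev x y A / bev x y B" by (rule function_cases)
  then show ?thesis
    using bev_twist_eq_0_iff[OF z] by (simp add: rotation_eq[OF z])
qed

lemma rotation_prod: "rotation z (prod g A) = (\<Prod>i\<in>A. rotation z (g i))"
  by (induction A rule: infinite_finite_induct) (simp_all add: rotation_arith rotation_values)

end

lemma unity_roots_mult: "z \<in> unity_roots m \<Longrightarrow> w \<in> unity_roots m \<Longrightarrow> z * w \<in> unity_roots m"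
  by (simp add: unity_roots_def power_mult_distrib)

lemma rotation_rotation:
  assumes "z \<in> unity_roots n" "w \<in> unity_roots n"
  shows "rotation w (rotation z h) = rotation (w * z) h"
proof -
  obtain A B where h: "bev x y B \<noteq> 0" "h = bev x y A / bev x y B" by (rule function_cases)
  have "rotation z h = bev x y (twist z A) / bev x y (twist z B)"
    unfolding h(2) rotation_eq[OF assms(1) h(1)] bev_twist ..
  moreover have "bev x y (twist z B) \<noteq> 0" using h(1) bev_twist_eq_0_iff[OF assms(1)] by (simp add: bev_twist)
  ultimately have "rotation w (rotation z h)
      = bev x (\<iota> w * y) (twist z A) / bev x (\<iota> w * y) (twist z B)"
    using rotation_eq[OF assms(2)] by simp
  also have "\<dots> = rotation (w * z) h"
    unfolding h(2) rotation_eq[OF unity_roots_mult[OF assms(2,1)] h(1)] bev_twist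
    by (simp add: iota_mult mult_ac)
  finally show ?thesis .
qed

lemma rotation_1: "rotation 1 h = h"
proof -
  obtain A B where h: "bev x y B \<noteq> 0" "h = bev x y A / bev x y B" by (rule function_cases)
  have "1 \<in> unity_roots n" by (simp add: unity_roots_def)
  then show ?thesis using rotation_eq[of 1 B A] h by (simp add: iota_1)
qed

lemma rotation_gen_ring:
  assumes z: "z \<in> unity_roots n" and h: "h \<in> gen_ring x y"
  shows "rotation z h \<in> gen_ring x y"
proof -
  obtain A where "h = bev x y A" using h by (auto simp: gen_ring_def)
  then have "rotation z h = bev x y (twist z A)" using rotation_bev[OF z] by (simp add: bev_twist)
  then show ?thesis by (simp add: gen_ring_def)
qed

text \<open>
  The product of all conjugates under the rotations is invariant; averaging its expansion in
  powers of \<open>y\<close> over the rotations leaves only the coefficient of \<open>1\<close>.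
\<close>

lemma multiple_in_constants_x:
  assumes h: "h \<in> gen_ring x y" "h \<noteq> 0"
  obtains C g where "C \<in> gen_ring x y" "g \<noteq> 0" "h * C = ev g x"
proof -
  let ?U = "unity_roots n :: 'a set"
  have fin: "finite ?U" using n finite_unity_roots by auto
  have one: "1 \<in> ?U" by (simp add: unity_roots_def)
  define N where "N = (\<Prod>z\<in>?U. rotation z h)"
  define C where "C = (\<Prod>z\<in>?U - {1}. rotation z h)"
  have R: "N \<in> gen_ring x y" "C \<in> gen_ring x y" unfolding N_def C_def
    using h rotation_gen_ring by (auto intro!: subring_prod[OF subring_gen_ring])
  have NC: "N = h * C"
    unfolding N_def C_def by (simp add: prod.remove[OF fin one] rotation_1)
  have N0: "N \<noteq> 0" unfolding N_def using fin h rotation_eq_0_iff by (auto simp: prod_zero_iff)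
  have inv: "rotation w N = N" if w: "w \<in> ?U" for w
  proof -
    have "rotation w N = (\<Prod>z\<in>?U. rotation (w * z) h)"
      unfolding N_def rotation_prod[OF w] using w by (intro prod.cong) (auto simp: rotation_rotation)
    also have "\<dots> = N" unfolding N_def
      by (rule prod.reindex_bij_witness[of _ "\<lambda>z. z / w" "\<lambda>z. w * z"])
         (use w unity_roots_nonzero[OF w] in
          \<open>auto simp: unity_roots_def power_mult_distrib power_divide\<close>)
    finally show ?thesis .
  qed
  obtain B where B: "degree B < n" "N = bev x y B" using gen_ring_expansion[OF R(1)] .
  let ?c = "\<lambda>j. ev (coeff B j) x * y ^ j"
  have "of_nat n * N = (\<Sum>w\<in>?U. rotation w N)"
    using inv card_unity_roots[OF n(2)] by simp
  also have "\<dots> = (\<Sum>w\<in>?U. \<Sum>j\<le>degree B. \<iota> (w ^ j) * ?c j)"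
  proof (rule sum.cong)
    fix w assume w: "w \<in> ?U"
    show "rotation w N = (\<Sum>j\<le>degree B. \<iota> (w ^ j) * ?c j)"
      unfolding B(2) rotation_bev[OF w] unfolding bev_altdef
      by (simp add: power_mult_distrib iota_power mult_ac)
  qed simp
  also have "\<dots> = (\<Sum>j\<le>degree B. \<iota> (\<Sum>w\<in>?U. w ^ j) * ?c j)"
    by (subst sum.swap) (simp add: iota_sum sum_distrib_right)
  also have "\<dots> = (\<Sum>j\<le>degree B. if j = 0 then of_nat n * ?c j else 0)"
  proof (rule sum.cong)
    fix j assume "j \<in> {..degree B}"
    then have "n dvd j \<longleftrightarrow> j = 0" using B(1) by (auto dest: dvd_imp_le)
    then show "\<iota> (\<Sum>w\<in>?U. w ^ j) * ?c j = (if j = 0 then of_nat n * ?c j else 0)"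
      by (simp add: sum_power_unity_roots[OF n(2)] iota_of_nat)
  qed simp
  also have "\<dots> = of_nat n * ev (coeff B 0) x" by (simp add: sum.delta)
  finally have "N = ev (coeff B 0) x" using n_nonzero by simp
  then show ?thesis using that[OF R(2), of "coeff B 0"] NC N0 by auto
qed

section \<open>The derivation \<open>d/dx\<close>\<close>

definition dy :: 'k where "dy = ev (pderiv f) x / (of_nat n * y ^ (n - 1))"

text \<open>The total derivative of \<open>A(x, y)\<close> with \<open>dx = 1\<close>.\<close>

definition total_deriv :: "'a poly poly \<Rightarrow> 'k" where
  "total_deriv A = bev x y (map_poly pderiv A) + bev x y (pderiv A) * dy"

lemma total_deriv_0 [simp]: "total_deriv 0 = 0" by (simp add: total_deriv_def)

lemma total_deriv_pCons:
  "total_deriv (pCons g B) = ev (pderiv g) x + y * total_deriv B + bev x y B * dy"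
  by (simp add: total_deriv_def map_poly_pCons pderiv_pCons bev_pCons bev_add algebra_simps)

lemma total_deriv_add: "total_deriv (A + B) = total_deriv A + total_deriv B"
  by (induction A B rule: poly_induct2)
     (simp_all add: total_deriv_pCons pderiv_add ev_add bev_add algebra_simps)

lemma total_deriv_smult:
  "total_deriv (smult g B) = ev (pderiv g) x * bev x y B + ev g x * total_deriv B"
  by (induction B)
     (simp_all add: total_deriv_pCons pderiv_mult ev_add ev_mult bev_smult bev_pCons algebra_simps)

lemma total_deriv_mult:
  "total_deriv (A * B) = total_deriv A * bev x y B + bev x y A * total_deriv B"
  by (induction A)
     (simp_all add: total_deriv_pCons total_deriv_add total_deriv_smult bev_mult bev_pCons algebra_simps)

lemma total_deriv_uminus: "total_deriv (- B) = - total_deriv B"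
  using total_deriv_add[of B "- B"] by (simp add: eq_neg_iff_add_eq_0 add.commute)

lemma total_deriv_diff: "total_deriv (A - B) = total_deriv A - total_deriv B"
  using total_deriv_add[of A "- B"] by (simp add: total_deriv_uminus)

lemma total_deriv_1 [simp]: "total_deriv 1 = 0"
  by (simp add: one_pCons total_deriv_pCons)

lemma total_deriv_curve_poly: "total_deriv curve_poly = 0"
proof -
  have m: "total_deriv (monom 1 k) = of_nat k * y ^ (k - 1) * dy" for k
  proof (induction k)
    case 0
    show ?case by (simp add: monom_0 total_deriv_pCons)
  next
    case (Suc k)
    then show ?case
      by (cases k) (simp_all add: monom_Suc[of 1] total_deriv_pCons bev_monom[of _ _ 1] bev_pCons monom_0 algebra_simps)
  qed
  show ?thesis
    using n_nonzero y_nonzero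
    by (simp add: curve_poly_def total_deriv_diff m total_deriv_pCons dy_def)
qed

text \<open>
  The value \<open>dy\<close> is chosen so that \<open>Y^n - f\<close> has total derivative zero; its multiples inherit this by
  the product rule. So the quotient rule below is independent of the representation.
\<close>

lemma total_deriv_eq_0:
  assumes "bev x y A = 0"
  shows "total_deriv A = 0"
proof -
  obtain C where "A = curve_poly * C" using bev_eq_0D[OF assms] .
  then show ?thesis
    using bev_curve_poly[OF curve_equation] by (simp add: total_deriv_mult total_deriv_curve_poly)
qed

definition deriv_x :: "'k \<Rightarrow> 'k" where
  "deriv_x h = (SOME r. \<exists>A B. bev x y B \<noteq> 0 \<and> h = bev x y A / bev x y B
     \<and> r = (total_deriv A * bev x y B - bev x y A * total_deriv B) / bev x y B ^ 2)"

lemma deriv_x_eq: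
  assumes B: "bev x y B \<noteq> 0" and h: "h = bev x y A / bev x y B"
  shows "deriv_x h = (total_deriv A * bev x y B - bev x y A * total_deriv B) / bev x y B ^ 2"
proof -
  obtain A' B' where AB': "bev x y B' \<noteq> 0" "h = bev x y A' / bev x y B'"
    and r: "deriv_x h = (total_deriv A' * bev x y B' - bev x y A' * total_deriv B') / bev x y B' ^ 2"
    using someI_ex[of "\<lambda>r. \<exists>A' B'. bev x y B' \<noteq> 0 \<and> h = bev x y A' / bev x y B'
        \<and> r = (total_deriv A' * bev x y B' - bev x y A' * total_deriv B') / bev x y B' ^ 2"] B h
    unfolding deriv_x_def by blast
  have eq: "bev x y A * bev x y B' = bev x y A' * bev x y B"
    using AB' B h by (simp add: field_simps)
  then have "bev x y (A * B' - A' * B) = 0" by (simp add: bev_diff bev_mult)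
  then have "total_deriv (A * B' - A' * B) = 0" by (rule total_deriv_eq_0)
  then have d: "total_deriv A * bev x y B' + bev x y A * total_deriv B'
      = total_deriv A' * bev x y B + bev x y A' * total_deriv B"
    by (simp add: total_deriv_diff total_deriv_mult)
  define a b a' b' da db da' db' where abs: "a = bev x y A" "b = bev x y B" "a' = bev x y A'"
    "b' = bev x y B'" "da = total_deriv A" "db = total_deriv B" "da' = total_deriv A'"
    "db' = total_deriv B'"
  note eqs = eq[folded abs] d[folded abs]
  have nz: "b \<noteq> 0" "b' \<noteq> 0" using B AB' by (auto simp: abs)
  have "(da * b - a * db) * b' ^ 2 - (da' * b' - a' * db') * b ^ 2
      = b * b' * ((da * b' + a * db') - (da' * b + a' * db)) - (b * db' + b' * db) * (a * b' - a' * b)"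
    by (simp add: algebra_simps power2_eq_square)
  then have "(da * b - a * db) * b' ^ 2 = (da' * b' - a' * db') * b ^ 2" using eqs by simp
  then show ?thesis unfolding r using nz by (simp add: frac_eq_eq flip: abs)
qed

lemma deriv_x_bev: "deriv_x (bev x y A) = total_deriv A"
  using deriv_x_eq[of 1 "bev x y A" A] by simp

lemma derivation_deriv_x: "derivation_over \<iota> deriv_x"
  unfolding derivation_over_def
proof (intro conjI allI)
  show "deriv_x (\<iota> a) = 0" for a
    using deriv_x_bev[of "[:[:a:]:]"] by (simp add: bev_const ev_pCons total_deriv_pCons)
  fix g h
  obtain A B where g: "bev x y B \<noteq> 0" "g = bev x y A / bev x y B" by (rule function_cases)
  obtain A' B' where h: "bev x y B' \<noteq> 0" "h = bev x y A' / bev x y B'" by (rule function_cases)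
  have BB: "bev x y (B * B') \<noteq> 0" using g h by (simp add: bev_mult)
  have sum: "g + h = bev x y (A * B' + A' * B) / bev x y (B * B')"
    and prod: "g * h = bev x y (A * A') / bev x y (B * B')"
    using g(1) h(1) unfolding g(2) h(2) by (simp_all add: bev_add bev_mult field_simps)
  show "deriv_x (g + h) = deriv_x g + deriv_x h"
    unfolding deriv_x_eq[OF g] deriv_x_eq[OF h] deriv_x_eq[OF BB sum] using g(1) h(1)
    by (simp add: total_deriv_add total_deriv_mult bev_add bev_mult field_simps power2_eq_square)
  show "deriv_x (g * h) = g * deriv_x h + h * deriv_x g"
    unfolding deriv_x_eq[OF g] deriv_x_eq[OF h] deriv_x_eq[OF BB prod] unfolding g(2) h(2) using g(1) h(1)
    by (simp add: total_deriv_mult bev_mult field_simps power2_eq_square)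
qed

lemma deriv_x_x: "deriv_x x = 1"
  using deriv_x_bev[of "[:[:0, 1:]:]"]
  by (simp add: bev_const ev_pCons total_deriv_pCons pderiv_pCons iota_1)

lemma derivation_y:
  assumes \<delta>: "derivation_over \<iota> \<delta>" and x: "\<delta> x = 1"
  shows "\<delta> y = dy"
proof -
  have "of_nat n * y ^ (n - 1) * \<delta> y = ev (pderiv f) x"
    using derivation_basic(8)[OF \<delta>, of y n] derivation_ev[OF \<delta>, of f x] x
    by (simp add: curve_equation)
  then show ?thesis using n_nonzero y_nonzero by (simp add: dy_def field_simps)
qed

text \<open>The elements on which two derivations agree form a field.\<close>

lemma ddx_eq: "ddx \<iota> x = deriv_x"
  unfolding ddx_def
proof (rule the_equality)
  show "derivation_over \<iota> deriv_x \<and> deriv_x x = 1" using derivation_deriv_x deriv_x_x by simp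
next
  fix \<delta> assume \<delta>: "derivation_over \<iota> \<delta> \<and> \<delta> x = 1"
  then have d: "derivation_over \<iota> \<delta>" and dx: "\<delta> x = 1" by auto
  have e: "derivation_over \<iota> deriv_x" by (rule derivation_deriv_x)
  let ?F = "{h. \<delta> h = deriv_x h}"
  have "subring ?F"
    by (rule subringI)
       (auto simp: derivation_basic(2,4,6)[OF d] derivation_basic(2,4,6)[OF e])
  moreover have "inverse h \<in> ?F" if "h \<in> ?F" "h \<noteq> 0" for h
    using derivation_quotient[OF d that(2), of 1] derivation_quotient[OF e that(2), of 1] that(1)
    by (simp add: derivation_basic(2)[OF d] derivation_basic(2)[OF e] inverse_eq_divide)
  moreover have "range \<iota> \<subseteq> ?F"
    by (auto simp: derivation_basic(7)[OF d] derivation_basic(7)[OF e])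
  moreover have "x \<in> ?F" "y \<in> ?F"
    using dx deriv_x_x derivation_y[OF d dx] derivation_y[OF e deriv_x_x] by auto
  ultimately have "h \<in> ?F" for h by (rule generates_subfield[OF generates_xy])
  then show "\<delta> = deriv_x" by auto
qed

end

section \<open>Places of the curve\<close>

lemma finite_polys_degree_le: "finite {p :: 'a::{finite,zero} poly. degree p \<le> m}"
proof (rule finite_subset)
  show "{p :: 'a poly. degree p \<le> m} \<subseteq> Poly ` {xs. set xs \<subseteq> UNIV \<and> length xs \<le> Suc m}"
  proof
    fix p :: "'a poly" assume "p \<in> {p. degree p \<le> m}"
    then have "length (coeffs p) \<le> Suc m" by (cases "p = 0") (auto simp: length_coeffs_degree)
    then show "p \<in> Poly ` {xs. set xs \<subseteq> UNIV \<and> length xs \<le> Suc m}"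
      by (intro image_eqI[of _ _ "coeffs p"]) auto
  qed
  show "finite (Poly ` {xs :: 'a list. set xs \<subseteq> UNIV \<and> length xs \<le> Suc m})"
    by (intro finite_imageI finite_lists_length_le) simp
qed

text \<open>The quotient \<open>(Q^k - 1) / (Q - 1)\<close> is a sum of \<open>k\<close> terms congruent to \<open>1\<close> modulo \<open>k\<close>.\<close>

lemma dvd_power_minus_1:
  fixes Q k :: nat
  assumes "k dvd Q - 1" "Q \<ge> 1"
  shows "k * (Q - 1) dvd Q ^ k - 1"
proof -
  have 1: "int Q ^ k - 1 = (int Q - 1) * (\<Sum>i<k. int Q ^ i)" by (rule power_diff_1_eq)
  have k: "int k dvd int Q - 1" using assms by (metis of_nat_1 of_nat_diff of_nat_dvd_iff)
  have "int k dvd (\<Sum>i<k. int Q ^ i - 1)"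
    by (rule dvd_sum, rule dvd_trans[OF k]) (simp add: power_diff_1_eq)
  then have "int k dvd (\<Sum>i<k. int Q ^ i) - int k" by (simp add: sum_subtractf)
  from dvd_add[OF this dvd_refl] have "int k dvd (\<Sum>i<k. int Q ^ i)" by simp
  then have "(int Q - 1) * int k dvd int Q ^ k - 1" unfolding 1 by (intro mult_dvd_mono) auto
  then have "int (k * (Q - 1)) dvd int (Q ^ k - 1)"
    using assms(2) by (simp add: of_nat_diff mult.commute)
  then show ?thesis by (simp only: of_nat_dvd_iff)
qed

context constant_embedding
begin

lemma inverse_of_nat_subset: "range \<iota> \<subseteq> V \<Longrightarrow> inverse (of_nat k) \<in> V"
  by (metis iota_inverse iota_of_nat rangeI subsetD)

text \<open>The elements whose residue lies in the field with \<open>q^r\<close> elements.\<close>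

definition residue_fixed :: "'k set \<Rightarrow> nat \<Rightarrow> 'k set" where
  "residue_fixed V r = {h \<in> V. h ^ (CARD('a) ^ r) - h \<in> nonunits V}"

context
  fixes V :: "'k set"
  assumes V: "valuation_ring V" "range \<iota> \<subseteq> V"
begin

lemma subring_residue_fixed: "subring (residue_fixed V r)"
proof (rule subringI)
  note VI = valuation_ring_intros[OF V(1)]
  show "1 \<in> residue_fixed V r" by (simp add: residue_fixed_def VI zero_nonunits[OF V(1)])
next
  note VI = valuation_ring_intros[OF V(1)]
  let ?Q = "CARD('a) ^ r"
  fix g h assume gh: "g \<in> residue_fixed V r" "h \<in> residue_fixed V r"
  have "(g - h) ^ ?Q - (g - h) = (g ^ ?Q - g) - (h ^ ?Q - h)" by (simp add: frobenius_diff)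
  also have "\<dots> \<in> nonunits V"
    by (rule nonunits_diff[OF V(1)]) (use gh in \<open>auto simp: residue_fixed_def\<close>)
  finally show "g - h \<in> residue_fixed V r" using gh by (auto simp: residue_fixed_def intro: VI)
  have "(g * h) ^ ?Q - g * h = g ^ ?Q * (h ^ ?Q - h) + h * (g ^ ?Q - g)"
    by (simp add: power_mult_distrib algebra_simps)
  also have "\<dots> \<in> nonunits V"
    using gh by (intro nonunits_add[OF V(1)] nonunits_mult(1)[OF V(1)] VI) (auto simp: residue_fixed_def)
  finally show "g * h \<in> residue_fixed V r" using gh by (auto simp: residue_fixed_def intro: VI)
qed

lemma iota_residue_fixed: "range \<iota> \<subseteq> residue_fixed V r"
  using V by (auto simp: residue_fixed_def frobenius_iota zero_nonunits[OF V(1)])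

lemma nonunits_residue_fixed: "h \<in> nonunits V \<Longrightarrow> h \<in> residue_fixed V r"
  using nonunits_subset[OF V(1)] card_field_ge_2[where 'a = 'a]
  by (auto simp: residue_fixed_def intro!: nonunits_diff[OF V(1)] nonunits_power_pos[OF V(1)])

lemma residue_fixed_cong:
  assumes "h - \<iota> a \<in> nonunits V"
  shows "h \<in> residue_fixed V r"
proof -
  have "\<iota> a \<in> residue_fixed V r" using iota_residue_fixed by blast
  from subring_add[OF subring_residue_fixed nonunits_residue_fixed[OF assms] this]
  show ?thesis by simp
qed

lemma residue_fixed_iterate:
  assumes "h \<in> residue_fixed V r"
  shows "h \<in> residue_fixed V (r * k)"
proof (induction k)
  case 0
  then show ?case using assms by (simp add: residue_fixed_def zero_nonunits[OF V(1)])
next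
  case (Suc k)
  have e: "CARD('a) ^ (r * Suc k) = CARD('a) ^ (r * k) * CARD('a) ^ r"
    by (simp add: power_add mult.commute)
  have "h ^ (CARD('a) ^ (r * Suc k)) - h
      = (h ^ (CARD('a) ^ (r * k)) - h) ^ (CARD('a) ^ r) + (h ^ (CARD('a) ^ r) - h)"
    unfolding e power_mult[of h] frobenius_diff by simp
  also have "\<dots> \<in> nonunits V"
    using assms Suc card_field_ge_2[where 'a = 'a]
    by (intro nonunits_add[OF V(1)] nonunits_power_pos[OF V(1)]) (auto simp: residue_fixed_def)
  finally show ?case using assms by (simp add: residue_fixed_def)
qed

text \<open>
  The residue of \<open>w\<close> is a root of unity of order dividing \<open>k (Q - 1)\<close>, which divides \<open>Q^k - 1\<close>
  because \<open>k\<close> divides \<open>q - 1\<close>.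
\<close>

lemma residue_fixed_root:
  assumes w: "w \<in> V" "w \<notin> nonunits V" and wk: "w ^ k \<in> residue_fixed V r"
    and k: "k dvd CARD('a) - 1" and r: "r > 0"
  shows "w \<in> residue_fixed V (r * k)"
proof -
  note VI = valuation_ring_intros[OF V(1)]
  let ?Q = "CARD('a) ^ r"
  have Q: "?Q \<ge> 1" using card_field_ge_2[where 'a = 'a] by simp
  have "int CARD('a) - 1 dvd int CARD('a) ^ r - 1" by (simp add: power_diff_1_eq)
  then have "int (CARD('a) - 1) dvd int (?Q - 1)"
    using Q card_field_ge_2[where 'a = 'a] by (simp add: of_nat_diff)
  then have "CARD('a) - 1 dvd ?Q - 1" by (simp only: of_nat_dvd_iff)
  then have "k dvd ?Q - 1" using k by (rule dvd_trans[rotated])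
  from dvd_power_minus_1[OF this Q] obtain m where m: "?Q ^ k - 1 = k * (?Q - 1) * m" by (auto elim: dvdE)
  have "(w ^ k) ^ ?Q - w ^ k = w ^ k * (w ^ (k * (?Q - 1)) - 1)"
  proof -
    have "w ^ k * w ^ (k * (?Q - 1)) = w ^ (k * ?Q)"
      using Q by (simp add: algebra_simps flip: power_add)
    then show ?thesis by (simp add: right_diff_distrib power_mult)
  qed
  then have "w ^ k * (w ^ (k * (?Q - 1)) - 1) \<in> nonunits V" using wk by (simp add: residue_fixed_def)
  then have 1: "w ^ (k * (?Q - 1)) - 1 \<in> nonunits V"
    using nonunits_prime[OF V(1), of "w ^ k"] nonunits_power[OF V(1)] w by (auto intro: VI)
  have "w ^ (?Q ^ k - 1) - 1 = (w ^ (k * (?Q - 1)) - 1) * (\<Sum>i<m. (w ^ (k * (?Q - 1))) ^ i)"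
    unfolding m power_mult by (rule power_diff_1_eq)
  also have "\<dots> \<in> nonunits V" by (intro nonunits_mult(2)[OF V(1) 1] VI w)
  finally have "w * (w ^ (?Q ^ k - 1) - 1) \<in> nonunits V" by (intro nonunits_mult(1)[OF V(1)] w)
  moreover have "w * (w ^ (?Q ^ k - 1) - 1) = w ^ (CARD('a) ^ (r * k)) - w"
  proof -
    have "w * w ^ (?Q ^ k - 1) = w ^ (?Q ^ k)" using Q by (simp flip: power_Suc)
    then show ?thesis by (simp add: right_diff_distrib power_mult)
  qed
  ultimately show ?thesis using w by (simp add: residue_fixed_def)
qed

end

end

context split_superelliptic
begin

text \<open>
  Divisibility by all powers of \<open>\<pi>\<close> would pass from an element of the function field to one of
  its multiples in \<open>k[x]\<close>, where it is excluded by hand.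
\<close>

lemma separated_criterion:
  assumes V: "valuation_ring V" "range \<iota> \<subseteq> V" and \<pi>: "\<pi> \<in> nonunits V" "\<pi> \<noteq> 0"
    and xy: "\<pi> ^ i * x \<in> V" "\<pi> ^ j * y \<in> V"
    and ev: "\<And>g. g \<noteq> 0 \<Longrightarrow> \<exists>k l u. u \<in> V \<and> u \<notin> nonunits V \<and> \<pi> ^ k * ev g x = \<pi> ^ l * u"
    and h: "h \<noteq> 0"
  shows "\<exists>i. \<forall>g\<in>V. h \<noteq> \<pi> ^ i * g"
proof (rule ccontr)
  note VI = valuation_ring_intros[OF V(1)]
  assume "\<not> ?thesis"
  then have div: "\<exists>g\<in>V. h = \<pi> ^ i * g" for i by blast
  have \<pi>V: "\<pi> \<in> V" by (rule nonunits_subset[OF V(1) \<pi>(1)])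
  define W where "W = {w. \<exists>i. \<pi> ^ i * w \<in> V}"
  have "subring W"
  proof (rule subringI)
    show "1 \<in> W" using VI(1) by (auto simp: W_def intro!: exI[of _ 0])
    fix a b assume "a \<in> W" "b \<in> W"
    then obtain i j where ij: "\<pi> ^ i * a \<in> V" "\<pi> ^ j * b \<in> V" by (auto simp: W_def)
    have "\<pi> ^ (i + j) * (a - b) = \<pi> ^ j * (\<pi> ^ i * a) - \<pi> ^ i * (\<pi> ^ j * b)"
      "\<pi> ^ (i + j) * (a * b) = (\<pi> ^ i * a) * (\<pi> ^ j * b)"
      by (simp_all add: power_add algebra_simps)
    moreover have "\<pi> ^ j * (\<pi> ^ i * a) \<in> V" "\<pi> ^ i * (\<pi> ^ j * b) \<in> V"
      by (rule VI(3)[OF VI(7)[OF \<pi>V]], rule ij)+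
    ultimately have "\<pi> ^ (i + j) * (a - b) \<in> V" "\<pi> ^ (i + j) * (a * b) \<in> V"
      using VI(2) VI(3)[OF ij] by (simp_all only:)
    then show "a - b \<in> W" "a * b \<in> W" unfolding W_def by blast+
  qed
  moreover have "range \<iota> \<subseteq> W" using V by (auto simp: W_def intro!: exI[of _ 0])
  moreover have "x \<in> W" "y \<in> W" using xy by (auto simp: W_def)
  ultimately have W: "gen_ring x y \<subseteq> W" by (rule gen_ring_subset)
  obtain a b where ab: "a \<in> gen_ring x y" "b \<in> gen_ring x y" "b \<noteq> 0" "h = a / b"
    using generates_xy unfolding generates_def by blast
  then have "a \<noteq> 0" using h by auto
  then obtain C g where C: "C \<in> gen_ring x y" "g \<noteq> 0" "a * C = ev g x"
    using multiple_in_constants_x ab(1) by blast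
  have "b * C \<in> W" using W subring_mult[OF subring_gen_ring ab(2) C(1)] by auto
  then obtain i where i: "\<pi> ^ i * (b * C) \<in> V" by (auto simp: W_def)
  obtain k l u where u: "u \<in> V" "u \<notin> nonunits V" "\<pi> ^ k * ev g x = \<pi> ^ l * u" using ev[OF C(2)] by blast
  obtain g' where g': "g' \<in> V" "h = \<pi> ^ (i + l + 1) * g'" using div by blast
  have "\<pi> ^ l * u = \<pi> ^ k * (h * (b * C))" unfolding u(3)[symmetric] C(3)[symmetric] using ab by simp
  also have "\<dots> = \<pi> ^ l * (\<pi> * (\<pi> ^ k * (g' * (\<pi> ^ i * (b * C)))))"
    unfolding g'(2) by (simp add: power_add mult_ac)
  finally have "u = \<pi> * (\<pi> ^ k * (g' * (\<pi> ^ i * (b * C))))" using \<pi>(2) by simp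
  also have "\<dots> \<in> nonunits V" by (intro nonunits_mult(2)[OF V(1) \<pi>(1)] VI \<pi>V g'(1) i)
  finally show False using u(2) by simp
qed

lemma differential_order:
  assumes P: "P \<in> places \<iota>" and S: "smooth_point \<iota> (place_ring P) s t \<pi> r" and m: "m \<noteq> 0"
    and st: "m * deriv_x s \<in> place_ring P" "m * deriv_x t \<in> place_ring P"
    and unit: "m * deriv_x \<pi> \<in> place_ring P" "m * deriv_x \<pi> \<notin> nonunits (place_ring P)"
    and g: "g \<noteq> 0"
  shows "differential_divisor \<iota> x g P = P g + P m"
proof -
  let ?t = "SOME t. P t = 1"
  have t: "P ?t = 1" using place_unif[OF P] by (rule someI_ex)
  note d = smooth_point.derivation_order[OF S P refl derivation_deriv_x m st unit t]
  show ?thesis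
    unfolding differential_divisor_def ddx_eq using P place_divide[OF P g d(1)] d(2) by simp
qed

section \<open>Finite places off the branch points\<close>

lemma x_frobenius_nonzero:
  assumes "r > 0"
  shows "x ^ (CARD('a) ^ r) - x \<noteq> 0"
proof -
  have "CARD('a) ^ r \<ge> 2"
    using assms card_field_ge_2[where 'a = 'a] by (metis self_le_power le_trans one_le_numeral)
  then have "CARD('a) ^ r \<noteq> 1" by linarith
  then have "coeff (monom (1::'a) (CARD('a) ^ r) - [:0, 1:]) 1 \<noteq> 0"
    by (simp only: coeff_diff coeff_monom if_False) simp
  then have "monom (1::'a) (CARD('a) ^ r) - [:0, 1:] \<noteq> 0" by (metis coeff_0)
  moreover have "ev (monom (1::'a) (CARD('a) ^ r) - [:0, 1:]) x = x ^ (CARD('a) ^ r) - x"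
    by (simp add: ev_diff ev_monom ev_pCons iota_1)
  ultimately show ?thesis using ev_x_eq_0 by metis
qed

text \<open>
  The element \<open>x^Q - x\<close> vanishes to first order at every unramified point with coordinates in the field
  with \<open>Q\<close> elements, and it divides \<open>y^Q - y\<close> because \<open>y\<close> is a unit and an \<open>n\<close>-th root of \<open>f(x)\<close>.
\<close>

lemma smooth_unramified:
  assumes P: "P \<in> places \<iota>" and x: "regular_at P x" and y: "y \<notin> nonunits (place_ring P)"
    and r: "r > 0" and xr: "vanishes_at P (x ^ (CARD('a) ^ r) - x)"
    and yr: "vanishes_at P (y ^ (CARD('a) ^ r) - y)"
  shows "smooth_point \<iota> (place_ring P) x y (x ^ (CARD('a) ^ r) - x) r"
proof -
  let ?V = "place_ring P" and ?\<pi> = "x ^ (CARD('a) ^ r) - x"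
  have V: "valuation_ring ?V" "range \<iota> \<subseteq> ?V" by (rule valuation_ring_place[OF P] iota_place_ring[OF P])+
  have xV: "x \<in> ?V" using x by (simp add: place_ring_def)
  have yV: "y \<in> ?V" by (rule y_integral[OF V xV])
  have nonu: "?\<pi> \<in> nonunits ?V" "y ^ (CARD('a) ^ r) - y \<in> nonunits ?V"
    using xr yr by (simp_all add: nonunits_place[OF P])
  interpret local_coordinates \<iota> ?V x y ?\<pi> r
    by unfold_locales (use V xV yV generates_xy nonu r in auto)
  have "?\<pi> \<in> unif_ideal" by (rule unif_idealI[of _ 1]) (auto intro: loc_intros)
  then have xf: "x \<in> frob_fixed" using gen_ring_loc gen_ring_gens by (auto simp: frob_fixed_def)
  have "y ^ n \<in> frob_fixed"
    unfolding curve_equation by (rule ev_in_subring[OF subring_frob_fixed iota_frob_fixed xf])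
  then have yf: "y \<in> frob_fixed"
    using frob_fixed_root[OF gen_ring_gens(3) y nonu(2) n_nonzero(1)] by simp
  have nz: "?\<pi> \<noteq> 0" by (rule x_frobenius_nonzero[OF r])
  show ?thesis
    by unfold_locales (use xf yf nz separated_place[OF P xr nz] in auto)
qed

text \<open>
  The residue of \<open>x\<close> is algebraic over a finite field, so two of its powers \<open>x^(q^i)\<close> coincide; and
  extraction of \<open>q\<close>-th roots is unique.
\<close>

lemma finite_place_residue:
  assumes P: "P \<in> places \<iota>" and x: "regular_at P x"
  obtains r where "r > 0" "vanishes_at P (x ^ (CARD('a) ^ r) - x)"
proof -
  let ?V = "place_ring P"
  have V: "valuation_ring ?V" "range \<iota> \<subseteq> ?V" by (rule valuation_ring_place[OF P] iota_place_ring[OF P])+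
  have xV: "x \<in> ?V" using x by (simp add: place_ring_def)
  have yV: "y \<in> ?V" by (rule y_integral[OF V xV])
  have RV: "gen_ring x y \<subseteq> ?V"
    by (rule gen_ring_subset[OF valuation_ring_subring[OF V(1)] V(2) xV yV])
  have "\<exists>g. g \<noteq> 0 \<and> vanishes_at P (ev g x)"
  proof (rule ccontr)
    \<comment> \<open>Otherwise the place is trivial on \<open>k(x)\<close>, hence on the function field.\<close>
    assume no: "\<not> ?thesis"
    have ev0: "P (ev g x) = 0" if "g \<noteq> 0" for g
    proof -
      have "ev g x \<in> ?V" using RV ev_in_gen_ring by auto
      then show ?thesis using no that by (auto simp: place_ring_def regular_at_def vanishes_at_def)
    qed
    have R0: "P h = 0" if h: "h \<in> gen_ring x y" "h \<noteq> 0" for h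
    proof -
      obtain C g where C: "C \<in> gen_ring x y" "g \<noteq> 0" "h * C = ev g x"
        using multiple_in_constants_x[OF h] .
      have "C \<noteq> 0" using C by auto
      then have "P h + P C = 0" using place_mult[OF P h(2), of C] C ev0 by simp
      moreover have "P h \<ge> 0" "P C \<ge> 0"
        using RV h C \<open>C \<noteq> 0\<close> by (auto simp: place_ring_def regular_at_def)
      ultimately show ?thesis by linarith
    qed
    obtain t where t: "P t = 1" using place_unif[OF P] by blast
    then have "t \<noteq> 0" using place_0[OF P] by auto
    moreover obtain a b where "a \<in> gen_ring x y" "b \<in> gen_ring x y" "b \<noteq> 0" "t = a / b"
      using generates_xy unfolding generates_def by blast
    ultimately have "P t = 0" using R0 place_divide[OF P, of a b] by auto
    then show False using t by simp
  qed
  then obtain g where g: "g \<noteq> 0" "vanishes_at P (ev g x)" by blast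
  let ?m = "\<lambda>i. monom (1::'a) (CARD('a) ^ i) mod g"
  have "range ?m \<subseteq> {p. degree p \<le> degree g}"
  proof
    fix p assume "p \<in> range ?m"
    then obtain i where "p = ?m i" by blast
    then have "p = 0 \<or> degree p < degree g" using degree_mod_less[OF g(1)] by simp
    then show "p \<in> {p. degree p \<le> degree g}" by auto
  qed
  then have "finite (range ?m)" by (rule finite_subset[OF _ finite_polys_degree_le])
  then have "\<not> inj ?m" using finite_imageD by blast
  then obtain i' j' where ij': "i' \<noteq> j'" "?m i' = ?m j'" unfolding inj_def by blast
  define i j where "i = min i' j'" and "j = max i' j'"
  then have ij: "i < j" "?m j = ?m i" using ij' by (auto simp: min_def max_def)
  then have "g dvd monom 1 (CARD('a) ^ j) - monom 1 (CARD('a) ^ i)" by (simp add: mod_eq_dvd_iff)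
  then obtain C where C: "monom 1 (CARD('a) ^ j) - monom 1 (CARD('a) ^ i) = g * C" by (auto elim: dvdE)
  have "x ^ (CARD('a) ^ j) - x ^ (CARD('a) ^ i) = ev g x * ev C x"
    unfolding ev_mult[symmetric] C[symmetric] by (simp add: ev_diff ev_monom iota_1)
  also have "\<dots> \<in> nonunits ?V"
  proof (rule nonunits_mult(2)[OF V(1)])
    show "ev g x \<in> nonunits ?V" using g(2) by (simp add: nonunits_place[OF P])
    show "ev C x \<in> ?V" using RV ev_in_gen_ring by auto
  qed
  finally have "x ^ (CARD('a) ^ j) - x ^ (CARD('a) ^ i) \<in> nonunits ?V" .
  moreover have "x ^ (CARD('a) ^ j) - x ^ (CARD('a) ^ i) = (x ^ (CARD('a) ^ (j - i)) - x) ^ (CARD('a) ^ i)"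
    using ij(1) by (simp add: frobenius_diff flip: power_mult power_add)
  ultimately have "x ^ (CARD('a) ^ (j - i)) - x \<in> nonunits ?V"
    using nonunits_power[OF V(1)] xV by (auto intro: valuation_ring_intros[OF V(1)])
  then show ?thesis using that[of "j - i"] ij(1) by (simp add: nonunits_place[OF P])
qed

text \<open>The derivative of \<open>x^Q - x\<close> is \<open>-1\<close>, so \<open>dx\<close> generates the differentials.\<close>

lemma unramified_differential:
  assumes P: "P \<in> places \<iota>" and x: "regular_at P x" and y: "\<not> vanishes_at P y" and g: "g \<noteq> 0"
  shows "differential_divisor \<iota> x g P = P g"
proof -
  let ?V = "place_ring P"
  have V: "valuation_ring ?V" "range \<iota> \<subseteq> ?V" by (rule valuation_ring_place[OF P] iota_place_ring[OF P])+
  note VI = valuation_ring_intros[OF V(1)]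
  have xV: "x \<in> ?V" using x by (simp add: place_ring_def)
  have yV: "y \<in> ?V" by (rule y_integral[OF V xV])
  have yu: "y \<notin> nonunits ?V" using y by (simp add: nonunits_place[OF P])
  obtain r where r: "r > 0" "vanishes_at P (x ^ (CARD('a) ^ r) - x)"
    using finite_place_residue[OF P x] .
  have xr: "x \<in> residue_fixed ?V r"
    using r xV by (simp add: residue_fixed_def nonunits_place[OF P])
  have "y ^ n \<in> residue_fixed ?V r"
    unfolding curve_equation
    by (rule ev_in_subring[OF subring_residue_fixed[OF V] iota_residue_fixed[OF V] xr])
  then have "y \<in> residue_fixed ?V (r * n)" by (rule residue_fixed_root[OF V yV yu _ n(2) r(1)])
  then have yr: "vanishes_at P (y ^ (CARD('a) ^ (r * n)) - y)"
    by (simp add: residue_fixed_def nonunits_place[OF P])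
  have xr': "vanishes_at P (x ^ (CARD('a) ^ (r * n)) - x)"
    using residue_fixed_iterate[OF V xr, of n] by (simp add: residue_fixed_def nonunits_place[OF P])
  have rn: "r * n > 0" using r n by simp
  let ?\<pi> = "x ^ (CARD('a) ^ (r * n)) - x"
  have S: "smooth_point \<iota> ?V x y ?\<pi> (r * n)" by (rule smooth_unramified[OF P x yu rn xr' yr])
  have d: "derivation_over \<iota> deriv_x" by (rule derivation_deriv_x)
  have "of_nat (CARD('a) ^ (r * n)) = (0 :: 'k)" using rn of_nat_q by (simp add: power_0_left)
  then have d\<pi>: "deriv_x ?\<pi> = - 1"
    by (simp add: derivation_basic(6,8)[OF d] deriv_x_x)
  have "inverse (of_nat n) \<in> ?V"
    by (rule inverse_of_nat_subset[OF V(2)])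
  moreover have "inverse y \<in> ?V" by (rule inverse_unit[OF V(1) yV yu])
  moreover have "ev (pderiv f) x \<in> ?V"
    by (rule ev_in_subring[OF valuation_ring_subring[OF V(1)] V(2) xV])
  ultimately have "ev (pderiv f) x * (inverse (of_nat n) * inverse y ^ (n - 1)) \<in> ?V" by (intro VI)
  then have "deriv_x y \<in> ?V"
    by (simp add: derivation_y[OF d deriv_x_x] dy_def divide_inverse power_inverse)
  then have "differential_divisor \<iota> x g P = P g + P 1"
    using VI one_notin_nonunits[OF V(1)] nonunits_uminus[OF V(1), of "-1"]
    by (intro differential_order[OF P S _ _ _ _ _ g]) (auto simp: deriv_x_x d\<pi>)
  then show ?thesis by (simp add: place_1[OF P])
qed

section \<open>Ramified places\<close>

text \<open>
  Over a root of \<open>f\<close> the element \<open>x - a\<close> is a unit times \<open>y^n\<close>, so \<open>y\<close> divides \<open>x^q - x\<close>, a multiple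
  of \<open>x - a\<close>.
\<close>

lemma smooth_ramified:
  assumes V: "valuation_ring V" "range \<iota> \<subseteq> V" "x - \<iota> a \<in> nonunits V" and a: "a \<in> roots"
  shows "smooth_point \<iota> V x y y (Suc 0)"
proof -
  obtain f1 where f1: "ev f1 x \<in> V" "ev f1 x \<notin> nonunits V" "x - \<iota> a = y ^ n * inverse (ev f1 x)"
    and yn: "y \<in> nonunits V"
    using over_root[OF V a] by metis
  have xV: "x \<in> V" by (rule ev_residue(2)[OF V])
  have yV: "y \<in> V" by (rule y_integral[OF V(1,2) xV])
  note VI = valuation_ring_intros[OF V(1)]
  interpret local_coordinates \<iota> V x y y "Suc 0"
    by unfold_locales (use V xV yV generates_xy yn in auto)
  have y_ideal: "y * h \<in> unif_ideal" if "h \<in> loc" for h using that by (auto intro: unif_idealI)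
  have yl: "y \<in> loc" and xl: "x \<in> loc" and il: "\<iota> c \<in> loc" for c
    using gen_ring_loc gen_ring_gens by auto
  have q: "CARD('a) \<ge> 2" by (rule card_field_ge_2)
  have "y ^ CARD('a) - y = y * (y ^ (CARD('a) - 1) - 1)"
    using q by (simp add: right_diff_distrib power_eq_if)
  also have "\<dots> \<in> unif_ideal" by (intro y_ideal loc_intros yl)
  finally have yf: "y \<in> frob_fixed" using yl by (simp add: frob_fixed_def)
  have "ev f1 x \<in> loc" using gen_ring_loc ev_in_gen_ring[of f1 x y] by auto
  then have "inverse (ev f1 x) \<in> loc" using f1(2) by (rule loc_inverse)
  then have "y * (y ^ (n - 1) * inverse (ev f1 x)) \<in> unif_ideal" by (intro y_ideal loc_intros yl)
  moreover have "y ^ n = y * y ^ (n - 1)" using n by (simp add: power_eq_if)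
  ultimately have xa: "x - \<iota> a \<in> unif_ideal" unfolding f1(3) by (simp add: mult.assoc)
  have "x ^ CARD('a) - x = (x - \<iota> a) ^ CARD('a) - (x - \<iota> a)"
    using frobenius_diff[of x "\<iota> a" 1] frobenius_iota[of a 1] by simp
  also have "\<dots> = (x - \<iota> a) ^ (CARD('a) - 1) * (x - \<iota> a) - (x - \<iota> a)"
    using q by (simp add: power_eq_if mult.commute)
  also have "\<dots> \<in> unif_ideal"
    by (rule unif_ideal_diff[OF unif_ideal_mult[OF _ xa] xa]) (intro loc_intros xl il)
  finally have xf: "x \<in> frob_fixed" using xl by (simp add: frob_fixed_def)
  have sep: "\<exists>i. \<forall>g\<in>V. h \<noteq> y ^ i * g" if "h \<noteq> 0" for h
  proof (rule separated_criterion[OF V(1,2) yn y_nonzero _ _ _ that])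
    show "y ^ 0 * x \<in> V" "y ^ 0 * y \<in> V" using xV yV by simp_all
    fix g :: "'a poly" assume g: "g \<noteq> 0"
    obtain h where h: "g = [:- a, 1:] ^ order a g * h" "\<not> [:- a, 1:] dvd h"
      using order_decomp[OF g] by blast
    let ?k = "order a g"
    have hV: "ev h x \<in> V" by (rule ev_in_subring[OF valuation_ring_subring[OF V(1)] V(2) xV])
    have hu: "ev h x \<notin> nonunits V" using h(2) ev_nonunit_iff[OF assms(1-3)] by (simp add: poly_eq_0_iff_dvd)
    have iu: "inverse (ev f1 x) \<in> V" by (rule inverse_unit[OF V(1) f1(1,2)])
    have iu': "inverse (ev f1 x) \<notin> nonunits V"
      using f1 zero_nonunits[OF V(1)] by (auto simp: nonunits_def)
    have "ev g x = (x - \<iota> a) ^ ?k * ev h x"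
      by (subst h(1)) (simp add: ev_mult ev_power ev_linear del: mult_pCons_left)
    also have "\<dots> = y ^ (n * ?k) * (inverse (ev f1 x) ^ ?k * ev h x)"
      unfolding f1(3) by (simp add: power_mult_distrib power_mult mult.assoc)
    finally have "y ^ 0 * ev g x = y ^ (n * ?k) * (inverse (ev f1 x) ^ ?k * ev h x)" by simp
    moreover have "inverse (ev f1 x) ^ ?k * ev h x \<in> V" by (intro VI iu hV)
    moreover have "inverse (ev f1 x) ^ ?k * ev h x \<notin> nonunits V"
      using nonunits_prime[OF V(1) _ VI(7)[OF iu] hV, of ?k] nonunits_power[OF V(1) _ iu] iu' hu by blast
    ultimately show "\<exists>k l u. u \<in> V \<and> u \<notin> nonunits V \<and> y ^ k * ev g x = y ^ l * u" by blast
  qed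
  show ?thesis by unfold_locales (use xf yf y_nonzero sep in auto)
qed

text \<open>The derivation \<open>y^(n-1) d/dx\<close> maps \<open>y\<close> to \<open>f'(x)/n\<close>, a unit since the root is simple.\<close>

lemma ramified_place_orders:
  assumes P: "P \<in> places \<iota>" and x: "vanishes_at P (x - \<iota> a)" and a: "a \<in> roots"
  shows "P y = 1" "P (x - \<iota> a) = int n"
    and "g \<noteq> 0 \<Longrightarrow> differential_divisor \<iota> x g P = P g + int n - 1"
proof -
  let ?V = "place_ring P"
  have V: "valuation_ring ?V" "range \<iota> \<subseteq> ?V" "x - \<iota> a \<in> nonunits ?V"
    using valuation_ring_place[OF P] iota_place_ring[OF P] x by (auto simp: nonunits_place[OF P])
  have S: "smooth_point \<iota> ?V x y y (Suc 0)" by (rule smooth_ramified[OF V a])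
  show y1: "P y = 1" by (rule smooth_point.place_of_unif(1)[OF S P refl])
  obtain f1 where f1: "f = [:- a, 1:] * f1" "poly f1 a \<noteq> 0" "ev f1 x \<in> ?V"
    "ev f1 x \<notin> nonunits ?V" "x - \<iota> a = y ^ n * inverse (ev f1 x)"
    using over_root[OF V a] by metis
  have f10: "ev f1 x \<noteq> 0" "P (ev f1 x) = 0" using unit_place[OF P f1(3)] f1(4) by auto
  have "P (x - \<iota> a) = P (y ^ n) + P (inverse (ev f1 x))"
    unfolding f1(5) using y_nonzero f10 by (intro place_mult[OF P]) auto
  then show "P (x - \<iota> a) = int n" using f10 y1 by (simp add: place_power[OF P] place_inverse[OF P])
  note VI = valuation_ring_intros[OF V(1)]
  have xV: "x \<in> ?V" by (rule ev_residue(2)[OF V])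
  have yV: "y \<in> ?V" by (rule y_integral[OF V(1,2) xV])
  have d: "derivation_over \<iota> deriv_x" by (rule derivation_deriv_x)
  have nV: "inverse (of_nat n) \<in> ?V" by (rule inverse_of_nat_subset[OF V(2)])
  have f'V: "ev (pderiv f) x \<in> ?V"
    by (rule ev_in_subring[OF valuation_ring_subring[OF V(1)] V(2) xV])
  have dy: "y ^ (n - 1) * deriv_x y = inverse (of_nat n) * ev (pderiv f) x"
    using y_nonzero n_nonzero by (simp add: derivation_y[OF d deriv_x_x] dy_def field_simps)
  have "poly (pderiv f) a = poly f1 a"
    unfolding f1(1) by (simp add: pderiv_mult pderiv_pCons del: mult_pCons_left)
  then have "ev (pderiv f) x \<notin> nonunits ?V" using ev_nonunit_iff[OF V] f1(2) by simp
  moreover have "inverse (of_nat n) \<notin> nonunits ?V"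
    using iota_unit[OF V(1,2), of "inverse (of_nat n)"] n_nonzero
    by (simp add: iota_inverse iota_of_nat)
  ultimately have unit: "y ^ (n - 1) * deriv_x y \<notin> nonunits ?V"
    unfolding dy using nonunits_prime[OF V(1) _ nV f'V] by blast
  have mem: "y ^ (n - 1) * deriv_x y \<in> ?V" unfolding dy by (intro VI nV f'V)
  assume g: "g \<noteq> 0"
  have "differential_divisor \<iota> x g P = P g + P (y ^ (n - 1))"
    using y_nonzero mem VI(7)[OF yV, of "n - 1"]
    by (intro differential_order[OF P S _ _ _ _ unit g]) (simp_all add: deriv_x_x)
  then show "differential_divisor \<iota> x g P = P g + int n - 1"
    using y1 n by (simp add: place_power[OF P] of_nat_diff)
qed

lemma exists_ramified_place:
  assumes a: "a \<in> roots"
  obtains P where "P \<in> places \<iota>" "vanishes_at P (x - \<iota> a)"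
proof -
  obtain V where V: "valuation_ring V" "range \<iota> \<subseteq> V" "x - \<iota> a \<in> nonunits V"
    using transcendental_valuation_ring[OF transcendental_x_minus] .
  interpret S: smooth_point \<iota> V x y y "Suc 0" by (rule smooth_ramified[OF V a])
  show ?thesis using that[OF S.unif_order_place(1)] S.unif_order_place(4) V(3) by simp
qed

end

context split_superelliptic
begin

section \<open>Places over infinity\<close>

text \<open>
  With \<open>c = gcd n d\<close>, \<open>n = c e\<close> and \<open>d = c d'\<close>, the functions \<open>x\<close> and \<open>y\<close> have poles of order
  \<open>e\<close> and \<open>d'\<close> over infinity.
\<close>

definition inf_gcd :: nat where "inf_gcd = gcd n (degree f)"
definition inf_e :: nat where "inf_e = n div inf_gcd"
definition inf_d :: nat where "inf_d = degree f div inf_gcd"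

lemma inf_gcd: "n = inf_gcd * inf_e" "degree f = inf_gcd * inf_d" "inf_gcd > 0" "inf_e > 0" "inf_d > 0"
  "coprime inf_e inf_d" "inf_gcd dvd CARD('a) - 1"
proof -
  show n': "n = inf_gcd * inf_e" "degree f = inf_gcd * inf_d" by (simp_all add: inf_gcd_def inf_e_def inf_d_def)
  show "inf_gcd > 0" using n by (simp add: inf_gcd_def)
  show "inf_e > 0" "inf_d > 0" using n' n degree_f by (auto intro!: Nat.gr0I)
  show "coprime inf_e inf_d" unfolding inf_e_def inf_d_def inf_gcd_def
    by (rule div_gcd_coprime) (use n in simp)
  show "inf_gcd dvd CARD('a) - 1" using n(2) n'(1) by (metis dvd_mult_left)
qed

lemma inf_bezout: obtains i j where "i * inf_e = j * inf_d + 1"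
proof -
  have "inf_e \<noteq> 0" using inf_gcd(4) by simp
  from bezout_nat[OF this, of inf_d] obtain i j where "inf_e * i = inf_d * j + gcd inf_e inf_d" by blast
  then show ?thesis using that[of i j] inf_gcd(6) by (simp add: mult.commute)
qed

definition inf_U :: 'k where "inf_U = y ^ inf_e / x ^ inf_d"
definition inf_T :: "nat \<Rightarrow> nat \<Rightarrow> 'k" where "inf_T i j = y ^ j / x ^ i"

lemma inf_U_nonzero: "inf_U \<noteq> 0" and inf_T_nonzero: "inf_T i j \<noteq> 0"
  using x_nonzero y_nonzero by (simp_all add: inf_U_def inf_T_def)

lemma inf_U_power: "inf_U ^ inf_gcd = ev (reflect_poly f) (inverse x)"
proof -
  have "inf_U ^ inf_gcd = y ^ n / x ^ degree f"
    using inf_gcd(1,2) by (simp add: inf_U_def power_divide mult.commute flip: power_mult)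
  also have "\<dots> = ev (reflect_poly f) (inverse x)"
    unfolding curve_equation using ev_reflect_poly[OF x_nonzero, of f] x_nonzero by simp
  finally show ?thesis .
qed

text \<open>
  The exponent vectors of \<open>T = y^j / x^i\<close> and \<open>U = y^e / x^d'\<close> form a basis of the lattice of all
  monomials, their determinant being \<open>j d' - i e = -1\<close>. Over infinity \<open>T\<close> has order one and \<open>U\<close> is a
  unit.
\<close>

lemma x_y_from_T_U:
  assumes ij: "i * inf_e = j * inf_d + 1"
  shows "x * inf_T i j ^ inf_e = inf_U ^ j" "y * inf_T i j ^ inf_d = inf_U ^ i"
proof -
  have "x * inf_T i j ^ inf_e = x * y ^ (j * inf_e) / x ^ (i * inf_e)"
    by (simp add: inf_T_def power_divide power_mult)
  also have "\<dots> = y ^ (j * inf_e) / x ^ (j * inf_d)" unfolding ij using x_nonzero by simp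
  finally show "x * inf_T i j ^ inf_e = inf_U ^ j"
    by (simp add: inf_U_def power_divide mult.commute flip: power_mult)
  have "y * inf_T i j ^ inf_d = y ^ (j * inf_d + 1) / x ^ (i * inf_d)"
    by (simp add: inf_T_def power_divide power_mult)
  then show "y * inf_T i j ^ inf_d = inf_U ^ i"
    unfolding ij[symmetric] by (simp add: inf_U_def power_divide mult.commute flip: power_mult)
qed

lemma generates_T_U:
  assumes ij: "i * inf_e = j * inf_d + 1"
  shows "generates (inf_T i j) inf_U"
proof (rule generates_change[OF generates_xy])
  note R = subring_intros[OF subring_gen_ring[of "inf_T i j" inf_U]]
  show "inf_U ^ j \<in> gen_ring (inf_T i j) inf_U" "inf_T i j ^ inf_e \<in> gen_ring (inf_T i j) inf_U"
    "inf_U ^ i \<in> gen_ring (inf_T i j) inf_U" "inf_T i j ^ inf_d \<in> gen_ring (inf_T i j) inf_U"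
    by (intro R gen_ring_gens)+
  show nz: "inf_T i j ^ inf_e \<noteq> 0" "inf_T i j ^ inf_d \<noteq> 0" using inf_T_nonzero by simp_all
  show "x = inf_U ^ j / inf_T i j ^ inf_e" "y = inf_U ^ i / inf_T i j ^ inf_d"
    using x_y_from_T_U[OF ij] nz by (simp_all add: field_simps)
qed

context
  fixes V :: "'k set"
  assumes V: "valuation_ring V" "range \<iota> \<subseteq> V" and inf: "inverse x \<in> nonunits V"
begin

lemma ev_inverse_x: "ev g (inverse x) \<in> V" "ev g (inverse x) \<in> nonunits V \<longleftrightarrow> poly g 0 = 0"
proof -
  have *: "inverse x - \<iota> 0 \<in> nonunits V" using inf by simp
  show "ev g (inverse x) \<in> V"
    by (rule ev_in_subring[OF valuation_ring_subring[OF V(1)] V(2) nonunits_subset[OF V(1) inf]])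
  show "ev g (inverse x) \<in> nonunits V \<longleftrightarrow> poly g 0 = 0" by (rule ev_nonunit_iff[OF V *])
qed

text \<open>The power \<open>U^c = f(x)/x^d\<close> takes at infinity the value of the leading coefficient of \<open>f\<close>.\<close>

lemma inf_U_unit: "inf_U \<in> V" "inf_U \<notin> nonunits V"
proof -
  have p: "poly (reflect_poly f) 0 \<noteq> 0" using f_nonzero by (simp add: poly_0_coeff_0)
  show "inf_U \<in> V"
    by (rule integrally_closed_power[OF V(1) _ inf_gcd(3)]) (simp add: inf_U_power ev_inverse_x)
  show "inf_U \<notin> nonunits V"
  proof
    assume "inf_U \<in> nonunits V"
    then have "inf_U ^ inf_gcd \<in> nonunits V" by (rule nonunits_power_pos[OF V(1) _ inf_gcd(3)])
    then show False using p by (simp add: inf_U_power ev_inverse_x)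
  qed
qed

lemma ev_pole:
  assumes "degree g \<le> m"
  obtains v where "v \<in> V" "ev g x = x ^ m * v"
proof -
  have "x ^ degree g = x ^ m * inverse x ^ (m - degree g)"
    using x_nonzero assms by (simp add: power_diff field_simps)
  then have "ev g x = x ^ m * (inverse x ^ (m - degree g) * ev (reflect_poly g) (inverse x))"
    unfolding ev_reflect_poly[OF x_nonzero, of g] by simp
  moreover have "inverse x ^ (m - degree g) * ev (reflect_poly g) (inverse x) \<in> V"
    using nonunits_subset[OF V(1) inf] ev_inverse_x by (intro valuation_ring_intros[OF V(1)])
  ultimately show ?thesis using that by blast
qed

lemma ev_leading:
  assumes "g \<noteq> 0"
  obtains u where "u \<in> V" "u \<notin> nonunits V" "ev g x = x ^ degree g * u"
proof -
  have "poly (reflect_poly g) 0 \<noteq> 0" using assms by (simp add: poly_0_coeff_0)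
  then show ?thesis using that ev_reflect_poly[OF x_nonzero, of g] ev_inverse_x by blast
qed

context
  fixes i j :: nat
  assumes ij: "i * inf_e = j * inf_d + 1"
begin

lemma inverse_x_eq: "inverse x = inf_T i j ^ inf_e * inverse (inf_U ^ j)"
  using x_y_from_T_U(1)[OF ij] x_nonzero inf_U_nonzero by (simp add: field_simps)

lemma inf_T_nonunit: "inf_T i j \<in> nonunits V"
proof -
  have "inf_T i j ^ inf_e = inverse x * inf_U ^ j"
    using inverse_x_eq inf_U_nonzero by (simp add: field_simps)
  also have "\<dots> \<in> nonunits V"
    by (intro nonunits_mult(2)[OF V(1) inf] valuation_ring_intros(7)[OF V(1)] inf_U_unit)
  finally have T: "inf_T i j ^ inf_e \<in> nonunits V" .
  have "inf_T i j \<in> V"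
    by (rule integrally_closed_power[OF V(1) nonunits_subset[OF V(1) T] inf_gcd(4)])
  then show ?thesis by (rule nonunits_power[OF V(1) T])
qed

text \<open>
  As \<open>1/x\<close> is a multiple of \<open>T\<close>, so is \<open>h^Q - h\<close> for each polynomial \<open>h\<close> in \<open>1/x\<close>, in particular for
  \<open>U^c\<close>; and \<open>c\<close>, a divisor of \<open>q - 1\<close>, is invertible. The residue of \<open>U\<close> lies in the field with
  \<open>Q = q^c\<close> elements.
\<close>

lemma smooth_infinite: "smooth_point \<iota> V (inf_T i j) inf_U (inf_T i j) inf_gcd"
proof -
  let ?T = "inf_T i j"
  note VI = valuation_ring_intros[OF V(1)]
  note val = V and pole = inf
  interpret local_coordinates \<iota> V ?T inf_U ?T inf_gcd
  proof unfold_locales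
    show "valuation_ring V" "range \<iota> \<subseteq> V" by (rule V)+
    show "?T \<in> V" by (rule nonunits_subset[OF V(1) inf_T_nonunit])
    show "inf_U \<in> V" by (rule inf_U_unit(1))
    show "generates ?T inf_U" by (rule generates_T_U[OF ij])
    show "?T \<in> nonunits V" by (rule inf_T_nonunit)
    show "inf_gcd > 0" by (rule inf_gcd(3))
  qed
  have Tl: "?T \<in> loc" and Ul: "inf_U \<in> loc" using gen_ring_loc gen_ring_gens by auto
  have T_ideal: "?T * h \<in> unif_ideal" if "h \<in> loc" for h using that by (auto intro: unif_idealI)
  have pos: "CARD('a) ^ m > 0" for m using card_field_ge_2[where 'a = 'a] by simp
  let ?Q = "CARD('a) ^ inf_gcd"
  have power_ideal: "h ^ ?Q - h \<in> unif_ideal" if h: "h \<in> unif_ideal" "h \<in> loc" for h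
  proof -
    have "h ^ ?Q - h = (h ^ (?Q - 1) - 1) * h"
      unfolding left_diff_distrib power_minus_mult[OF pos] by simp
    then show ?thesis using h by (auto intro!: unif_ideal_mult loc_intros)
  qed
  have "?T * 1 \<in> unif_ideal" by (intro T_ideal loc_intros)
  then have Tf: "?T \<in> frob_fixed" using power_ideal[of ?T] Tl by (simp add: frob_fixed_def)
  have iU: "inverse (inf_U ^ j) \<in> loc"
    using inf_U_unit nonunits_power[OF V(1)] by (intro loc_inverse loc_intros Ul) blast
  have "inverse x = ?T * (?T ^ (inf_e - 1) * inverse (inf_U ^ j))"
    unfolding inverse_x_eq power_minus_mult[OF inf_gcd(4), of ?T, symmetric] by (simp add: mult_ac)
  moreover have "?T ^ (inf_e - 1) * inverse (inf_U ^ j) \<in> loc" by (intro loc_intros Tl iU)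
  ultimately have "inverse x \<in> unif_ideal" "inverse x \<in> loc"
    using T_ideal loc_intros(3)[OF Tl] by auto
  then have zf: "inverse x \<in> frob_fixed" using power_ideal by (simp add: frob_fixed_def)
  have Ucf: "inf_U ^ inf_gcd \<in> frob_fixed"
    unfolding inf_U_power by (rule ev_in_subring[OF subring_frob_fixed iota_frob_fixed zf])
  have "inverse x \<in> residue_fixed V 1" by (rule nonunits_residue_fixed[OF val pole])
  then have "inf_U ^ inf_gcd \<in> residue_fixed V 1"
    unfolding inf_U_power
    by (rule ev_in_subring[OF subring_residue_fixed[OF val] iota_residue_fixed[OF val]])
  then have "inf_U \<in> residue_fixed V (1 * inf_gcd)"
    by (rule residue_fixed_root[OF val inf_U_unit _ inf_gcd(7)]) simp
  then have "inf_U ^ ?Q - inf_U \<in> nonunits V" by (simp add: residue_fixed_def)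
  then have Uf: "inf_U \<in> frob_fixed"
    by (rule frob_fixed_root[OF gen_ring_gens(3) inf_U_unit(2) _ of_nat_dvd_card_minus_1[OF inf_gcd(7)] Ucf])
  have sep: "\<exists>k. \<forall>g\<in>V. h \<noteq> ?T ^ k * g" if "h \<noteq> 0" for h
  proof (rule separated_criterion[OF val inf_T_nonunit inf_T_nonzero _ _ _ that])
    show "?T ^ inf_e * x \<in> V" "?T ^ inf_d * y \<in> V"
      using x_y_from_T_U[OF ij] VI(7)[OF inf_U_unit(1)] by (simp_all add: mult.commute)
    fix g :: "'a poly" assume "g \<noteq> 0"
    then obtain u where u: "u \<in> V" "u \<notin> nonunits V" "ev g x = x ^ degree g * u" using ev_leading by blast
    have "?T ^ (inf_e * degree g) * ev g x = (x * ?T ^ inf_e) ^ degree g * u"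
      unfolding u(3) by (simp add: power_mult_distrib power_mult)
    also have "\<dots> = inf_U ^ (j * degree g) * u"
      unfolding x_y_from_T_U(1)[OF ij] by (simp add: power_mult)
    finally have "?T ^ (inf_e * degree g) * ev g x = ?T ^ 0 * (inf_U ^ (j * degree g) * u)" by simp
    moreover have "inf_U ^ (j * degree g) * u \<in> V" by (intro VI inf_U_unit u)
    moreover have "inf_U ^ (j * degree g) * u \<notin> nonunits V"
      using nonunits_prime[OF val(1) _ VI(7)[OF inf_U_unit(1)] u(1)] nonunits_power[OF val(1) _ inf_U_unit(1)]
        inf_U_unit(2) u(2) by blast
    ultimately show "\<exists>k l u. u \<in> V \<and> u \<notin> nonunits V \<and> ?T ^ k * ev g x = ?T ^ l * u" by blast
  qed
  show ?thesis by unfold_locales (use Tf Uf inf_T_nonzero sep in auto)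
qed

end

end

lemma exists_infinite_place:
  obtains P where "P \<in> places \<iota>" "P x < 0"
proof -
  obtain V where V: "valuation_ring V" "range \<iota> \<subseteq> V" "inverse x \<in> nonunits V"
    using transcendental_valuation_ring[OF transcendental_inverse_x] .
  obtain i j where ij: "i * inf_e = j * inf_d + 1" using inf_bezout .
  interpret S: smooth_point \<iota> V "inf_T i j" inf_U "inf_T i j" inf_gcd
    by (rule smooth_infinite[OF V ij])
  have P: "S.unif_order \<in> places \<iota>" by (rule S.unif_order_place(1))
  have "vanishes_at S.unif_order (inverse x)" using S.unif_order_place(4) V(3) by simp
  then have "S.unif_order x < 0"
    using x_nonzero place_inverse[OF P, of x] by (simp add: vanishes_at_def)
  then show ?thesis using that P by blast
qed

text \<open>The polynomial \<open>X f' - d f\<close> has degree less than \<open>d\<close>, since the leading terms cancel.\<close>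

lemma log_derivative_y:
  assumes V: "valuation_ring V" "range \<iota> \<subseteq> V" and inf: "inverse x \<in> nonunits V"
  obtains v where "v \<in> V" "of_nat n * (x * dy / y) = of_nat (degree f) + inverse x * v"
proof -
  let ?d = "degree f"
  define p where "p = pCons 0 (pderiv f) - smult (of_nat ?d) f"
  have coeff_p: "coeff p i = (of_nat i - of_nat ?d) * coeff f i" for i
    by (cases i) (simp_all add: p_def coeff_pderiv left_diff_distrib)
  have "degree p \<le> ?d - 1"
  proof (rule degree_le, intro allI impI)
    fix i assume "?d - 1 < i"
    then have "i = ?d \<or> i > ?d" using degree_f by linarith
    then show "coeff p i = 0" by (auto simp: coeff_p coeff_eq_0)
  qed
  then obtain v where v: "v \<in> V" "ev p x = x ^ (?d - 1) * v" using ev_pole[OF V inf] by blast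
  obtain u where u: "u \<in> V" "u \<notin> nonunits V" "ev f x = x ^ ?d * u"
    using ev_leading[OF V inf f_nonzero] by blast
  have u0: "u \<noteq> 0" using u(2) zero_nonunits[OF V(1)] by auto
  have evf: "ev f x \<noteq> 0" using f_nonzero by simp
  have "ev p x = x * ev (pderiv f) x - of_nat ?d * ev f x"
    by (simp add: p_def ev_diff ev_pCons ev_smult iota_of_nat)
  then have "x * ev (pderiv f) x / ev f x = of_nat ?d + ev p x / ev f x"
    using evf by (simp add: field_simps)
  also have "ev p x / ev f x = inverse x * (v * inverse u)"
  proof -
    have "x ^ ?d = x * x ^ (?d - 1)" using degree_f by (simp add: power_eq_if)
    then show ?thesis unfolding v(2) u(3) using x_nonzero u0 by (simp add: field_simps)
  qed
  also have "x * ev (pderiv f) x / ev f x = of_nat n * (x * dy / y)"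
  proof -
    have "y ^ n = y * y ^ (n - 1)" using n by (simp add: power_eq_if)
    then show ?thesis
      unfolding curve_equation[symmetric] dy_def using y_nonzero n_nonzero by (simp add: field_simps)
  qed
  finally show ?thesis
    using that[of "v * inverse u"] v u inverse_unit[OF V(1)] by (auto intro: valuation_ring_intros(3)[OF V(1)])
qed

lemma log_derivative_monomial:
  assumes "h * x ^ i = y ^ j"
  shows "x * deriv_x h = h * (of_nat j * (x * dy / y) - of_nat i)"
proof -
  have d: "derivation_over \<iota> deriv_x" by (rule derivation_deriv_x)
  have xi: "x * deriv_x (x ^ i) = of_nat i * x ^ i"
    unfolding derivation_basic(8)[OF d] deriv_x_x by (cases i) simp_all
  have yj: "x * deriv_x (y ^ j) = of_nat j * (x * dy / y) * y ^ j"
    unfolding derivation_basic(8)[OF d] derivation_y[OF d deriv_x_x] using y_nonzero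
    by (cases j) simp_all
  have "deriv_x (y ^ j) = h * deriv_x (x ^ i) + x ^ i * deriv_x h"
    unfolding assms[symmetric] by (rule derivation_basic(4)[OF d])
  then have "x * deriv_x (y ^ j) = h * (x * deriv_x (x ^ i)) + x ^ i * (x * deriv_x h)"
    by (simp add: algebra_simps)
  then have "x ^ i * (x * deriv_x h) = x ^ i * (h * (of_nat j * (x * dy / y) - of_nat i))"
    unfolding xi yj unfolding assms[symmetric] by (simp add: algebra_simps)
  then show ?thesis using x_nonzero by simp
qed

text \<open>
  The derivation \<open>(x/T) d/dx\<close> multiplies a monomial by \<open>1/T\<close> times its logarithmic derivative. At
  infinity the latter is \<open>-c/n\<close> for \<open>T\<close>, by the choice of \<open>i\<close> and \<open>j\<close>, whereas for \<open>U\<close> it vanishes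
  together with \<open>1/x\<close>.
\<close>

lemma infinite_place_orders:
  assumes P: "P \<in> places \<iota>" and x: "P x < 0"
  shows "P x = - int inf_e" "P y = - int inf_d"
    and "g \<noteq> 0 \<Longrightarrow> differential_divisor \<iota> x g P = P g - int inf_e - 1"
proof -
  let ?V = "place_ring P"
  have V: "valuation_ring ?V" "range \<iota> \<subseteq> ?V" by (rule valuation_ring_place[OF P] iota_place_ring[OF P])+
  have inf: "inverse x \<in> nonunits ?V"
    using x by (simp add: nonunits_place[OF P] vanishes_at_def place_inverse[OF P])
  note VI = valuation_ring_intros[OF V(1)]
  obtain i j where ij: "i * inf_e = j * inf_d + 1" using inf_bezout .
  let ?T = "inf_T i j"
  have S: "smooth_point \<iota> ?V ?T inf_U ?T inf_gcd" by (rule smooth_infinite[OF V inf ij])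
  have PT: "P ?T = 1" by (rule smooth_point.place_of_unif(1)[OF S P refl])
  note U = inf_U_unit[OF V inf]
  have PU: "P inf_U = 0" using unit_place[OF P U(1)] U(2) by simp
  note xyTU = x_y_from_T_U[OF ij]
  have "P x + P (?T ^ inf_e) = P (inf_U ^ j)"
    unfolding xyTU(1)[symmetric] using x_nonzero inf_T_nonzero by (intro place_mult[OF P, symmetric]) auto
  then show Px: "P x = - int inf_e" using PT PU by (simp add: place_power[OF P])
  have "P y + P (?T ^ inf_d) = P (inf_U ^ i)"
    unfolding xyTU(2)[symmetric] using y_nonzero inf_T_nonzero by (intro place_mult[OF P, symmetric]) auto
  then show "P y = - int inf_d" using PT PU by (simp add: place_power[OF P])
  define \<kappa> where "\<kappa> = x * dy / y"
  obtain v where v: "v \<in> ?V" "of_nat n * \<kappa> = of_nat (degree f) + inverse x * v"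
    unfolding \<kappa>_def using log_derivative_y[OF V inf] .
  have nV: "inverse (of_nat n) \<in> ?V" by (rule inverse_of_nat_subset[OF V(2)])
  have "?T * x ^ i = y ^ j" "inf_U * x ^ inf_d = y ^ inf_e"
    using x_nonzero by (simp_all add: inf_T_def inf_U_def)
  note dTU = this[THEN log_derivative_monomial, folded \<kappa>_def]
  let ?m = "x / ?T"
  have n0: "of_nat n \<noteq> (0 :: 'k)" by (rule n_nonzero)
  have T0: "?T \<noteq> 0" by (rule inf_T_nonzero)
  have mT: "?m * deriv_x ?T = of_nat j * \<kappa> - of_nat i" using dTU(1) T0 by simp
  have nT: "of_nat n * (of_nat j * \<kappa> - of_nat i) = - of_nat inf_gcd + of_nat j * v * inverse x"
  proof -
    have "of_nat (j * degree f) - of_nat (i * n) = (- of_nat inf_gcd :: 'k)"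
    proof -
      have "j * degree f + inf_gcd = inf_gcd * (j * inf_d + 1)" using inf_gcd(2) by (simp add: algebra_simps)
      also have "\<dots> = i * n" unfolding ij[symmetric] using inf_gcd(1) by (simp add: mult_ac)
      finally have "of_nat (j * degree f + inf_gcd) = (of_nat (i * n) :: 'k)" by (rule arg_cong)
      then show ?thesis by (simp add: algebra_simps)
    qed
    moreover have "of_nat n * (of_nat j * \<kappa> - of_nat i) = of_nat j * (of_nat n * \<kappa>) - of_nat i * of_nat n"
      by (simp add: algebra_simps)
    ultimately show ?thesis unfolding v(2) by (simp add: algebra_simps)
  qed
  have T_eq: "of_nat j * \<kappa> - of_nat i = inverse (of_nat n) * (- of_nat inf_gcd + of_nat j * v * inverse x)"
    using nT n0 by (simp add: field_simps)
  have zV: "inverse x \<in> ?V" by (rule nonunits_subset[OF V(1) inf])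
  have mTV: "?m * deriv_x ?T \<in> ?V" unfolding mT T_eq by (intro VI nV v(1) zV)
  have mTu: "?m * deriv_x ?T \<notin> nonunits ?V"
  proof
    assume "?m * deriv_x ?T \<in> nonunits ?V"
    then have "- of_nat inf_gcd + of_nat j * v * inverse x \<in> nonunits ?V"
      unfolding nT[symmetric] mT by (intro nonunits_mult(1)[OF V(1)] VI)
    moreover have "of_nat j * v * inverse x \<in> nonunits ?V"
      by (intro nonunits_mult(1)[OF V(1) inf] VI v(1))
    ultimately have "(of_nat j * v * inverse x) - (- of_nat inf_gcd + of_nat j * v * inverse x) \<in> nonunits ?V"
      by (intro nonunits_diff[OF V(1)])
    then have "\<iota> (of_nat inf_gcd) \<in> nonunits ?V" by (simp add: iota_of_nat)
    then show False using iota_unit[OF V] of_nat_dvd_card_minus_1[OF inf_gcd(7)] by blast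
  qed
  have mU: "?m * deriv_x inf_U = inf_U * of_nat inf_e * v * inverse (of_nat n) * (inverse x / ?T)"
  proof -
    have "of_nat n * (of_nat inf_e * \<kappa> - of_nat inf_d) = of_nat inf_e * v * inverse x"
    proof -
      have "inf_e * degree f = n * inf_d" using inf_gcd(1,2) by (metis mult.commute mult.assoc)
      then have "of_nat inf_e * of_nat (degree f) = (of_nat n * of_nat inf_d :: 'k)" by (simp flip: of_nat_mult)
      moreover have "of_nat n * (of_nat inf_e * \<kappa> - of_nat inf_d) = of_nat inf_e * (of_nat n * \<kappa>) - of_nat n * of_nat inf_d"
        by (simp add: algebra_simps)
      ultimately show ?thesis unfolding v(2) by (simp add: algebra_simps)
    qed
    then have "of_nat inf_e * \<kappa> - of_nat inf_d = inverse (of_nat n) * (of_nat inf_e * v * inverse x)"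
      using n0 by (metis mult.assoc left_inverse mult_1)
    moreover have "?m * deriv_x inf_U = inf_U * (of_nat inf_e * \<kappa> - of_nat inf_d) / ?T"
      using dTU(2) by simp
    ultimately show ?thesis by (simp add: mult_ac)
  qed
  have "inverse x / ?T = ?T ^ (inf_e - 1) * inverse (inf_U ^ j)"
    unfolding inverse_x_eq[OF V inf ij] power_minus_mult[OF inf_gcd(4), of ?T, symmetric]
    using T0 by simp
  moreover have "inverse (inf_U ^ j) \<in> ?V"
    using U nonunits_power[OF V(1)] by (intro inverse_unit[OF V(1)] VI) blast+
  ultimately have "inverse x / ?T \<in> ?V"
    using nonunits_subset[OF V(1) inf_T_nonunit[OF V inf ij]] by (auto intro!: VI)
  then have mUV: "?m * deriv_x inf_U \<in> ?V" unfolding mU by (intro VI U v(1) nV)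
  assume g: "g \<noteq> 0"
  have "differential_divisor \<iota> x g P = P g + P ?m"
    by (rule differential_order[OF P S _ mTV mUV mTV mTu g]) (use x_nonzero T0 in simp)
  then show "differential_divisor \<iota> x g P = P g - int inf_e - 1"
    using place_divide[OF P x_nonzero T0] PT Px by simp
qed

end

section \<open>The divisors on the curve\<close>

lemma nonunits_prodD:
  assumes V: "valuation_ring V" and "prod g A \<in> nonunits V" "\<And>i. i \<in> A \<Longrightarrow> g i \<in> V"
  shows "\<exists>i\<in>A. g i \<in> nonunits V"
  using assms(2,3)
proof (induction A rule: infinite_finite_induct)
  case (insert i A)
  then show ?case
    using nonunits_prime[OF V, of "g i" "prod g A"] valuation_ring_intros(9)[OF V, of A g] by auto
qed (simp_all add: one_notin_nonunits[OF V])

lemma (in constant_embedding) vanishing_point_unique: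
  assumes P: "P \<in> places \<iota>" and "vanishes_at P (h - \<iota> a)" "vanishes_at P (h - \<iota> b)"
  shows "a = b"
proof -
  have V: "valuation_ring (place_ring P)" "range \<iota> \<subseteq> place_ring P"
    by (rule valuation_ring_place[OF P] iota_place_ring[OF P])+
  have "(h - \<iota> b) - (h - \<iota> a) \<in> nonunits (place_ring P)"
    by (rule nonunits_diff[OF V(1)]) (use assms in \<open>simp_all add: nonunits_place[OF P]\<close>)
  then have "\<iota> (a - b) \<in> nonunits (place_ring P)" by (simp add: iota_diff)
  then show ?thesis using iota_unit[OF V] by simp
qed

lemma (in constant_embedding) place_diff:
  assumes "P \<in> places \<iota>" "g \<noteq> 0" "h \<noteq> 0" "g - h \<noteq> 0"
  shows "min (P g) (P h) \<le> P (g - h)"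
  using place_add[OF assms(1), of g "- h"] assms by (simp add: place_uminus)

context split_superelliptic
begin

lemma regular_x_iff:
  assumes P: "P \<in> places \<iota>"
  shows "regular_at P x \<longleftrightarrow> \<not> P x < 0"
  using x_nonzero by (auto simp: regular_at_def)

lemma vanishing_point_regular:
  assumes P: "P \<in> places \<iota>" and "vanishes_at P (x - \<iota> a)"
  shows "\<not> P x < 0"
proof -
  have "x - \<iota> a \<in> nonunits (place_ring P)" using assms by (simp add: nonunits_place[OF P])
  then have "x \<in> place_ring P" by (rule ev_residue(2)[OF valuation_ring_place[OF P] iota_place_ring[OF P]])
  then show ?thesis using regular_x_iff[OF P] by (simp add: place_ring_def)
qed

lemma place_trichotomy:
  assumes P: "P \<in> places \<iota>"
  obtains (infinite) "P x < 0"
    | (ramified) a where "a \<in> roots" "vanishes_at P (x - \<iota> a)"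
    | (unramified) "regular_at P x" "\<not> vanishes_at P y"
proof -
  let ?V = "place_ring P"
  have V: "valuation_ring ?V" "range \<iota> \<subseteq> ?V" by (rule valuation_ring_place[OF P] iota_place_ring[OF P])+
  have "\<exists>a\<in>roots. vanishes_at P (x - \<iota> a)" if x: "regular_at P x" and y: "vanishes_at P y"
  proof -
    have xV: "x \<in> ?V" using x by (simp add: place_ring_def)
    have "y ^ n \<in> nonunits ?V"
      using y n by (intro nonunits_power_pos[OF V(1)]) (auto simp: nonunits_place[OF P])
    moreover have "y ^ n = \<iota> (lead_coeff f) * (\<Prod>a\<in>roots. x - \<iota> a)"
      unfolding curve_equation by (subst split) (simp add: ev_smult ev_prod ev_linear)
    moreover have mem: "x - \<iota> a \<in> ?V" for a
      using V(2) xV by (intro valuation_ring_intros(2)[OF V(1)]) auto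
    moreover have "(\<Prod>a\<in>roots. x - \<iota> a) \<in> ?V" by (intro valuation_ring_intros(9)[OF V(1)] mem)
    moreover have "\<iota> (lead_coeff f) \<in> ?V" using V(2) by auto
    moreover have "\<iota> (lead_coeff f) \<notin> nonunits ?V" using iota_unit[OF V] f_nonzero by simp
    ultimately have "(\<Prod>a\<in>roots. x - \<iota> a) \<in> nonunits ?V" using nonunits_prime[OF V(1)] by metis
    then show ?thesis using nonunits_prodD[OF V(1)] mem by (auto simp: nonunits_place[OF P])
  qed
  then show ?thesis using that regular_x_iff[OF P] by blast
qed

lemma eta_denominator_nonzero: "x ^ CARD('a) - x \<noteq> 0"
  using x_frobenius_nonzero[of 1] by simp

lemma eta_coefficient:
  assumes P: "P \<in> places \<iota>"
  shows "- 1 / (x ^ CARD('a) - x) \<noteq> 0" "P (- 1 / (x ^ CARD('a) - x)) = - P (x ^ CARD('a) - x)"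
  using eta_denominator_nonzero place_divide[OF P, of "- 1" "x ^ CARD('a) - x"]
    place_uminus[OF P, of 1] place_1[OF P] by simp_all

lemma eta_denominator_shift: "x ^ CARD('a) - x = (x - \<iota> a) ^ CARD('a) - (x - \<iota> a)"
  using frobenius_diff[of x "\<iota> a" 1] frobenius_iota[of a 1] by simp

lemma eta_denominator_vanishes:
  assumes P: "P \<in> places \<iota>" and x: "vanishes_at P (x - \<iota> a)"
  shows "P (x - \<iota> a) > 0" "P (x ^ CARD('a) - x) \<ge> P (x - \<iota> a)"
proof -
  let ?t = "x - \<iota> a"
  have t0: "?t \<noteq> 0" using ev_x_eq_0[of "[:- a, 1:]"] by (simp add: ev_linear del: ev_x_eq_0)
  then show pos: "P ?t > 0" using x by (simp add: vanishes_at_def)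
  have "1 * P ?t \<le> int CARD('a) * P ?t" using pos by (intro mult_right_mono) auto
  then have "min (P (?t ^ CARD('a))) (P ?t) \<ge> P ?t" unfolding place_power[OF P] by simp
  moreover have "min (P (?t ^ CARD('a))) (P ?t) \<le> P (?t ^ CARD('a) - ?t)"
    by (rule place_diff[OF P]) (use t0 eta_denominator_nonzero eta_denominator_shift[of a] in simp_all)
  ultimately show "P (x ^ CARD('a) - x) \<ge> P ?t"
    unfolding eta_denominator_shift[of a] by (rule order.trans)
qed

lemma A_divisor_infinite:
  assumes P: "P \<in> places \<iota>" and x: "P x < 0"
  shows "A_divisor \<iota> f x s P = (int CARD('a) - 1) * int inf_e - 1 - int s" "G_divisor \<iota> x s P = int s"
proof -
  show G: "G_divisor \<iota> x s P = int s" using P x by (simp add: G_divisor_def D_infinity_def)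
  have "D_evaluation \<iota> f x P = 0"
    unfolding D_evaluation_def using vanishing_point_regular[OF P] x by auto
  moreover have "P (x ^ CARD('a) - x) = - (int CARD('a) * int inf_e)"
  proof -
    have "P (x ^ CARD('a)) < P (- x)"
    proof -
      have "int CARD('a) * P x \<le> 2 * P x"
        using x card_field_ge_2[where 'a = 'a] by (intro mult_right_mono_neg) auto
      then show ?thesis unfolding place_power[OF P] place_uminus[OF P] using x by linarith
    qed
    then have "P (x ^ CARD('a) + - x) = P (x ^ CARD('a))"
      using place_add_unequal[OF P, of "x ^ CARD('a)" "- x"] x_nonzero by simp
    then show ?thesis by (simp add: place_power[OF P] infinite_place_orders(1)[OF P x])
  qed
  ultimately show "A_divisor \<iota> f x s P = (int CARD('a) - 1) * int inf_e - 1 - int s"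
    unfolding A_divisor_def div_eta_def
    using G infinite_place_orders(3)[OF P x eta_coefficient(1)[OF P]] eta_coefficient(2)[OF P]
    by (simp add: algebra_simps)
qed

lemma A_divisor_ramified:
  assumes P: "P \<in> places \<iota>" and a: "a \<in> roots" and x: "vanishes_at P (x - \<iota> a)"
  shows "A_divisor \<iota> f x s P < 0" "G_divisor \<iota> x s P = 0"
proof -
  show G: "G_divisor \<iota> x s P = 0"
    using vanishing_point_regular[OF P x] by (simp add: G_divisor_def D_infinity_def)
  have "D_evaluation \<iota> f x P = 0"
    unfolding D_evaluation_def using vanishing_point_unique[OF P x] a by (auto simp: poly_f)
  moreover have "P (x ^ CARD('a) - x) \<ge> int n"
    using eta_denominator_vanishes(2)[OF P x] ramified_place_orders(2)[OF P x a] by simp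
  ultimately show "A_divisor \<iota> f x s P < 0"
    unfolding A_divisor_def div_eta_def
    using G ramified_place_orders(3)[OF P x a eta_coefficient(1)[OF P]] eta_coefficient(2)[OF P]
    by simp
qed

text \<open>
  The denominator \<open>x^q - x\<close> of \<open>\<eta>\<close> vanishes at every rational point of the line, which offsets the
  coefficient of \<open>D\<close>.
\<close>

lemma A_divisor_unramified:
  assumes P: "P \<in> places \<iota>" and x: "regular_at P x" and y: "\<not> vanishes_at P y"
  shows "A_divisor \<iota> f x s P \<le> 0" "G_divisor \<iota> x s P = 0"
proof -
  show G: "G_divisor \<iota> x s P = 0"
    using x x_nonzero by (auto simp: G_divisor_def D_infinity_def regular_at_def)
  have eta: "div_eta \<iota> x P = - P (x ^ CARD('a) - x)"
    unfolding div_eta_def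
    using unramified_differential[OF P x y eta_coefficient(1)[OF P]] eta_coefficient(2)[OF P] by simp
  have "D_evaluation \<iota> f x P \<le> P (x ^ CARD('a) - x)"
  proof (cases "\<exists>a. vanishes_at P (x - \<iota> a)")
    case True
    then obtain a where a: "vanishes_at P (x - \<iota> a)" by blast
    then have "P (x ^ CARD('a) - x) > 0"
      using eta_denominator_vanishes[OF P a] by simp
    then show ?thesis by (simp add: D_evaluation_def)
  next
    case False
    have "x ^ CARD('a) - x \<in> place_ring P"
      using x valuation_ring_intros[OF valuation_ring_place[OF P]] by (simp add: place_ring_def)
    then show ?thesis using False eta_denominator_nonzero
      by (auto simp: D_evaluation_def place_ring_def regular_at_def)
  qed
  then show "A_divisor \<iota> f x s P \<le> 0" unfolding A_divisor_def using G eta by simp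
qed

theorem G_not_le_A: "\<not> G_divisor \<iota> x s \<le> A_divisor \<iota> f x s"
proof
  assume le: "G_divisor \<iota> x s \<le> A_divisor \<iota> f x s"
  obtain a where a: "a \<in> roots" using roots_nonempty .
  obtain P where "P \<in> places \<iota>" "vanishes_at P (x - \<iota> a)" using exists_ramified_place[OF a] .
  then show False using le_funD[OF le, of P] A_divisor_ramified[of P a s] a by simp
qed

theorem A_le_G_iff:
  "A_divisor \<iota> f x s \<le> G_divisor \<iota> x s \<longleftrightarrow> (int CARD('a) - 1) * int inf_e - 1 \<le> 2 * int s"
proof
  assume le: "A_divisor \<iota> f x s \<le> G_divisor \<iota> x s"
  obtain P where "P \<in> places \<iota>" "P x < 0" using exists_infinite_place .
  then show "(int CARD('a) - 1) * int inf_e - 1 \<le> 2 * int s"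
    using le_funD[OF le, of P] A_divisor_infinite[of P s] by simp
next
  assume s: "(int CARD('a) - 1) * int inf_e - 1 \<le> 2 * int s"
  show "A_divisor \<iota> f x s \<le> G_divisor \<iota> x s"
  proof (rule le_funI)
    fix P
    show "A_divisor \<iota> f x s P \<le> G_divisor \<iota> x s P"
    proof (cases "P \<in> places \<iota>")
      case True
      then show ?thesis
      proof (cases rule: place_trichotomy)
        case infinite
        then show ?thesis using A_divisor_infinite[OF True, of s] s by simp
      next
        case (ramified a)
        then show ?thesis using A_divisor_ramified[OF True, of a s] by simp
      next
        case unramified
        then show ?thesis using A_divisor_unramified[OF True, of s] by simp
      qed
    next
      case False
      then show ?thesis
        by (simp add: A_divisor_def G_divisor_def D_infinity_def D_evaluation_def rational_place_def
            div_eta_def differential_divisor_def)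
    qed
  qed
qed

end

section \<open>Evaluation at rational places\<close>

context constant_embedding
begin

context
  fixes P :: "'k point"
  assumes rat: "rational_place \<iota> P"
begin

lemma rational_place_place: "P \<in> places \<iota>" using rat by (simp add: rational_place_def)

lemmas rational_ring = valuation_ring_place[OF rational_place_place]
lemmas rational_const = iota_place_ring[OF rational_place_place]

lemma value_at_unique:
  assumes "h - \<iota> a \<in> nonunits (place_ring P)"
  shows "value_at \<iota> P h = a"
  unfolding value_at_def
proof (rule the_equality)
  show "vanishes_at P (h - \<iota> a)" using assms by (simp add: nonunits_place[OF rational_place_place])
  fix b assume "vanishes_at P (h - \<iota> b)"
  then show "b = a"
    using assms by (intro vanishing_point_unique[OF rational_place_place, of h])
      (simp_all add: nonunits_place[OF rational_place_place])
qed

lemma value_at_residue: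
  assumes "h \<in> place_ring P"
  shows "h - \<iota> (value_at \<iota> P h) \<in> nonunits (place_ring P)"
proof -
  have "regular_at P h" using assms by (simp add: place_ring_def)
  then obtain a where "vanishes_at P (h - \<iota> a)" using rat unfolding rational_place_def by blast
  then have a: "h - \<iota> a \<in> nonunits (place_ring P)" by (simp add: nonunits_place[OF rational_place_place])
  then show ?thesis using value_at_unique[OF a] by simp
qed

lemma value_at_iota: "value_at \<iota> P (\<iota> a) = a"
  by (rule value_at_unique) (simp add: zero_nonunits[OF rational_ring])

lemma value_at_0: "value_at \<iota> P 0 = 0" using value_at_iota[of 0] by simp

lemma value_at_add:
  assumes "g \<in> place_ring P" "h \<in> place_ring P"
  shows "value_at \<iota> P (g + h) = value_at \<iota> P g + value_at \<iota> P h"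
proof (rule value_at_unique)
  have "g + h - \<iota> (value_at \<iota> P g + value_at \<iota> P h)
      = (g - \<iota> (value_at \<iota> P g)) + (h - \<iota> (value_at \<iota> P h))"
    by (simp add: iota_add)
  also have "\<dots> \<in> nonunits (place_ring P)" by (intro nonunits_add[OF rational_ring] value_at_residue assms)
  finally show "g + h - \<iota> (value_at \<iota> P g + value_at \<iota> P h) \<in> nonunits (place_ring P)" .
qed

lemma value_at_mult:
  assumes "g \<in> place_ring P" "h \<in> place_ring P"
  shows "value_at \<iota> P (g * h) = value_at \<iota> P g * value_at \<iota> P h"
proof (rule value_at_unique)
  let ?a = "value_at \<iota> P g" and ?b = "value_at \<iota> P h"
  have "g * h - \<iota> (?a * ?b) = g * (h - \<iota> ?b) + (g - \<iota> ?a) * \<iota> ?b"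
    by (simp add: iota_mult algebra_simps)
  also have "\<dots> \<in> nonunits (place_ring P)"
    using rational_const assms
    by (intro nonunits_add[OF rational_ring] nonunits_mult[OF rational_ring] value_at_residue) auto
  finally show "g * h - \<iota> (?a * ?b) \<in> nonunits (place_ring P)" .
qed

lemma value_at_power: "h \<in> place_ring P \<Longrightarrow> value_at \<iota> P (h ^ k) = value_at \<iota> P h ^ k"
  using value_at_iota[of 1]
  by (induction k) (simp_all add: value_at_mult valuation_ring_intros(7)[OF rational_ring] iota_1)

lemma value_at_sum:
  assumes "\<And>i. i \<in> A \<Longrightarrow> g i \<in> place_ring P"
  shows "value_at \<iota> P (sum g A) = (\<Sum>i\<in>A. value_at \<iota> P (g i))"
  using assms
proof (induction A rule: infinite_finite_induct)
  case (insert i A)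
  then show ?case by (simp add: value_at_add valuation_ring_intros(8)[OF rational_ring])
qed (simp_all add: value_at_0)

lemma value_at_ev:
  assumes "t \<in> place_ring P"
  shows "value_at \<iota> P (ev g t) = poly g (value_at \<iota> P t)"
  by (rule value_at_unique, rule ev_residue(1)[OF rational_ring rational_const value_at_residue[OF assms]])

lemma value_at_eq_0_iff:
  assumes "h \<in> place_ring P"
  shows "value_at \<iota> P h = 0 \<longleftrightarrow> h \<in> nonunits (place_ring P)"
  using value_at_residue[OF assms] value_at_unique[of h 0] by auto

end

end

section \<open>The evaluation points\<close>

context split_superelliptic
begin

definition eval_points :: "'k point set" where
  "eval_points = Supp (D_evaluation \<iota> f x)"

abbreviation X_at :: "'k point \<Rightarrow> 'a" where "X_at P \<equiv> value_at \<iota> P x"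
abbreviation Y_at :: "'k point \<Rightarrow> 'a" where "Y_at P \<equiv> value_at \<iota> P y"

lemma eval_points_iff:
  "P \<in> eval_points \<longleftrightarrow> rational_place \<iota> P \<and> (\<exists>a. vanishes_at P (x - \<iota> a) \<and> poly f a \<noteq> 0)"
  by (simp add: eval_points_def Supp_def D_evaluation_def)

lemma eval_point:
  assumes "P \<in> eval_points"
  shows "rational_place \<iota> P" "P \<in> places \<iota>" "x \<in> place_ring P" "y \<in> place_ring P"
    "poly f (X_at P) \<noteq> 0" "Y_at P ^ n = poly f (X_at P)" "Y_at P \<noteq> 0"
    "vanishes_at P (x - \<iota> (X_at P))"
proof -
  show rat: "rational_place \<iota> P" and P: "P \<in> places \<iota>"
    using assms by (auto simp: eval_points_iff rational_place_def)
  obtain a where a: "vanishes_at P (x - \<iota> a)" "poly f a \<noteq> 0"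
    using assms by (auto simp: eval_points_iff)
  have V: "valuation_ring (place_ring P)" "range \<iota> \<subseteq> place_ring P"
    by (rule valuation_ring_place[OF P] iota_place_ring[OF P])+
  have an: "x - \<iota> a \<in> nonunits (place_ring P)" using a by (simp add: nonunits_place[OF P])
  then have X: "X_at P = a" by (rule value_at_unique[OF rat])
  show xV: "x \<in> place_ring P" by (rule ev_residue(2)[OF V an])
  show yV: "y \<in> place_ring P" by (rule y_integral[OF V xV])
  show f: "poly f (X_at P) \<noteq> 0" using a X by simp
  show Y: "Y_at P ^ n = poly f (X_at P)"
    unfolding value_at_power[OF rat yV, symmetric] curve_equation by (rule value_at_ev[OF rat xV])
  show "Y_at P \<noteq> 0" using Y f n by (auto simp: power_0_left)
  show "vanishes_at P (x - \<iota> (X_at P))" using a X by simp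
qed

lemma eval_point_smooth:
  assumes "P \<in> eval_points"
  shows "smooth_point \<iota> (place_ring P) x y (x ^ (CARD('a) ^ Suc 0) - x) (Suc 0)"
proof (rule smooth_unramified)
  note E = eval_point[OF assms]
  note V = rational_ring[OF E(1)] rational_const[OF E(1)]
  show "P \<in> places \<iota>" by (rule E)
  show "regular_at P x" using E(3) by (simp add: place_ring_def)
  show "y \<notin> nonunits (place_ring P)" using E(7) value_at_eq_0_iff[OF E(1,4)] by simp
  have "x \<in> residue_fixed (place_ring P) (Suc 0)" "y \<in> residue_fixed (place_ring P) (Suc 0)"
    by (rule residue_fixed_cong[OF V value_at_residue[OF E(1)]], rule E)+
  then show "vanishes_at P (x ^ (CARD('a) ^ Suc 0) - x)" "vanishes_at P (y ^ (CARD('a) ^ Suc 0) - y)"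
    by (simp_all add: residue_fixed_def nonunits_place[OF E(2)])
qed simp

text \<open>
  The coordinates of an evaluation point determine which elements of \<open>k[x, y]\<close> vanish there, hence
  the local ring with its uniformiser \<open>x^q - x\<close>, hence the valuation.
\<close>

lemma eval_point_determined:
  assumes P: "P \<in> eval_points" and P': "P' \<in> eval_points"
    and eq: "X_at P = X_at P'" "Y_at P = Y_at P'"
  shows "P = P'"
proof
  fix h
  note E = eval_point[OF P] and E' = eval_point[OF P']
  let ?V = "place_ring P" and ?V' = "place_ring P'"
  note VI = valuation_ring_intros[OF rational_ring[OF E(1)]]
  note VI' = valuation_ring_intros[OF rational_ring[OF E'(1)]]
  interpret S: smooth_point \<iota> ?V x y "x ^ (CARD('a) ^ Suc 0) - x" "Suc 0"
    by (rule eval_point_smooth[OF P])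
  interpret S': smooth_point \<iota> ?V' x y "x ^ (CARD('a) ^ Suc 0) - x" "Suc 0"
    by (rule eval_point_smooth[OF P'])
  let ?F = "{h \<in> ?V \<inter> ?V'. value_at \<iota> P h = value_at \<iota> P' h}"
  have neg: "- 1 \<in> ?V" "- 1 \<in> ?V'" "value_at \<iota> P (- 1) = - 1" "value_at \<iota> P' (- 1) = - 1"
    using value_at_iota[OF E(1), of "- 1"] value_at_iota[OF E'(1), of "- 1"] VI(1,5) VI'(1,5)
    by (auto simp: iota_uminus iota_1)
  have "subring ?F"
  proof (rule subringI)
    show "1 \<in> ?F"
      using value_at_iota[OF E(1), of 1] value_at_iota[OF E'(1), of 1] VI(1) VI'(1) by (simp add: iota_1)
    fix g h assume gh: "g \<in> ?F" "h \<in> ?F"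
    show "g * h \<in> ?F"
      using gh VI(3) VI'(3) by (auto simp: value_at_mult[OF E(1)] value_at_mult[OF E'(1)])
    have "g - h = g + (- 1) * h" by simp
    then show "g - h \<in> ?F"
      using gh neg VI(2,3) VI'(2,3) value_at_add[OF E(1), of g "- 1 * h"] value_at_mult[OF E(1), of "- 1" h]
        value_at_add[OF E'(1), of g "- 1 * h"] value_at_mult[OF E'(1), of "- 1" h] VI(5) VI'(5) by auto
  qed
  moreover have "range \<iota> \<subseteq> ?F"
    using rational_const[OF E(1)] rational_const[OF E'(1)]
    by (auto simp: value_at_iota[OF E(1)] value_at_iota[OF E'(1)])
  ultimately have R: "gen_ring x y \<subseteq> ?F" by (rule gen_ring_subset) (use E E' eq in auto)
  have same: "a \<in> nonunits ?V \<longleftrightarrow> a \<in> nonunits ?V'" if "a \<in> gen_ring x y" for a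
    using R that value_at_eq_0_iff[OF E(1), of a] value_at_eq_0_iff[OF E'(1), of a] by auto
  show "P h = P' h"
  proof (cases "h = 0")
    case True
    then show ?thesis using place_0[OF E(2)] place_0[OF E'(2)] by simp
  next
    case False
    then obtain m u where u: "u \<in> S.loc" "u \<notin> nonunits ?V"
      "h = (x ^ (CARD('a) ^ Suc 0) - x) powi m * u" by (rule S.factor)
    obtain a b where ab: "u = a / b" "a \<in> gen_ring x y" "b \<in> gen_ring x y" "b \<notin> nonunits ?V"
      using u(1) by (auto simp: S.loc_def)
    have b0: "b \<noteq> 0" using S.denominator_nonzero ab(4) by auto
    then have "a = u * b" using ab(1) by simp
    then have an: "a \<notin> nonunits ?V"
      using nonunits_prime[OF rational_ring[OF E(1)], of u b] u S.loc_V ab S.gen_ring_V by auto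
    have u': "u \<in> S'.loc" unfolding S'.loc_def using ab same by blast
    have "u \<notin> nonunits ?V'"
    proof
      assume "u \<in> nonunits ?V'"
      then have "u * b \<in> nonunits ?V'"
        using ab(3) S'.gen_ring_V by (intro nonunits_mult(2)[OF rational_ring[OF E'(1)]]) auto
      then show False using \<open>a = u * b\<close> an same[OF ab(2)] by simp
    qed
    then have "P' h = m" by (rule S'.place_of_unif(2)[OF E'(2) refl u(3) u'])
    then show ?thesis using S.place_of_unif(2)[OF E(2) refl u(3,1,2)] by simp
  qed
qed

text \<open>Composing the valuation with a rotation gives another evaluation point of the same fibre.\<close>

lemma rotated_eval_point:
  assumes P: "P \<in> eval_points" and z: "z \<in> unity_roots n"
  obtains P' where "P' \<in> eval_points" "X_at P' = X_at P" "Y_at P' = z * Y_at P"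
proof
  note E = eval_point[OF P]
  let ?P' = "\<lambda>h. P (rotation z h)"
  have iz: "inverse z \<in> unity_roots n" using z by (simp add: unity_roots_def power_inverse)
  obtain t where t: "P t = 1" using place_unif[OF E(2)] by blast
  have tt: "rotation z (rotation (inverse z) t) = t"
    using rotation_rotation[OF iz z] unity_roots_nonzero[OF z] by (simp add: rotation_1)
  have t0: "t \<noteq> 0" using t place_0[OF E(2)] by auto
  have "?P' \<in> places \<iota>"
    unfolding places_def mem_Collect_eq
  proof (intro conjI allI impI)
    show "P (rotation z 0) = 0" by (simp add: rotation_values[OF z] place_0[OF E(2)])
    show "P (rotation z (\<iota> a)) = 0" for a by (simp add: rotation_values[OF z] place_iota[OF E(2)])
    show "\<exists>t. t \<noteq> 0 \<and> P (rotation z t) = 1"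
      using t t0 tt rotation_eq_0_iff[OF iz] by (intro exI[of _ "rotation (inverse z) t"]) simp
    fix g h assume gh: "g \<noteq> (0 :: 'k)" "h \<noteq> (0 :: 'k)"
    show "P (rotation z (g * h)) = P (rotation z g) + P (rotation z h)"
      using gh by (simp add: rotation_arith[OF z] place_mult[OF E(2)] rotation_eq_0_iff[OF z])
    assume "g + h \<noteq> 0"
    then have "rotation z g + rotation z h \<noteq> 0"
      using rotation_eq_0_iff[OF z, of "g + h"] by (simp add: rotation_arith[OF z])
    then show "min (P (rotation z g)) (P (rotation z h)) \<le> P (rotation z (g + h))"
      using gh place_add[OF E(2)] by (simp add: rotation_arith[OF z] rotation_eq_0_iff[OF z])
  qed
  moreover have van: "vanishes_at ?P' h \<longleftrightarrow> vanishes_at P (rotation z h)" for h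
    by (simp add: vanishes_at_def rotation_eq_0_iff[OF z])
  moreover have reg: "regular_at ?P' h \<longleftrightarrow> regular_at P (rotation z h)" for h
    by (simp add: regular_at_def rotation_eq_0_iff[OF z])
  ultimately have rat: "rational_place \<iota> ?P'"
    using E(1) unfolding rational_place_def by (simp add: rotation_arith[OF z] rotation_values[OF z])
  have vx: "vanishes_at ?P' (x - \<iota> (X_at P))"
    using E(8) van by (simp add: rotation_arith[OF z] rotation_values[OF z])
  show mem: "?P' \<in> eval_points" unfolding eval_points_iff using rat vx E(5) by blast
  show "X_at ?P' = X_at P"
    by (rule value_at_unique[OF rat]) (use vx in \<open>simp add: nonunits_place[OF eval_point(2)[OF mem]]\<close>)
  have "\<iota> z * y - \<iota> (z * Y_at P) = \<iota> z * (y - \<iota> (Y_at P))" by (simp add: iota_mult algebra_simps)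
  also have "\<dots> \<in> nonunits (place_ring P)"
    using rational_const[OF E(1)] by (intro nonunits_mult(1)[OF rational_ring[OF E(1)]] value_at_residue[OF E(1)] E(4)) auto
  finally have "vanishes_at P (\<iota> z * y - \<iota> (z * Y_at P))" by (simp add: nonunits_place[OF E(2)])
  then have "vanishes_at ?P' (y - \<iota> (z * Y_at P))"
    using van by (simp add: rotation_arith[OF z] rotation_values[OF z])
  then show "Y_at ?P' = z * Y_at P"
    by (intro value_at_unique[OF rat]) (simp add: nonunits_place[OF eval_point(2)[OF mem]])
qed

definition fibre :: "'a \<Rightarrow> 'a set" where "fibre a = {b. b ^ n = poly f a}"

definition eval_abscissae :: "'a set" where "eval_abscissae = X_at ` eval_points"

lemma eval_abscissae_nonroot: "a \<in> eval_abscissae \<Longrightarrow> poly f a \<noteq> 0"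
  by (auto simp: eval_abscissae_def eval_point)

lemma eval_points_coordinates:
  "bij_betw (\<lambda>P. (X_at P, Y_at P)) eval_points (SIGMA a:eval_abscissae. fibre a)"
proof (rule bij_betw_imageI)
  show "inj_on (\<lambda>P. (X_at P, Y_at P)) eval_points"
    by (rule inj_onI) (auto intro: eval_point_determined)
  show "(\<lambda>P. (X_at P, Y_at P)) ` eval_points = (SIGMA a:eval_abscissae. fibre a)"
  proof
    show "(\<lambda>P. (X_at P, Y_at P)) ` eval_points \<subseteq> (SIGMA a:eval_abscissae. fibre a)"
      by (auto simp: eval_abscissae_def fibre_def eval_point)
    show "(SIGMA a:eval_abscissae. fibre a) \<subseteq> (\<lambda>P. (X_at P, Y_at P)) ` eval_points"
    proof
      fix p assume "p \<in> (SIGMA a:eval_abscissae. fibre a)"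
      then obtain P b where P: "P \<in> eval_points" "p = (X_at P, b)" "b ^ n = poly f (X_at P)"
        by (auto simp: eval_abscissae_def fibre_def)
      let ?z = "b / Y_at P"
      have "?z \<in> unity_roots n"
        using P(3) eval_point(5,6)[OF P(1)] by (simp add: unity_roots_def power_divide)
      then obtain P' where "P' \<in> eval_points" "X_at P' = X_at P" "Y_at P' = ?z * Y_at P"
        using rotated_eval_point[OF P(1)] by blast
      then show "p \<in> (\<lambda>P. (X_at P, Y_at P)) ` eval_points"
        using P eval_point(7)[OF P(1)] by (intro image_eqI[of _ _ P']) auto
    qed
  qed
qed

lemma finite_eval_points: "finite eval_points"
  using bij_betw_finite[OF eval_points_coordinates] by simp

end

section \<open>Duality for polynomial evaluations\<close>

text \<open>
  A function \<open>u\<close> on a finite field is interpolated by \<open>\<Sum>a. u a (1 - (X - a)^(q-1))\<close>, whose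
  coefficients are, up to binomial factors, the moments \<open>\<Sum>a. u a a^k\<close>. So vanishing of the first
  \<open>r\<close> moments lowers the degree by \<open>r\<close>.
\<close>

lemma interpolation_moments:
  fixes u :: "'a::{finite,field} \<Rightarrow> 'a"
  assumes mom: "\<And>i. i < r \<Longrightarrow> (\<Sum>a\<in>UNIV. u a * a ^ i) = 0"
  obtains h where "\<And>a. poly h a = u a" "\<And>i. coeff h i \<noteq> 0 \<Longrightarrow> i + r \<le> CARD('a) - 1"
proof -
  let ?m = "CARD('a) - 1"
  have m: "?m \<ge> 1" using card_field_ge_2[where 'a = 'a] by simp
  define c where "c k = of_nat (?m choose k) * (\<Sum>a\<in>UNIV. u a * (- a) ^ (?m - k))" for k
  define h where "h = [:\<Sum>a\<in>UNIV. u a:] - (\<Sum>k\<le>?m. monom (c k) k)"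
  have "poly h b = u b" for b
  proof -
    have "poly (\<Sum>k\<le>?m. monom (c k) k) b
        = (\<Sum>k\<le>?m. \<Sum>a\<in>UNIV. u a * (of_nat (?m choose k) * b ^ k * (- a) ^ (?m - k)))"
      by (simp add: poly_sum poly_monom c_def sum_distrib_left sum_distrib_right mult_ac)
    also have "\<dots> = (\<Sum>a\<in>UNIV. u a * (b + - a) ^ ?m)"
      unfolding binomial_ring by (subst sum.swap) (simp add: sum_distrib_left)
    finally have "poly h b = (\<Sum>a\<in>UNIV. u a - u a * (b - a) ^ ?m)"
      by (simp add: h_def sum_subtractf)
    also have "\<dots> = (\<Sum>a\<in>UNIV. if a = b then u a else 0)"
    proof (rule sum.cong)
      show "u a - u a * (b - a) ^ ?m = (if a = b then u a else 0)" for a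
        using power_card_minus_1_field[of "b - a"] m by (auto simp: power_0_left)
    qed simp
    finally show ?thesis by simp
  qed
  moreover have "i + r \<le> ?m" if i: "coeff h i \<noteq> 0" for i
  proof (rule ccontr)
    assume lt: "\<not> i + r \<le> ?m"
    have 0: "coeff [:\<Sum>a\<in>UNIV. u a:] i = 0"
    proof (cases "i = 0")
      case True
      then show ?thesis using mom[of 0] lt m by simp
    qed (simp add: coeff_pCons split: nat.split)
    have "(\<Sum>a\<in>UNIV. u a * (- a) ^ k) = (- 1) ^ k * (\<Sum>a\<in>UNIV. u a * a ^ k)" for k
      unfolding sum_distrib_left
      by (rule sum.cong, simp, subst power_minus) (simp add: mult_ac)
    then have c0: "c i = 0" if "i \<le> ?m" using mom[of "?m - i"] lt that by (simp add: c_def)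
    have "coeff (\<Sum>k\<le>?m. monom (c k) k) i = (if i \<le> ?m then c i else 0)"
      by (simp add: coeff_sum coeff_monom)
    then show False using i 0 c0 by (simp add: h_def split: if_splits)
  qed
  ultimately show ?thesis using that by blast
qed

lemma prod_linear_dvd:
  fixes H :: "'a::field poly"
  assumes "finite A" "\<And>a. a \<in> A \<Longrightarrow> poly H a = 0"
  shows "(\<Prod>a\<in>A. [:- a, 1:]) dvd H"
  using assms
proof (induction A rule: finite_induct)
  case (insert a A)
  then obtain K where K: "H = (\<Prod>a\<in>A. [:- a, 1:]) * K" by (auto elim: dvdE)
  have "poly (\<Prod>a\<in>A. [:- a, 1:]) a \<noteq> 0" using insert.hyps by (simp add: poly_prod prod_zero_iff)
  moreover have "poly H a = 0" using insert.prems by simp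
  ultimately have "poly K a = 0" by (simp add: K)
  then have "[:- a, 1:] dvd K" by (simp only: poly_eq_0_iff_dvd)
  then have "(\<Prod>a\<in>A. [:- a, 1:]) * [:- a, 1:] dvd H" unfolding K by (rule mult_dvd_mono[OF dvd_refl])
  then show ?case unfolding prod.insert[OF insert.hyps] by (simp only: mult.commute)
qed simp

lemma sum_powers_unity_root:
  fixes z :: "'a::field"
  assumes "z ^ n = 1"
  shows "(\<Sum>j<n. z ^ j) = (if z = 1 then of_nat n else 0)"
proof -
  have "(z - 1) * (\<Sum>j<n. z ^ j) = 0" using assms power_diff_1_eq[of z n] by simp
  then show ?thesis by (auto simp: mult_eq_0_iff)
qed

context split_superelliptic
begin

lemma fibre_nonzero:
  assumes "poly f a \<noteq> 0" "b \<in> fibre a"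
  shows "b \<noteq> 0"
  using assms n by (auto simp: fibre_def power_0_left)

text \<open>
  The Fourier transform on the fibres splits a word orthogonal to the monomials \<open>x^i y^l\<close> of the
  code into words on the line with factors \<open>y^j\<close>. The \<open>j\<close>-th one, multiplied by \<open>f\<close> if \<open>j\<close> is
  positive, is orthogonal to a Reed-Solomon code. Interpolation bounds the degree of that product,
  and division by \<open>f\<close> lowers it by \<open>d\<close>.
\<close>

lemma orthogonal_expansion:
  fixes W :: "'a \<Rightarrow> 'a \<Rightarrow> 'a" and s :: nat
  assumes \<Lambda>: "\<And>a. a \<in> \<Lambda> \<Longrightarrow> poly f a \<noteq> 0"
    and orth: "\<And>i l. i * inf_e + l * inf_d \<le> s
      \<Longrightarrow> (\<Sum>a\<in>\<Lambda>. \<Sum>b\<in>fibre a. W a b * (a ^ i * b ^ l)) = 0"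
    and s: "(CARD('a) - 1) * inf_e \<le> 2 * s + 1"
  obtains h where "\<And>j i. j < n \<Longrightarrow> coeff (h j) i \<noteq> 0 \<Longrightarrow> i * inf_e + j * inf_d \<le> s"
    and "\<And>a b. a \<in> \<Lambda> \<Longrightarrow> b \<in> fibre a \<Longrightarrow> W a b = (\<Sum>j<n. poly (h j) a * b ^ j)"
proof -
  define w where "w j a = inverse (of_nat n) * (\<Sum>b\<in>fibre a. W a b * inverse b ^ j)" for j a
  have moments: "\<exists>H r. (\<forall>a. poly H a = (if a \<in> \<Lambda> then inverse (of_nat n) * (\<Sum>b\<in>fibre a. W a b * b ^ l) else 0))
      \<and> (\<forall>i. coeff H i \<noteq> 0 \<longrightarrow> i + r \<le> CARD('a) - 1) \<and> r * inf_e + l * inf_d > s" for l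
  proof -
    define r where "r = (LEAST i. i * inf_e + l * inf_d > s)"
    have "Suc s * inf_e + l * inf_d > s" using inf_gcd(4) by (cases inf_e) auto
    then have r: "r * inf_e + l * inf_d > s" unfolding r_def by (rule LeastI)
    have r': "i * inf_e + l * inf_d \<le> s" if "i < r" for i
      using not_less_Least[of i "\<lambda>i. i * inf_e + l * inf_d > s"] that by (simp add: r_def)
    let ?u = "\<lambda>a. if a \<in> \<Lambda> then inverse (of_nat n) * (\<Sum>b\<in>fibre a. W a b * b ^ l) else 0"
    have mom: "(\<Sum>a\<in>UNIV. ?u a * a ^ i) = 0" if "i < r" for i
    proof -
      have "(\<Sum>a\<in>UNIV. ?u a * a ^ i) = (\<Sum>a\<in>\<Lambda>. ?u a * a ^ i)"
        by (rule sum.mono_neutral_right) auto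
      also have "\<dots> = inverse (of_nat n) * (\<Sum>a\<in>\<Lambda>. \<Sum>b\<in>fibre a. W a b * (a ^ i * b ^ l))"
        unfolding sum_distrib_left
        by (rule sum.cong) (simp_all add: sum_distrib_left sum_distrib_right mult_ac)
      finally show ?thesis using orth[OF r'[OF that]] by simp
    qed
    obtain H where "\<And>a. poly H a = ?u a" "\<And>i. coeff H i \<noteq> 0 \<Longrightarrow> i + r \<le> CARD('a) - 1"
      using interpolation_moments[of r ?u, OF mom] by metis
    then show ?thesis using r by blast
  qed
  \<comment> \<open>Here \<open>j + l\<close> is \<open>0\<close> or \<open>n\<close>, and \<open>k\<close> counts the factors \<open>f\<close> gained from \<open>b^n = f(a)\<close>.\<close>
  have bound: "i * inf_e + j * inf_d \<le> s"
    if "i + k * degree f + r \<le> CARD('a) - 1" "r * inf_e + l * inf_d > s" "j + l = k * n" for i j k l r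
  proof (rule ccontr)
    assume "\<not> ?thesis"
    then have "2 * s + 2 \<le> i * inf_e + r * inf_e + (j + l) * inf_d"
      using that(2) by (simp add: add_mult_distrib)
    also have "(j + l) * inf_d = k * degree f * inf_e"
      unfolding that(3) using inf_gcd(1,2) by (metis mult.assoc mult.commute)
    finally have "2 * s + 2 \<le> (i + k * degree f + r) * inf_e" by (simp add: add_mult_distrib)
    also have "\<dots> \<le> (CARD('a) - 1) * inf_e" using that(1) by (rule mult_right_mono) simp
    finally show False using s by simp
  qed
  have "\<exists>h. (\<forall>a\<in>\<Lambda>. poly h a = w j a) \<and> (\<forall>i. coeff h i \<noteq> 0 \<longrightarrow> i * inf_e + j * inf_d \<le> s)"
    if j: "j < n" for j
  proof (cases "j = 0")
    case True
    obtain H r where H: "\<And>a. poly H a = (if a \<in> \<Lambda> then inverse (of_nat n) * (\<Sum>b\<in>fibre a. W a b * b ^ 0) else 0)"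
      "\<And>i. coeff H i \<noteq> 0 \<Longrightarrow> i + r \<le> CARD('a) - 1" "r * inf_e + 0 * inf_d > s"
      using moments[of 0] by blast
    have "i * inf_e + j * inf_d \<le> s" if "coeff H i \<noteq> 0" for i
      using bound[of i 0 r 0 j] H(2)[OF that] H(3) True by simp
    moreover have "poly H a = w j a" if "a \<in> \<Lambda>" for a using that True by (simp add: H(1) w_def)
    ultimately show ?thesis by blast
  next
    case False
    obtain H r where H: "\<And>a. poly H a = (if a \<in> \<Lambda> then inverse (of_nat n) * (\<Sum>b\<in>fibre a. W a b * b ^ (n - j)) else 0)"
      "\<And>i. coeff H i \<noteq> 0 \<Longrightarrow> i + r \<le> CARD('a) - 1" "r * inf_e + (n - j) * inf_d > s"
      using moments[of "n - j"] by blast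
    have "(\<Prod>a\<in>roots. [:- a, 1:]) dvd H"
    proof (rule prod_linear_dvd[OF finite_roots])
      fix a assume "a \<in> roots"
      then have "a \<notin> \<Lambda>" using \<Lambda> poly_f by blast
      then show "poly H a = 0" by (simp add: H(1))
    qed
    then have "f dvd H" by (subst split) (simp add: smult_dvd f_nonzero)
    then obtain h where h: "H = f * h" by (auto elim: dvdE)
    have "i * inf_e + j * inf_d \<le> s" if "coeff h i \<noteq> 0" for i
    proof -
      have h0: "h \<noteq> 0" using that by auto
      then have deg: "degree H = degree f + degree h" and "H \<noteq> 0"
        using f_nonzero by (auto simp: h degree_mult_eq)
      have "lead_coeff H \<noteq> 0" using \<open>H \<noteq> 0\<close> by simp
      with deg have "degree f + degree h + r \<le> CARD('a) - 1" using H(2) by metis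
      moreover have "i \<le> degree h" using that by (rule le_degree)
      ultimately show ?thesis using bound[of i 1 r "n - j" j] H(3) j by simp
    qed
    moreover have "poly h a = w j a" if a: "a \<in> \<Lambda>" for a
    proof -
      have "(\<Sum>b\<in>fibre a. W a b * b ^ (n - j)) = poly f a * (\<Sum>b\<in>fibre a. W a b * inverse b ^ j)"
        unfolding sum_distrib_left
      proof (rule sum.cong)
        fix b assume b: "b \<in> fibre a"
        have "b \<noteq> 0" by (rule fibre_nonzero[OF \<Lambda>[OF a] b])
        then have "b ^ (n - j) = b ^ n * inverse b ^ j" using j by (simp add: power_diff field_simps)
        also have "b ^ n = poly f a" using b by (simp add: fibre_def)
        finally show "W a b * b ^ (n - j) = poly f a * (W a b * inverse b ^ j)" by simp
      qed simp
      then have "poly f a * poly h a = poly f a * w j a"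
        using H(1)[of a] a by (simp add: h w_def)
      then show ?thesis using \<Lambda>[OF a] by simp
    qed
    ultimately show ?thesis by blast
  qed
  then obtain h where h: "\<And>j a. j < n \<Longrightarrow> a \<in> \<Lambda> \<Longrightarrow> poly (h j) a = w j a"
    "\<And>j i. j < n \<Longrightarrow> coeff (h j) i \<noteq> 0 \<Longrightarrow> i * inf_e + j * inf_d \<le> s"
    by metis
  have "W a b = (\<Sum>j<n. poly (h j) a * b ^ j)" if a: "a \<in> \<Lambda>" and b: "b \<in> fibre a" for a b
  proof -
    note nz = fibre_nonzero[OF \<Lambda>[OF a]]
    have "(\<Sum>j<n. poly (h j) a * b ^ j)
        = (\<Sum>j<n. \<Sum>b'\<in>fibre a. inverse (of_nat n) * W a b' * (b / b') ^ j)"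
    proof (rule sum.cong)
      fix j assume "j \<in> {..<n}"
      then have "poly (h j) a = w j a" using h(1) a by simp
      then show "poly (h j) a * b ^ j = (\<Sum>b'\<in>fibre a. inverse (of_nat n) * W a b' * (b / b') ^ j)"
        by (simp add: w_def sum_distrib_left sum_distrib_right power_mult_distrib power_inverse divide_inverse mult_ac)
    qed simp
    also have "\<dots> = (\<Sum>b'\<in>fibre a. inverse (of_nat n) * W a b' * (\<Sum>j<n. (b / b') ^ j))"
      by (subst sum.swap) (simp add: sum_distrib_left)
    also have "\<dots> = (\<Sum>b'\<in>fibre a. if b' = b then W a b else 0)"
    proof (rule sum.cong)
      fix b' assume b': "b' \<in> fibre a"
      have "(b / b') ^ n = 1" using b b' \<Lambda>[OF a] by (simp add: fibre_def power_divide)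
      then have "(\<Sum>j<n. (b / b') ^ j) = (if b / b' = 1 then of_nat n else 0)"
        by (rule sum_powers_unity_root)
      moreover have "b / b' = 1 \<longleftrightarrow> b' = b" using nz[OF b'] by auto
      ultimately show "inverse (of_nat n) * W a b' * (\<Sum>j<n. (b / b') ^ j) = (if b' = b then W a b else 0)"
        using n_nonzero(1) by simp
    qed simp
    also have "\<dots> = W a b" using b by simp
    finally show ?thesis by simp
  qed
  then show ?thesis using that h(2) by blast
qed

end

section \<open>The code and its dual\<close>

context constant_embedding
begin

lemma RR_space_iff:
  "h \<in> RR_space \<iota> G \<longleftrightarrow>
    h = 0 \<or> (\<forall>P. 0 \<le> (if P \<in> places \<iota> then P h else 0) + G P)"
  by (auto simp: RR_space_def principal_divisor_def le_fun_def)

lemma RR_spaceD: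
  assumes "h \<in> RR_space \<iota> G" "h \<noteq> 0"
  shows "P \<in> places \<iota> \<Longrightarrow> 0 \<le> P h + G P" "P \<notin> places \<iota> \<Longrightarrow> 0 \<le> G P"
  using assms spec[of "\<lambda>P. 0 \<le> (if P \<in> places \<iota> then P h else 0) + G P" P]
  by (simp_all add: RR_space_iff)

lemma RR_spaceI:
  assumes "\<And>P. P \<in> places \<iota> \<Longrightarrow> 0 \<le> P h + G P" "\<And>P. P \<notin> places \<iota> \<Longrightarrow> 0 \<le> G P"
  shows "h \<in> RR_space \<iota> G"
  using assms by (simp add: RR_space_iff)

lemma RR_space_0: "0 \<in> RR_space \<iota> G" by (simp add: RR_space_iff)

lemma RR_space_add:
  assumes "g \<in> RR_space \<iota> G" "h \<in> RR_space \<iota> G"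
  shows "g + h \<in> RR_space \<iota> G"
proof (cases "g = 0 \<or> h = 0 \<or> g + h = 0")
  case True
  then show ?thesis using assms RR_space_0 by fastforce
next
  case False
  show ?thesis
  proof (rule RR_spaceI)
    fix P assume P: "P \<in> places \<iota>"
    then have "0 \<le> P g + G P" "0 \<le> P h + G P" using assms False by (auto intro: RR_spaceD)
    then show "0 \<le> P (g + h) + G P" using place_add[OF P, of g h] False by simp
  next
    fix P assume "P \<notin> places \<iota>"
    then show "0 \<le> G P" using RR_spaceD(2)[OF assms(1)] False by simp
  qed
qed

lemma RR_space_scale:
  assumes "h \<in> RR_space \<iota> G"
  shows "\<iota> a * h \<in> RR_space \<iota> G"
proof (cases "a = 0 \<or> h = 0")
  case True
  then show ?thesis by (auto simp: RR_space_0)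
next
  case False
  have "P (\<iota> a * h) = P h" if "P \<in> places \<iota>" for P
    using place_mult[OF that, of "\<iota> a" h] place_iota[OF that] False by simp
  note eq = this
  show ?thesis
  proof (rule RR_spaceI)
    fix P assume P: "P \<in> places \<iota>"
    show "0 \<le> P (\<iota> a * h) + G P" unfolding eq[OF P] using RR_spaceD(1)[OF assms _ P] False by simp
  qed (use RR_spaceD(2)[OF assms] False in simp)
qed

lemma RR_space_sum: "(\<And>i. i \<in> A \<Longrightarrow> g i \<in> RR_space \<iota> G) \<Longrightarrow> sum g A \<in> RR_space \<iota> G"
  by (induction A rule: infinite_finite_induct) (auto intro: RR_space_0 RR_space_add)

end

context split_superelliptic
begin

lemma monomial_in_RR_space:
  assumes "i * inf_e + j * inf_d \<le> s"
  shows "x ^ i * y ^ j \<in> RR_space \<iota> (G_divisor \<iota> x s)"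
proof (rule RR_spaceI)
  fix P assume True: "P \<in> places \<iota>"
  show "0 \<le> P (x ^ i * y ^ j) + G_divisor \<iota> x s P"
    proof (cases "P x < 0")
      case inf: True
      have "P (x ^ i * y ^ j) = - int (i * inf_e + j * inf_d)"
        using x_nonzero y_nonzero infinite_place_orders(1,2)[OF True inf]
        by (simp add: place_mult[OF True] place_power[OF True])
      moreover have "int (i * inf_e + j * inf_d) \<le> int s" using assms by (simp only: of_nat_le_iff)
      ultimately show ?thesis using True inf by (simp only: G_divisor_def D_infinity_def) simp
    next
      case fin: False
      then have "x \<in> place_ring P" by (simp add: place_ring_def regular_at_def)
      then have "y \<in> place_ring P"
        by (rule y_integral[OF valuation_ring_place[OF True] iota_place_ring[OF True]])
      then have "0 \<le> P y" using y_nonzero by (simp add: place_ring_def regular_at_def)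
      then have "0 \<le> P (x ^ i * y ^ j)"
        using fin x_nonzero y_nonzero by (simp add: place_mult[OF True] place_power[OF True])
      then show ?thesis using True fin by (simp add: G_divisor_def D_infinity_def)
    qed
qed (simp add: G_divisor_def D_infinity_def)

lemma RR_space_regular:
  assumes P: "P \<in> eval_points" and h: "h \<in> RR_space \<iota> (G_divisor \<iota> x s)"
  shows "h \<in> place_ring P"
proof -
  note E = eval_point[OF P]
  have "\<not> P x < 0" using E(3) x_nonzero by (auto simp: place_ring_def regular_at_def)
  then have "G_divisor \<iota> x s P = 0" by (simp add: G_divisor_def D_infinity_def)
  then show ?thesis
    using RR_spaceD(1)[OF h _ E(2)] by (auto simp: place_ring_def regular_at_def)
qed

text \<open>
  The expansion of an orthogonal word exhibits it as the evaluation of a combination of monomials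
  of the code.
\<close>

theorem dual_code_subset:
  assumes s: "(CARD('a) - 1) * inf_e \<le> 2 * s + 1"
  defines "D \<equiv> D_evaluation \<iota> f x"
  defines "C \<equiv> AG_code \<iota> D (G_divisor \<iota> x s)"
  shows "dual_code D C \<subseteq> C"
proof
  fix w assume w: "w \<in> dual_code D C"
  let ?G = "G_divisor \<iota> x s"
  let ?pt = "\<lambda>P. (X_at P, Y_at P)"
  let ?E = "SIGMA a:eval_abscissae. fibre a"
  have S: "Supp D = eval_points" by (simp add: eval_points_def D_def)
  define W where "W a b = w (inv_into eval_points ?pt (a, b))" for a b
  have WP: "W (X_at P) (Y_at P) = w P" if "P \<in> eval_points" for P
    unfolding W_def using eval_points_coordinates that
    by (simp add: bij_betw_def inv_into_f_f[of ?pt])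
  have orth: "(\<Sum>a\<in>eval_abscissae. \<Sum>b\<in>fibre a. W a b * (a ^ i * b ^ l)) = 0"
    if il: "i * inf_e + l * inf_d \<le> s" for i l
  proof -
    have "(\<Sum>a\<in>eval_abscissae. \<Sum>b\<in>fibre a. W a b * (a ^ i * b ^ l))
        = (\<Sum>(a, b)\<in>?E. W a b * (a ^ i * b ^ l))"
      by (rule sum.Sigma) auto
    also have "\<dots> = (\<Sum>P\<in>eval_points. W (X_at P) (Y_at P) * (X_at P ^ i * Y_at P ^ l))"
      using sum.reindex_bij_betw[OF eval_points_coordinates,
          of "\<lambda>(a, b). W a b * (a ^ i * b ^ l)"] by simp
    also have "\<dots> = (\<Sum>P\<in>eval_points. w P * value_at \<iota> P (x ^ i * y ^ l))"
    proof (rule sum.cong)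
      fix P assume P: "P \<in> eval_points"
      note E = eval_point[OF P]
      note VI = valuation_ring_intros[OF rational_ring[OF E(1)]]
      show "W (X_at P) (Y_at P) * (X_at P ^ i * Y_at P ^ l) = w P * value_at \<iota> P (x ^ i * y ^ l)"
        using WP[OF P] E(3,4) VI(7) by (simp add: value_at_mult[OF E(1)] value_at_power[OF E(1)])
    qed simp
    also have "\<dots> = 0"
    proof -
      have "(\<lambda>P. if P \<in> Supp D then value_at \<iota> P (x ^ i * y ^ l) else 0) \<in> C"
        unfolding C_def AG_code_def using monomial_in_RR_space[OF il] by blast
      then have "(\<Sum>P\<in>Supp D. w P * (if P \<in> Supp D then value_at \<iota> P (x ^ i * y ^ l) else 0)) = 0"
        using w unfolding dual_code_def mem_Collect_eq by (rule bspec[OF conjunct2, rotated])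
      then show ?thesis by (simp add: S)
    qed
    finally show ?thesis .
  qed
  obtain h where h: "\<And>j i. j < n \<Longrightarrow> coeff (h j) i \<noteq> 0 \<Longrightarrow> i * inf_e + j * inf_d \<le> s"
    "\<And>a b. a \<in> eval_abscissae \<Longrightarrow> b \<in> fibre a \<Longrightarrow> W a b = (\<Sum>j<n. poly (h j) a * b ^ j)"
    using orthogonal_expansion[OF eval_abscissae_nonroot orth s] by blast
  define \<Phi> where "\<Phi> = (\<Sum>j<n. ev (h j) x * y ^ j)"
  have "\<Phi> = (\<Sum>j<n. \<Sum>i\<le>degree (h j). \<iota> (coeff (h j) i) * (x ^ i * y ^ j))"
    unfolding \<Phi>_def ev_altdef by (simp add: sum_distrib_right mult.assoc)
  also have "\<dots> \<in> RR_space \<iota> ?G"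
  proof (intro RR_space_sum)
    fix j i assume "j \<in> {..<n}"
    then show "\<iota> (coeff (h j) i) * (x ^ i * y ^ j) \<in> RR_space \<iota> ?G"
      using RR_space_scale[OF monomial_in_RR_space, of i j s "coeff (h j) i"] h(1)[of j i] RR_space_0
      by (cases "coeff (h j) i = 0") auto
  qed
  finally have \<Phi>: "\<Phi> \<in> RR_space \<iota> ?G" .
  have "w = (\<lambda>P. if P \<in> Supp D then value_at \<iota> P \<Phi> else 0)"
  proof
    fix P
    show "w P = (if P \<in> Supp D then value_at \<iota> P \<Phi> else 0)"
    proof (cases "P \<in> eval_points")
      case True
      note E = eval_point[OF True]
      note VI = valuation_ring_intros[OF rational_ring[OF E(1)]]
      have evV: "ev g x \<in> place_ring P" for g
        by (rule ev_in_subring[OF valuation_ring_subring[OF rational_ring[OF E(1)]] rational_const[OF E(1)] E(3)])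
      have "value_at \<iota> P \<Phi> = (\<Sum>j<n. value_at \<iota> P (ev (h j) x * y ^ j))"
        unfolding \<Phi>_def by (rule value_at_sum[OF E(1)]) (intro VI evV E(4))
      also have "\<dots> = (\<Sum>j<n. poly (h j) (X_at P) * Y_at P ^ j)"
        using evV VI(7)[OF E(4)]
        by (simp add: value_at_mult[OF E(1)] value_at_power[OF E(1) E(4)] value_at_ev[OF E(1) E(3)])
      also have "\<dots> = W (X_at P) (Y_at P)"
        using h(2)[of "X_at P" "Y_at P"] True E(6) by (simp add: eval_abscissae_def fibre_def)
      finally show ?thesis using True WP[OF True] S by simp
    next
      case False
      then show ?thesis using w S by (auto simp: dual_code_def word_space_def)
    qed
  qed
  then show "w \<in> C" unfolding C_def AG_code_def using \<Phi> by blast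
qed

end

section \<open>Dimensions\<close>

interpretation words: vector_space "word_scale :: 'a::field \<Rightarrow> ('k, 'a) codeword \<Rightarrow> ('k, 'a) codeword"
  by (rule vector_space_word_scale)

definition dot :: "'k divisor \<Rightarrow> ('k, 'a::field) codeword \<Rightarrow> ('k, 'a) codeword \<Rightarrow> 'a" where
  "dot D v w = (\<Sum>P\<in>Supp D. v P * w P)"

lemma dual_code_dot: "dual_code D B = {w \<in> word_space D. \<forall>v\<in>B. dot D w v = 0}"
  by (simp add: dual_code_def dot_def)

lemma dot_linear:
  "dot D (v + v') w = dot D v w + dot D v' w" "dot D (word_scale a v) w = a * dot D v w"
  "dot D w (v + v') = dot D w v + dot D w v'" "dot D w (word_scale a v) = a * dot D w v"
  "dot D 0 w = 0" "dot D w 0 = 0"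
  by (simp_all add: dot_def word_scale_def sum.distrib sum_distrib_left algebra_simps)

lemma subspace_dual_code: "words.subspace (dual_code D B)"
  unfolding dual_code_dot word_space_def
  by (rule words.subspaceI) (auto simp: dot_linear, simp add: word_scale_def)

lemma dual_code_span: "dual_code D (words.span B) = dual_code D B"
proof
  show "dual_code D (words.span B) \<subseteq> dual_code D B"
    using words.span_superset[of B] by (auto simp: dual_code_dot)
  show "dual_code D B \<subseteq> dual_code D (words.span B)"
  proof
    fix w assume w: "w \<in> dual_code D B"
    have "dot D w v = 0" if "v \<in> words.span B" for v
      using that
    proof (induction rule: words.span_induct)
      case base
      show ?case by (rule words.subspaceI) (auto simp: dot_linear)
    next
      case (step v)
      then show ?case using w by (simp add: dual_code_dot)
    qed
    then show "w \<in> dual_code D (words.span B)" using w by (simp add: dual_code_dot)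
  qed
qed

lemma sum_fun_apply: "sum g A P = (\<Sum>i\<in>A. g i P)"
  by (induction A rule: infinite_finite_induct) auto

definition unit_word :: "'k point \<Rightarrow> ('k, 'a::field) codeword" where
  "unit_word P = (\<lambda>Q. if Q = P then 1 else 0)"

context
  fixes D :: "'k divisor"
  assumes fin: "finite (Supp D)"
begin

lemma dot_unit_word:
  assumes "P \<in> Supp D"
  shows "dot D w (unit_word P) = w P"
proof -
  have "dot D w (unit_word P) = (\<Sum>Q\<in>Supp D. if Q = P then w P else 0)"
    unfolding dot_def by (rule sum.cong) (auto simp: unit_word_def)
  then show ?thesis using fin assms by simp
qed

lemma word_space_span: "word_space D \<subseteq> words.span (unit_word ` Supp D)"
proof
  fix w :: "('k, 'b::field) codeword" assume w: "w \<in> word_space D"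
  have "w = (\<Sum>P\<in>Supp D. word_scale (w P) (unit_word P))"
  proof
    fix Q
    have "(\<Sum>P\<in>Supp D. word_scale (w P) (unit_word P)) Q = (\<Sum>P\<in>Supp D. if Q = P then w Q else 0)"
      unfolding sum_fun_apply by (rule sum.cong) (auto simp: word_scale_def unit_word_def)
    also have "\<dots> = w Q" using fin w by (auto simp: word_space_def)
    finally show "w Q = (\<Sum>P\<in>Supp D. word_scale (w P) (unit_word P)) Q" by simp
  qed
  also have "\<dots> \<in> words.span (unit_word ` Supp D)"
    by (intro words.span_sum words.span_scale words.span_base) auto
  finally show "w \<in> words.span (unit_word ` Supp D)" .
qed

lemma independent_word_space_finite:
  assumes "words.independent B" "B \<subseteq> word_space D"
  shows "finite B"
proof -
  have "B \<subseteq> words.span (unit_word ` Supp D)" using assms(2) word_space_span by (rule order.trans)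
  from words.independent_span_bound[OF finite_imageI[OF fin] assms(1) this] show ?thesis by simp
qed

lemma dim_word_space: "words.dim (word_space D :: ('k, 'b::field) codeword set) = card (Supp D)"
proof -
  let ?e = "unit_word :: 'k point \<Rightarrow> ('k, 'b) codeword"
  have inj: "inj_on ?e (Supp D)"
    by (rule inj_onI) (metis unit_word_def zero_neq_one)
  have "words.independent (?e ` Supp D)"
    unfolding words.independent_explicit_finite_subsets
  proof (intro allI impI ballI)
    fix T u v assume T: "T \<subseteq> ?e ` Supp D" "finite T" "(\<Sum>v\<in>T. word_scale (u v) v) = 0" "v \<in> T"
    then obtain P where P: "P \<in> Supp D" "v = ?e P" by auto
    have "0 = (\<Sum>v\<in>T. word_scale (u v) v) P" using T(3) by simp
    also have "\<dots> = (\<Sum>v'\<in>T. if v' = v then u v else 0)"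
      unfolding sum_fun_apply
    proof (rule sum.cong)
      fix v' assume "v' \<in> T"
      then obtain P' where P': "P' \<in> Supp D" "v' = ?e P'" using T(1) by auto
      then have "v' = v \<longleftrightarrow> P = P'" using P inj_on_eq_iff[OF inj P'(1) P(1)] by auto
      moreover have "v' P = (if P = P' then 1 else 0)" unfolding P'(2) by (simp add: unit_word_def)
      ultimately show "word_scale (u v') v' P = (if v' = v then u v else 0)"
        by (cases "v' = v") (simp_all add: word_scale_def)
    qed simp
    also have "\<dots> = u v" using T by simp
    finally show "u v = 0" by simp
  qed
  then have "words.dim (word_space D :: ('k, 'b) codeword set) = card (?e ` Supp D)"
    by (intro words.dim_unique[OF _ word_space_span _ refl]) (auto simp: word_space_def unit_word_def)
  then show ?thesis by (simp add: card_image[OF inj])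
qed

text \<open>The kernel of a linear form, together with one vector outside of it, spans the space.\<close>

lemma dim_dual_code_insert:
  fixes B :: "('k, 'b::field) codeword set"
  shows "words.dim (dual_code D B) \<le> words.dim (dual_code D (insert v B)) + 1"
proof -
  let ?U = "dual_code D B" and ?U' = "dual_code D (insert v B)"
  obtain T where T: "T \<subseteq> ?U'" "words.independent T" "?U' \<subseteq> words.span T" "card T = words.dim ?U'"
    by (rule words.basis_exists)
  have finT: "finite T"
    by (rule independent_word_space_finite[OF T(2)]) (use T(1) in \<open>auto simp: dual_code_def\<close>)
  show ?thesis
  proof (cases "\<exists>u\<in>?U. dot D u v \<noteq> 0")
    case False
    then have "?U \<subseteq> ?U'" by (auto simp: dual_code_dot)
    then have "words.dim ?U \<le> card T" using T finT by (intro words.dim_le_card) auto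
    then show ?thesis using T by simp
  next
    case True
    then obtain u where u: "u \<in> ?U" "dot D u v \<noteq> 0" by blast
    have "?U \<subseteq> words.span (insert u T)"
    proof
      fix w assume w: "w \<in> ?U"
      let ?a = "dot D w v / dot D u v"
      have "w + word_scale (- ?a) u \<in> ?U"
        by (intro words.subspace_add words.subspace_scale subspace_dual_code w u)
      moreover have "dot D (w + word_scale (- ?a) u) v = 0" unfolding dot_linear using u(2) by simp
      ultimately have "w + word_scale (- ?a) u \<in> ?U'" unfolding dual_code_dot by blast
      then have "w + word_scale (- ?a) u \<in> words.span (insert u T)"
        using T(3) words.span_mono[of T "insert u T"] by auto
      moreover have "word_scale ?a u \<in> words.span (insert u T)"
        by (intro words.span_scale words.span_base) simp
      ultimately have "w + word_scale (- ?a) u + word_scale ?a u \<in> words.span (insert u T)"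
        by (rule words.span_add)
      moreover have "w + word_scale (- ?a) u + word_scale ?a u = w"
        by (simp add: word_scale_def fun_eq_iff)
      ultimately show "w \<in> words.span (insert u T)" by simp
    qed
    then have "words.dim ?U \<le> card (insert u T)" using finT by (intro words.dim_le_card) auto
    also have "\<dots> \<le> card T + 1" using finT by (simp add: card_insert_if)
    finally show ?thesis using T by simp
  qed
qed

lemma dim_dual_code_union:
  fixes B :: "('k, 'b::field) codeword set"
  assumes "finite F"
  shows "words.dim (dual_code D B) \<le> words.dim (dual_code D (F \<union> B)) + card F"
  using assms
proof (induction F rule: finite_induct)
  case (insert v F)
  then show ?case using dim_dual_code_insert[of "F \<union> B" v] by simp
qed simp

text \<open>
  Going from no condition to a basis of the code and on to a basis of the whole space, the
  dimension of the orthogonal space falls from \<open>N\<close> to \<open>0\<close> in \<open>N\<close> steps, so by exactly one in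
  each step.
\<close>

theorem dim_dual_code:
  fixes C :: "('k, 'b::field) codeword set"
  assumes C: "words.subspace C" "C \<subseteq> word_space D"
  shows "words.dim (dual_code D C) + words.dim C = card (Supp D)"
proof -
  let ?W = "word_space D :: ('k, 'b) codeword set"
  obtain B where B: "B \<subseteq> C" "words.independent B" "C \<subseteq> words.span B" "card B = words.dim C"
    by (rule words.basis_exists)
  have "B \<subseteq> ?W" using B C by auto
  then obtain B' where B': "B \<subseteq> B'" "B' \<subseteq> ?W" "words.independent B'" "?W \<subseteq> words.span B'"
    using words.maximal_independent_subset_extend[OF _ B(2)] by blast
  have fin': "finite B'" by (rule independent_word_space_finite[OF B'(3,2)])
  have finB: "finite B" using B'(1) fin' by (rule finite_subset)
  have card': "card B' = card (Supp D)"
    using words.basis_card_eq_dim[OF B'(2,4,3)] by (simp add: dim_word_space)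
  have "words.span B = C" using B C by (simp add: words.span_subspace)
  then have dual: "dual_code D C = dual_code D B" using dual_code_span[of D B] by simp
  have "dual_code D {} = ?W" by (simp add: dual_code_def)
  then have "card (Supp D) \<le> words.dim (dual_code D B) + card B"
    using dim_dual_code_union[OF finB, of "{}"] by (simp add: dim_word_space)
  moreover have "words.dim (dual_code D B) \<le> words.dim (dual_code D B') + card (B' - B)"
    using dim_dual_code_union[of "B' - B" B] fin' B'(1) by (simp add: Un_absorb2)
  moreover have "words.dim (dual_code D B') = 0"
  proof -
    have "dual_code D B' \<subseteq> {0}"
    proof
      fix w assume w: "w \<in> dual_code D B'"
      then have "w \<in> dual_code D (words.span B')" by (simp add: dual_code_span)
      moreover have "unit_word P \<in> words.span B'" if "P \<in> Supp D" for P
        using B'(4) that by (auto simp: word_space_def unit_word_def)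
      ultimately have "w P = 0" if "P \<in> Supp D" for P
        using that dot_unit_word[OF that, of w] by (simp add: dual_code_dot)
      then show "w \<in> {0}" using w by (auto simp: dual_code_def word_space_def fun_eq_iff)
    qed
    then have "words.dim (dual_code D B') \<le> card ({} :: ('k, 'b) codeword set)"
      by (intro words.dim_le_card) auto
    then show ?thesis by simp
  qed
  moreover have "card (B' - B) + card B = card (Supp D)"
    using card_Diff_subset[OF finB B'(1)] card_mono[OF fin' B'(1)] card' by simp
  ultimately show ?thesis unfolding dual B(4)[symmetric] by linarith
qed

end

context constant_embedding
begin

lemma quotient_dim_eq_0:
  assumes "U \<subseteq> W" "0 \<in> W"
  shows "quotient_dim (field_scale \<iota>) U W = 0"
proof -
  have "quotient_basis (field_scale \<iota>) U W {}"
    using assms by (auto simp: quotient_basis_def)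
  moreover have "B = {}" if B: "quotient_basis (field_scale \<iota>) U W B" for B
  proof (rule ccontr)
    assume "B \<noteq> {}"
    then obtain b where b: "b \<in> B" by blast
    then have "(\<Sum>b\<in>{b}. field_scale \<iota> 1 b) \<in> W"
      using B assms by (auto simp: quotient_basis_def field_scale_def iota_1)
    then have "(1 :: 'a) = 0"
      using B b unfolding quotient_basis_def
      by (elim conjE) (drule spec[of _ "{b}"], drule spec[of _ "\<lambda>_. 1"], simp)
    then show False by simp
  qed
  ultimately have "(SOME B. finite B \<and> quotient_basis (field_scale \<iota>) U W B) = {}"
    and "\<exists>B. finite B \<and> quotient_basis (field_scale \<iota>) U W B"
    by (auto intro!: some_equality)
  then show ?thesis by (simp add: quotient_dim_def zero_enat_def)
qed

text \<open>Any two residues are linearly dependent over the constants, so every basis has one element.\<close>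

lemma place_degree_rational:
  assumes rat: "rational_place \<iota> P"
  shows "place_degree \<iota> P = 1"
proof -
  let ?U = "{h. regular_at P h}" and ?W = "{h. vanishes_at P h}"
  note P = rational_place_place[OF rat]
  note V = rational_ring[OF rat]
  have U: "?U = place_ring P" by (simp add: place_ring_def)
  have W: "?W = nonunits (place_ring P)" by (simp add: nonunits_place[OF P])
  have "quotient_basis (field_scale \<iota>) ?U ?W {1}"
    unfolding quotient_basis_def U W
  proof (intro conjI allI impI ballI)
    show "{1} \<subseteq> place_ring P" using valuation_ring_intros(1)[OF V] by simp
  next
    fix F u b assume F: "finite F" "F \<subseteq> {1}" "(\<Sum>b\<in>F. field_scale \<iota> (u b) b) \<in> nonunits (place_ring P)" "b \<in> F"
    then have "F = {1}" "b = 1" by auto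
    then have "\<iota> (u 1) \<in> nonunits (place_ring P)" using F(3) by (simp add: field_scale_def)
    then show "u b = 0" using \<open>b = 1\<close> iota_unit[OF V rational_const[OF rat]] by simp
  next
    fix h assume "h \<in> place_ring P"
    then have "h - (\<Sum>b\<in>{1}. field_scale \<iota> (value_at \<iota> P h) b) \<in> nonunits (place_ring P)"
      using value_at_residue[OF rat] by (simp add: field_scale_def)
    then show "\<exists>F u. finite F \<and> F \<subseteq> {1} \<and> h - (\<Sum>b\<in>F. field_scale \<iota> (u b) b) \<in> nonunits (place_ring P)"
      by (intro exI[of _ "{1}"] exI[of _ "\<lambda>_. value_at \<iota> P h"]) simp
  qed
  then have ex: "\<exists>B. finite B \<and> quotient_basis (field_scale \<iota>) ?U ?W B" by blast
  have card: "card B = 1" if B: "finite B" "quotient_basis (field_scale \<iota>) ?U ?W B" for B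
  proof -
    have BU: "B \<subseteq> place_ring P"
      and ind: "\<And>F u b. finite F \<Longrightarrow> F \<subseteq> B \<Longrightarrow> (\<Sum>b\<in>F. \<iota> (u b) * b) \<in> nonunits (place_ring P) \<Longrightarrow> b \<in> F \<Longrightarrow> u b = 0"
      and gen: "\<And>h. h \<in> place_ring P \<Longrightarrow> \<exists>F u. finite F \<and> F \<subseteq> B \<and> h - (\<Sum>b\<in>F. \<iota> (u b) * b) \<in> nonunits (place_ring P)"
      using B(2) unfolding quotient_basis_def U W field_scale_def by (blast, blast, blast)
    have "B \<noteq> {}"
      using gen[OF valuation_ring_intros(1)[OF V]] one_notin_nonunits[OF V] by auto
    then obtain b where b: "b \<in> B" by blast
    have "b' = b" if b': "b' \<in> B" for b'
    proof (rule ccontr)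
      assume ne: "b' \<noteq> b"
      let ?v = "value_at \<iota> P"
      let ?u = "\<lambda>c. if c = b then ?v b' else - ?v b"
      have bV: "b \<in> place_ring P" "b' \<in> place_ring P" using b b' BU by auto
      have "(\<Sum>c\<in>{b, b'}. \<iota> (?u c) * c) = \<iota> (?v b') * (b - \<iota> (?v b)) - \<iota> (?v b) * (b' - \<iota> (?v b'))"
        using ne by (simp add: iota_uminus algebra_simps)
      also have "\<dots> \<in> nonunits (place_ring P)"
        using rational_const[OF rat]
        by (intro nonunits_diff[OF V nonunits_mult(1)[OF V] nonunits_mult(1)[OF V]] value_at_residue[OF rat] bV) auto
      finally have "?u b' = 0" by (rule ind[rotated 2]) (use b b' in auto)
      then have "b \<in> nonunits (place_ring P)" using value_at_eq_0_iff[OF rat bV(1)] ne by simp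
      then have "(\<lambda>_. 1 :: 'a) b = 0" by (intro ind[of "{b}"]) (use b in \<open>auto simp: iota_1\<close>)
      then show False by simp
    qed
    then have "B = {b}" using b by blast
    then show ?thesis by simp
  qed
  have "card (SOME B. finite B \<and> quotient_basis (field_scale \<iota>) ?U ?W B) = 1"
    using someI_ex[OF ex] card by blast
  then show ?thesis unfolding place_degree_def quotient_dim_def using ex by simp
qed

end

context split_superelliptic
begin

lemma degree_D_evaluation: "divisor_degree \<iota> (D_evaluation \<iota> f x) = int (card eval_points)"
proof -
  have "divisor_degree \<iota> (D_evaluation \<iota> f x) = (\<Sum>P\<in>eval_points. 1)"
    unfolding divisor_degree_def eval_points_def[symmetric]
  proof (rule sum.cong)
    fix P assume P: "P \<in> eval_points"
    then have "D_evaluation \<iota> f x P = 1" by (simp add: eval_points_iff D_evaluation_def)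
    then show "D_evaluation \<iota> f x P * int (place_degree \<iota> P) = 1"
      by (simp add: place_degree_rational[OF eval_point(1)[OF P]])
  qed simp
  then show ?thesis by simp
qed

lemma AG_code_subspace:
  fixes s
  defines "D \<equiv> D_evaluation \<iota> f x"
  defines "C \<equiv> AG_code \<iota> D (G_divisor \<iota> x s)"
  shows "words.subspace C" "C \<subseteq> word_space D"
proof -
  let ?G = "G_divisor \<iota> x s"
  let ?w = "\<lambda>h P. if P \<in> Supp D then value_at \<iota> P h else 0"
  have C: "C = ?w ` RR_space \<iota> ?G" by (simp add: C_def AG_code_def)
  have S: "P \<in> eval_points \<longleftrightarrow> P \<in> Supp D" for P by (simp add: eval_points_def D_def)
  show "C \<subseteq> word_space D" by (auto simp: C word_space_def)
  show "words.subspace C"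
  proof (rule words.subspaceI)
    have "?w 0 = 0" using eval_point(1) by (auto simp: S value_at_0)
    then show "0 \<in> C" unfolding C by (intro image_eqI[OF _ RR_space_0]) (rule sym)
  next
    fix v w assume "v \<in> C" "w \<in> C"
    then obtain g h where gh: "g \<in> RR_space \<iota> ?G" "h \<in> RR_space \<iota> ?G" "v = ?w g" "w = ?w h"
      by (auto simp: C)
    have "?w (g + h) = v + w"
      unfolding gh(3,4) using gh(1,2) RR_space_regular eval_point(1)
      by (auto simp: S fun_eq_iff value_at_add)
    then show "v + w \<in> C" unfolding C by (intro image_eqI[OF _ RR_space_add[OF gh(1,2)]]) (rule sym)
  next
    fix a w assume "w \<in> C"
    then obtain h where h: "h \<in> RR_space \<iota> ?G" "w = ?w h" by (auto simp: C)
    have "?w (\<iota> a * h) = word_scale a w"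
    proof
      fix P
      show "?w (\<iota> a * h) P = word_scale a w P"
      proof (cases "P \<in> Supp D")
        case True
        then have P: "P \<in> eval_points" by (simp add: S)
        have "\<iota> a \<in> place_ring P" using rational_const[OF eval_point(1)[OF P]] by auto
        then show ?thesis
          using True RR_space_regular[OF P h(1)] eval_point(1)[OF P]
          by (simp add: h(2) word_scale_def value_at_mult value_at_iota)
      qed (simp add: h(2) word_scale_def)
    qed
    then show "word_scale a w \<in> C" unfolding C by (intro image_eqI[OF _ RR_space_scale[OF h(1)]]) (rule sym)
  qed
qed

text \<open>Here \<open>L(G \<or> A - D) = L(G - D)\<close> is the first summand of the denominator.\<close>

lemma excess_eq_0:
  assumes "A \<le> G"
  shows "excess \<iota> D G A = 0"
  unfolding excess_def
proof (rule quotient_dim_eq_0)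
  have sup: "sup G A = G" using assms by (simp add: sup_absorb1)
  show "subspace_sum (RR_space \<iota> G) (RR_space \<iota> A) \<inter> RR_space \<iota> (sup G A - D)
      \<subseteq> subspace_sum (RR_space \<iota> (G - D)) (RR_space \<iota> (A - D))"
  proof
    fix h assume "h \<in> subspace_sum (RR_space \<iota> G) (RR_space \<iota> A) \<inter> RR_space \<iota> (sup G A - D)"
    then have "h \<in> RR_space \<iota> (G - D)" by (simp add: sup)
    moreover have "h = h + 0" by simp
    ultimately show "h \<in> subspace_sum (RR_space \<iota> (G - D)) (RR_space \<iota> (A - D))"
      unfolding subspace_sum_def using RR_space_0 by blast
  qed
  have "(0 :: 'k) = 0 + 0" by simp
  then show "0 \<in> subspace_sum (RR_space \<iota> (G - D)) (RR_space \<iota> (A - D))"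
    unfolding subspace_sum_def using RR_space_0 by blast
qed

end

section \<open>The hull of the codes\<close>

theorem theorem7p8:
  fixes \<iota> :: "'a::{finite,field} \<Rightarrow> 'k::field"
    and x y :: 'k and f :: "'a poly" and n d q c s :: nat
    and M N :: int and D G A :: "'k divisor" and C :: "('k, 'a) codeword set"
  assumes q: "q = CARD('a)"
    and n: "n \<ge> 2" "n dvd q - 1"
    and d: "d \<ge> 3" "degree f = d"
    and split: "\<exists>R. card R = d \<and> f = smult (lead_coeff f) (\<Prod>a\<in>R. [:- a, 1:])"
    and curve: "superelliptic_function_field \<iota> n f x y"
    and s: "s \<ge> 1"
    and c: "c = gcd n d"
    and M: "M = (int q - 1) * int n div int c - 1"
    and D: "D = D_evaluation \<iota> f x"
    and N: "N = divisor_degree \<iota> D"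
    and G: "G = G_divisor \<iota> x s"
    and A: "A = A_divisor \<iota> f x s"
    and C: "C = AG_code \<iota> D G"
  shows "\<not> G \<le> A \<and>
    (A \<le> G \<longleftrightarrow> 2 * int s \<ge> M) \<and>
    (2 * int s \<ge> M \<longrightarrow>
       dual_code D C \<subseteq> C \<and>
       excess \<iota> D G A = 0 \<and>
       Hull D C = dual_code D C \<and>
       int (code_dim (Hull D C)) = N - int (code_dim C))"
proof -
  obtain R where R: "card R = d" "f = smult (lead_coeff f) (\<Prod>a\<in>R. [:- a, 1:])"
    using split by blast
  interpret superelliptic_function_field \<iota> n f x y by (rule curve)
  interpret split_superelliptic \<iota> n f x y R
    by unfold_locales (use n d q R in auto)
  have "c = inf_gcd" using c d by (simp add: inf_gcd_def)
  then have "(int q - 1) * int n div int c = (int q - 1) * int inf_e"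
    using inf_gcd(1,3) by (metis int_ops(7) mult.left_commute nonzero_mult_div_cancel_left of_nat_0_less_iff less_irrefl)
  then have M': "M = (int CARD('a) - 1) * int inf_e - 1" using M q by simp
  have le_iff: "A \<le> G \<longleftrightarrow> 2 * int s \<ge> M" unfolding A G M' by (rule A_le_G_iff)
  have "dual_code D C \<subseteq> C \<and> excess \<iota> D G A = 0 \<and> Hull D C = dual_code D C
      \<and> int (code_dim (Hull D C)) = N - int (code_dim C)" if s: "2 * int s \<ge> M"
  proof -
    have "int ((CARD('a) - 1) * inf_e) \<le> int (2 * s + 1)"
      using s card_field_ge_2[where 'a = 'a] by (simp add: M' of_nat_diff)
    then have "(CARD('a) - 1) * inf_e \<le> 2 * s + 1" by (simp only: of_nat_le_iff)
    then have sub: "dual_code D C \<subseteq> C" unfolding C D G by (rule dual_code_subset)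
    then have hull: "Hull D C = dual_code D C" by (auto simp: Hull_def)
    have "finite (Supp D)" using finite_eval_points by (simp add: eval_points_def D)
    then have "words.dim (dual_code D C) + words.dim C = card (Supp D)"
      using AG_code_subspace[of s] by (intro dim_dual_code) (simp_all add: C D G)
    moreover have "N = int (card (Supp D))"
      unfolding N D degree_D_evaluation by (simp add: eval_points_def)
    ultimately have "int (code_dim (Hull D C)) = N - int (code_dim C)"
      unfolding code_dim_def hull by linarith
    moreover have "excess \<iota> D G A = 0" using excess_eq_0 le_iff s by blast
    ultimately show ?thesis using sub hull by blast
  qed
  moreover have "\<not> G \<le> A" unfolding A G by (rule G_not_le_A)
  ultimately show ?thesis using le_iff by blast
qed

end
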